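(* Let $H$ be a real Hilbert space, $d\in\mathbb{N}^*$, and let $C\subset H$ be a nonempty bounded closed convex subset with $\operatorname{diam}(C)\le d$. Let $T:C\to C$ be nonexpansive and let $\mathcal{G}:C\to C$ be a strict contraction with Lipschitz constant $\tau\in(0,1)$. Let $(\lambda_n)_{n\in\mathbb{N}}$ be a sequence in $(0,1]$ converging to $0$, let $h:\mathbb{N}\to\mathbb{N}^*$ satisfy $\lambda_n\ge \frac1{h(n)}$ for all $n\in\mathbb{N}$, and let $\chi:\mathbb{N}\to\mathbb{N}$ satisfy $\lambda_i\le\frac1{n+1}$ for all $n\in\mathbb{N}$ and all $i\ge\chi(n)$. Suppose that $\phi_1,\phi_2:(0,\infty)\to\mathbb{N}$ satisfy $\sum_{i=1}^{\phi_1(k)}\lambda_i\ge k$ for all real $k>0$, and $\frac{|\lambda_n-\lambda_{n+1}|}{\lambda_{n+1}^2}\le\varepsilon$ for all $\varepsilon>0$ and all $n\ge\phi_2(\varepsilon)$. Let $u_0\in C$ be arbitrary and define $u_{n+1}:=(1-\lambda_{n+1})Tu_n+\lambda_{n+1}\mathcal{G}(Tu_n)$ for $n\in\mathbb{N}$. Then for all $\varepsilon\in(0,1]$, $g:\mathbb{N}\to\mathbb{N}$ and $x\in C$, there exists an $n\le\Xi(\delta/6,g_c,\chi,h,d)+c$, where $$\delta:=\frac{\varepsilon}{2d(2+\tau)},\qquad c:=\phi_1\!\left(\tfrac1\tau\big(\phi_2(\delta/6)+\log(6d/\delta)\big)\right),\qquad g_c(n):=n+c+g(n+c),$$ such that (i)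 $\|u_i-u_j\|\le\varepsilon$ for all $i,j\in\{n,n+1,\dots,n+g(n)\}$, and (ii) if $\|Tx-x\|\le\varepsilon'$, then $\langle\mathcal{G}u_n-u_n,\,x-u_n\rangle\le\varepsilon$, where $\varepsilon':=1/k_{i_0}(\delta/6,g_c)$, and $\Xi$ and $k_{i_0}(\cdot,\cdot)$ are the explicit functionals given in the context.
   Context: $\mathbb{N}$ denotes the nonnegative integers and $\mathbb{N}^*$ the positive integers. $F^{(m)}$ denotes the $m$-fold iterate of a function $F$. For a function $F$ defined on $\mathbb{N}$ or $\mathbb{N}^*$ with values in $\mathbb{N}$, $F^M(n):=\max\{F(i): i\le n\}$ ($i$ ranging over the domain of $F$). For $g:\mathbb{N}\to\mathbb{N}$, $\tilde g(n):=\max\{n,g(n)\}$. Definition of $k_{i_0}(\varepsilon,g)$ and $\Xi(\varepsilon,g,\chi,h,d)$ (with $\tau,\chi,h,d$ fixed), for $\varepsilon\in(0,1]$ and $g:\mathbb{N}\to\mathbb{N}$: put $$\varepsilon_d:=\frac{(\varepsilon/2)^4}{8(1-\tau)^2d^2},\quad \tilde\varepsilon:=\frac{(1-\tau)^2}{6+8d}\,\varepsilon_d,\quad N_0:=\lceil 8d^4/\tilde\varepsilon^4\rceil,\quad i_0:=\lceil\log_\tau(\tilde\varepsilon/(6d^2))-1\rceil .$$ Define $f:\mathbb{N}^*\to\mathbb{N}^*$ by $$f(n):=\left\lceil\frac{6d(1-\tau)\,h^M\big(\tilde g^M(\chi(d\cdot n))\big)}{(\varepsilon/2)^2}\right\rceil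 ,$$ $\tilde f(n):=\max\{f^M(16dn^2),16dn^2\}$, and for $i\ge0$ $$f_i(k):=\tilde f^{(N_0^i)}(k),\qquad \tilde f_i(n):=\max\{f_i^M(16dn^2),16dn^2\},$$ $$k_0:=\tilde f_0^{(N_0)}(1),\qquad k_{i+1}:=\tilde f_i^{(N_0)}(k_i).$$ Then $k_{i_0}(\varepsilon,g)$ is the term $k_{i_0}$ of this sequence with this $i_0$, and $\Xi(\varepsilon,g,\chi,h,d):=\chi(d\cdot k_{i_0}(\varepsilon,g))$. *)

theory Defs
  imports "HOL-Analysis.Analysis"
begin

text \<open>
  The operator \<open>F \<mapsto> F\<^sup>M\<close> depends on the domain of \<open>F\<close>, so there are two versions:
  \<open>maj\<close> for functions on the nonnegative integers and \<open>maj_pos\<close> for functions on the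
  positive integers. Functions on the positive integers are represented by functions
  \<open>nat \<Rightarrow> nat\<close> whose value at \<open>0\<close> is irrelevant: below, they are only evaluated at
  positive arguments (for \<open>d \<ge> 1\<close>), so that the maximum in \<open>maj_pos\<close> is over a nonempty set.
\<close>

definition maj :: "(nat \<Rightarrow> nat) \<Rightarrow> nat \<Rightarrow> nat" where
  "maj F n = Max (F ` {0..n})"

definition maj_pos :: "(nat \<Rightarrow> nat) \<Rightarrow> nat \<Rightarrow> nat" where
  "maj_pos F n = Max (F ` {1..n})"

definition g_tilde :: "(nat \<Rightarrow> nat) \<Rightarrow> nat \<Rightarrow> nat" where
  "g_tilde g n = max n (g n)"

definition eps_d :: "real \<Rightarrow> nat \<Rightarrow> real \<Rightarrow> real" where
  "eps_d \<tau> d \<epsilon> = (\<epsilon> / 2) ^ 4 / (8 * (1 - \<tau>)\<^sup>2 * (real d)\<^sup>2)"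

definition eps_tilde :: "real \<Rightarrow> nat \<Rightarrow> real \<Rightarrow> real" where
  "eps_tilde \<tau> d \<epsilon> = (1 - \<tau>)\<^sup>2 / (6 + 8 * real d) * eps_d \<tau> d \<epsilon>"

definition N_0 :: "real \<Rightarrow> nat \<Rightarrow> real \<Rightarrow> nat" where
  "N_0 \<tau> d \<epsilon> = nat \<lceil>8 * real d ^ 4 / eps_tilde \<tau> d \<epsilon> ^ 4\<rceil>"

text \<open>
  For \<open>0 < \<tau> < 1\<close>, \<open>0 < \<epsilon> \<le> 1\<close> and \<open>d \<ge> 1\<close> the logarithm below is positive, hence the
  ceiling is nonnegative and \<open>nat\<close> does not truncate.
\<close>

definition i_0 :: "real \<Rightarrow> nat \<Rightarrow> real \<Rightarrow> nat" where
  "i_0 \<tau> d \<epsilon> = nat \<lceil>log \<tau> (eps_tilde \<tau> d \<epsilon> / (6 * (real d)\<^sup>2)) - 1\<rceil>"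

definition f_base ::
  "real \<Rightarrow> (nat \<Rightarrow> nat) \<Rightarrow> (nat \<Rightarrow> nat) \<Rightarrow> nat \<Rightarrow> real \<Rightarrow> (nat \<Rightarrow> nat) \<Rightarrow> nat \<Rightarrow> nat" where
  "f_base \<tau> chi h d \<epsilon> g n =
     nat \<lceil>6 * real d * (1 - \<tau>) * real (maj h (maj (g_tilde g) (chi (d * n)))) / (\<epsilon> / 2)\<^sup>2\<rceil>"

text \<open>The common operation by which \<open>f\<close> and each \<open>f\<^sub>i\<close> receive their tilde versions.\<close>

definition tilde_pos :: "nat \<Rightarrow> (nat \<Rightarrow> nat) \<Rightarrow> nat \<Rightarrow> nat" where
  "tilde_pos d F n = max (maj_pos F (16 * d * n\<^sup>2)) (16 * d * n\<^sup>2)"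

definition f_seq ::
  "real \<Rightarrow> (nat \<Rightarrow> nat) \<Rightarrow> (nat \<Rightarrow> nat) \<Rightarrow> nat \<Rightarrow> real \<Rightarrow> (nat \<Rightarrow> nat) \<Rightarrow> nat \<Rightarrow> nat \<Rightarrow> nat" where
  "f_seq \<tau> chi h d \<epsilon> g i = tilde_pos d (f_base \<tau> chi h d \<epsilon> g) ^^ (N_0 \<tau> d \<epsilon> ^ i)"

primrec k_seq ::
  "real \<Rightarrow> (nat \<Rightarrow> nat) \<Rightarrow> (nat \<Rightarrow> nat) \<Rightarrow> nat \<Rightarrow> real \<Rightarrow> (nat \<Rightarrow> nat) \<Rightarrow> nat \<Rightarrow> nat" where
  "k_seq \<tau> chi h d \<epsilon> g 0 =
     (tilde_pos d (f_seq \<tau> chi h d \<epsilon> g 0) ^^ N_0 \<tau> d \<epsilon>) 1"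
| "k_seq \<tau> chi h d \<epsilon> g (Suc i) =
     (tilde_pos d (f_seq \<tau> chi h d \<epsilon> g i) ^^ N_0 \<tau> d \<epsilon>) (k_seq \<tau> chi h d \<epsilon> g i)"

definition k_i0 ::
  "real \<Rightarrow> (nat \<Rightarrow> nat) \<Rightarrow> (nat \<Rightarrow> nat) \<Rightarrow> nat \<Rightarrow> real \<Rightarrow> (nat \<Rightarrow> nat) \<Rightarrow> nat" where
  "k_i0 \<tau> chi h d \<epsilon> g = k_seq \<tau> chi h d \<epsilon> g (i_0 \<tau> d \<epsilon>)"

definition Xi ::
  "real \<Rightarrow> real \<Rightarrow> (nat \<Rightarrow> nat) \<Rightarrow> (nat \<Rightarrow> nat) \<Rightarrow> (nat \<Rightarrow> nat) \<Rightarrow> nat \<Rightarrow> nat" where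
  "Xi \<tau> \<epsilon> g chi h d = chi (d * k_i0 \<tau> chi h d \<epsilon> g)"

end

theory Submission
  imports Defs
begin

text \<open>
  Write \<open>\<kappa> = 1 - \<tau>\<close>, \<open>F = G \<circ> T\<close> and \<open>B y = y - F y\<close>. The map \<open>B\<close> is strongly monotone with modulus
  \<open>\<kappa>\<close>. For \<open>K \<ge> 1\<close> let \<open>z\<^sub>K\<close> be the fixed point of \<open>(1 - 1/K) T + (1/K) F\<close>. Since \<open>I - T\<close> is
  monotone, \<open>z\<^sub>K\<close> satisfies \<open>\<langle>B z\<^sub>K, y - z\<^sub>K\<rangle> \<ge> -K d \<parallel>y - T y\<parallel>\<close> (lemma \<open>resolvent_variational\<close>), so up
  to a negligible error it solves a variational inequality against every \<open>y\<close> that is a much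
  better approximate fixed point of \<open>T\<close> than \<open>z\<^sub>K\<close> itself: the resolvents of much later
  parameters, the iterates \<open>u\<^sub>j\<close> with much larger indices, and the point \<open>x\<close> of the theorem.
  Conversely, \<open>u\<^sub>j\<close> drifts towards every such \<open>y\<close>: in a step of length \<open>\<lambda>\<close> the quantity
  \<open>\<parallel>u\<^sub>j - y\<parallel>\<^sup>2\<close> grows by at most \<open>2 \<lambda> \<langle>B u\<^sub>j, y - u\<^sub>j\<rangle>\<close> up to small errors (lemma \<open>step_towards\<close>). Both facts are
  affine in \<open>y\<close>, so they hold for means of resolvents. If \<open>M\<close> is such a mean and
  \<open>\<langle>B y, M - y\<rangle> \<le> \<alpha> (r - \<parallel>y - M\<parallel>\<^sup>2)\<close> for the relevant \<open>y\<close>, then iterates and resolvents settle in the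
  ball of radius about \<open>\<surd>r\<close> around \<open>M\<close> (lemma \<open>settle\<close>).

  The proof cuts time into stages with rapidly growing thresholds \<open>K\<^sub>0, K\<^sub>1, \<dots>\<close>. A stretch of stages
  on which all resolvents and iterates are within \<open>R\<close> of a point is shown to contain a shorter
  stretch on which they are within a smaller radius of another point. This is repeated down to the
  radius \<open>\<delta>/2\<close>, where one stage suffices for both claims of the theorem. There are two ways to
  shrink the radius.

  For \<open>\<kappa> \<ge> 1/16\<close>, replace \<open>F\<close> by its value \<open>v\<close> at the centre. The resolvent path of a constant map is
  Browder's path; its squared distance to \<open>v\<close> is almost increasing, so it is almost constant on one
  of boundedly many blocks, and its value there serves as the next centre (lemma \<open>picard_step\<close>).
  This multiplies \<open>R\<^sup>2\<close> by \<open>\<tau>\<close>.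

  As \<open>\<kappa>\<close> tends to \<open>0\<close>, this needs about \<open>1/\<kappa>\<close> nested rounds with tolerances of order \<open>\<kappa>\<close>, so the
  number of stages becomes \<open>1/\<kappa>\<close> to the power of a multiple of \<open>1/\<kappa>\<close>, whereas the bound of the
  theorem provides \<open>exp (const/\<kappa>)\<close> stages. So for \<open>\<kappa> < 1/16\<close> the radius is halved at once, by a cut
  through a sequence of resolvents: if the mean \<open>M\<^sup>-\<close> of earlier and the mean \<open>M\<^sup>+\<close> of later
  resolvents are so close that \<open>\<langle>B y, M\<^sup>+ - M\<^sup>-\<rangle>\<close> is at most a small multiple of \<open>\<kappa> R\<^sup>2\<close>, then the
  variational inequalities of the earlier resolvents and strong monotonicity show that \<open>M\<^sup>+\<close> attracts
  everything near the cut (lemma \<open>kernel_step\<close>). Among \<open>exp (const/\<kappa>)\<close> points there is a cut \<open>i\<close> for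
  which the means with weights \<open>1/\<bar>j - i\<bar>\<close> are that close: by Hilbert's inequality the difference of
  the unnormalised sums is bounded for suitable \<open>i\<close>, whereas the total weights grow like a logarithm
  (lemma \<open>balanced_cut\<close>).

  The stages come from iterating the functional \<open>f\<^sup>~\<close>. The value \<open>k\<^sub>i\<^sub>0\<close> contains \<open>N\<^sub>0\<close> to the power
  \<open>max 1 i\<^sub>0\<close> of its iterations, which is more than either way of shrinking consumes. The shift \<open>c\<close>
  is at least \<open>\<phi>\<^sub>2 (\<delta>/6)\<close>, and from there on \<open>ln (1/\<lambda>)\<close> grows no faster than the sums of the \<open>\<lambda>\<^sub>j\<close>;
  hence a large drop of \<open>\<lambda>\<close> between two stages forces these sums to be large, which gives \<open>u\<close> the
  time to settle.
\<close>


section \<open>Hilbert's inequality\<close>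

lemma sum_inverse_squares_le:
  fixes S :: "int set"
  assumes "finite S"
  shows "(\<Sum>m\<in>S. 1 / (real_of_int m)\<^sup>2) \<le> 4"
proof -
  have half: "(\<Sum>m = 1..n. 1 / (real m)\<^sup>2) \<le> 2 - 1 / real n" for n
  proof (induction n)
    case (Suc n)
    have "1 / (real (Suc n))\<^sup>2 \<le> 1 / real n - 1 / real (Suc n)" if "n > 0"
    proof -
      have "1 / real n - 1 / real (Suc n) = 1 / (real n * real (Suc n))" using that by (simp add: field_simps)
      moreover have "1 / (real (Suc n))\<^sup>2 \<le> 1 / (real n * real (Suc n))"
        using that by (intro frac_le) (auto simp: power2_eq_square)
      ultimately show ?thesis by simp
    qed
    with Suc show ?case by (cases "n = 0") auto
  qed simp
  obtain L where L: "\<And>m. m \<in> S \<Longrightarrow> \<bar>m\<bar> \<le> int L"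
  proof -
    have "finite ((\<lambda>m. nat \<bar>m\<bar>) ` S)" using assms by simp
    then have "\<And>m. m \<in> S \<Longrightarrow> nat \<bar>m\<bar> \<le> Max (insert 0 ((\<lambda>m. nat \<bar>m\<bar>) ` S))" by simp
    then show ?thesis using that[of "Max (insert 0 ((\<lambda>m. nat \<bar>m\<bar>) ` S))"]
      by (metis abs_ge_zero int_nat_eq of_nat_le_iff)
  qed
  have "S \<subseteq> insert 0 (int ` {1..L} \<union> (\<lambda>m. - int m) ` {1..L})"
  proof
    fix m assume "m \<in> S"
    then have m: "\<bar>m\<bar> \<le> int L" by (rule L)
    consider "m = 0" | "m > 0" | "m < 0" by linarith
    then show "m \<in> insert 0 (int ` {1..L} \<union> (\<lambda>m. - int m) ` {1..L})"
    proof cases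
      case 2 with m have "m = int (nat m)" "nat m \<in> {1..L}" by auto
      then show ?thesis by blast
    next
      case 3 with m have "m = - int (nat (-m))" "nat (-m) \<in> {1..L}" by auto
      then show ?thesis by blast
    qed simp
  qed
  then have "(\<Sum>m\<in>S. 1 / (real_of_int m)\<^sup>2)
      \<le> (\<Sum>m\<in>insert 0 (int ` {1..L} \<union> (\<lambda>m. - int m) ` {1..L}). 1 / (real_of_int m)\<^sup>2)"
    by (intro sum_mono2) auto
  also have "\<dots> = (\<Sum>m\<in>int ` {1..L}. 1 / (real_of_int m)\<^sup>2) + (\<Sum>m\<in>(\<lambda>m. - int m) ` {1..L}. 1 / (real_of_int m)\<^sup>2)"
    by (subst sum.insert_if) (auto intro!: sum.union_disjoint)
  also have "\<dots> = (\<Sum>m = 1..L. 1 / (real m)\<^sup>2) + (\<Sum>m = 1..L. 1 / (real m)\<^sup>2)"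
    by (subst (1 2) sum.reindex) (auto simp: inj_on_def)
  also have "\<dots> \<le> 4" using half[of L] by (smt (verit) divide_nonneg_nonneg of_nat_0_le_iff)
  finally show ?thesis .
qed

text \<open>
  Moving the pole by one only exchanges the two extreme terms of the window, and each of them is at
  most \<open>1/N\<close> because the window exceeds the range of the poles by \<open>N\<close> on both sides. The term at the
  pole itself vanishes, as division by zero yields zero.
\<close>

lemma harmonic_window_shift:
  fixes j k :: nat and N :: nat
  defines "J \<equiv> {- int N..<2 * int N}"
  assumes jk: "j \<le> k" "k < N"
  shows "\<bar>(\<Sum>i\<in>J. 1 / real_of_int (int j - i)) - (\<Sum>i\<in>J. 1 / real_of_int (int k - i))\<bar>
           \<le> 2 * (real k - real j) / real N"
  using jk
proof (induction k rule: dec_induct)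
  case base then show ?case by simp
next
  case (step k)
  define S where "S j = (\<Sum>i\<in>J. 1 / real_of_int (int j - i))" for j
  have N: "N > 0" using step by simp
  have eq: "S j = (\<Sum>m\<in>{int j - 2 * int N<..int j + int N}. 1 / real_of_int m)" for j
    unfolding S_def J_def
    by (rule sum.reindex_bij_witness[of _ "\<lambda>m. int j - m" "\<lambda>i. int j - i"]) auto
  have "{int k - 2 * int N<..int k + int N} = insert (int k + 1 - 2 * int N) ({int k + 1 - 2 * int N<..int k + int N})"
    using N by auto
  then have 1: "S k = 1 / real_of_int (int k + 1 - 2 * int N) + (\<Sum>m\<in>{int k + 1 - 2 * int N<..int k + int N}. 1 / real_of_int m)"
    unfolding eq by simp
  have "{int (Suc k) - 2 * int N<..int (Suc k) + int N} = insert (int k + 1 + int N) ({int k + 1 - 2 * int N<..int k + int N})"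
    using N by auto
  then have 2: "S (Suc k) = 1 / real_of_int (int k + 1 + int N) + (\<Sum>m\<in>{int k + 1 - 2 * int N<..int k + int N}. 1 / real_of_int m)"
    unfolding eq by simp
  have "S (Suc k) - S k = 1 / (real k + 1 + real N) + 1 / (2 * real N - real k - 1)"
    unfolding 1 2 using minus_divide_right[of 1 "2 * real N - real k - 1"] by (simp add: algebra_simps)
  moreover have "1 / (real k + 1 + real N) \<le> 1 / real N" "1 / (2 * real N - real k - 1) \<le> 1 / real N"
    "0 \<le> 1 / (real k + 1 + real N)" "0 \<le> 1 / (2 * real N - real k - 1)"
    using N step by (auto intro!: divide_left_mono mult_pos_pos)
  ultimately have "\<bar>S (Suc k) - S k\<bar> \<le> 2 / real N" by linarith
  moreover have "\<bar>S j - S k\<bar> \<le> 2 * (real k - real j) / real N"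
    using step unfolding S_def by simp
  moreover have "2 * (real (Suc k) - real j) / real N = 2 * (real k - real j) / real N + 2 / real N"
    by (simp add: algebra_simps add_divide_distrib diff_divide_distrib)
  ultimately show ?case unfolding S_def[symmetric] by linarith
qed

text \<open>
  By partial fractions the product is \<open>1/(k - j)\<close> times a difference of two terms with one pole
  each. Over a window that is much longer than \<open>k - j\<close> these nearly cancel; what remains comes from the two
  indices \<open>i = j\<close> and \<open>i = k\<close>, where the product vanishes but the difference does not.
\<close>

lemma hilbert_kernel_correlation:
  fixes j k :: nat and N :: nat
  assumes jk: "j < N" "k < N" "j \<noteq> k"
  shows "\<bar>\<Sum>i\<in>{- int N..<2 * int N}. 1 / real_of_int (int j - i) * (1 / real_of_int (int k - i))\<bar>
           \<le> 2 / (real_of_int (int k - int j))\<^sup>2 + 2 / real N"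
proof -
  define J where "J = {- int N..<2 * int N}"
  have main: "\<bar>\<Sum>i\<in>J. 1 / real_of_int (int j - i) * (1 / real_of_int (int k - i))\<bar>
           \<le> 2 / (real_of_int (int k - int j))\<^sup>2 + 2 / real N" if jk: "j < k" "k < N" for j k
  proof -
    define n where "n = real k - real j"
    have n: "n > 0" using that by (simp add: n_def)
    have pf: "1 / real_of_int (int j - i) * (1 / real_of_int (int k - i))
       = (1 / n) * (1 / real_of_int (int j - i) - 1 / real_of_int (int k - i))
          + (if i = int j then 1 / n\<^sup>2 else 0) + (if i = int k then 1 / n\<^sup>2 else 0)" for i
    proof -
      consider "i = int j" | "i = int k" | "i \<noteq> int j" "i \<noteq> int k" by blast
      then show ?thesis
      proof cases
        case 1 then show ?thesis using n jk by (simp add: n_def power2_eq_square)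
      next
        case 2
        have "1 / (real j - real k) = - (1 / n)" unfolding n_def
          by (metis minus_diff_eq minus_divide_right)
        with 2 show ?thesis using n jk by (simp add: power2_eq_square)
      next
        case 3
        then have "real j - real_of_int i \<noteq> 0" "real k - real_of_int i \<noteq> 0"
          by (auto simp: of_int_eq_iff[symmetric] simp del: of_int_eq_iff)
        then have "1 / (real j - real_of_int i) - 1 / (real k - real_of_int i)
           = n * (1 / (real j - real_of_int i) * (1 / (real k - real_of_int i)))"
          by (simp add: n_def field_simps)
        with 3 n show ?thesis by simp
      qed
    qed
    have "int j \<in> J" "int k \<in> J" "finite J" using jk by (auto simp: J_def)
    then have eq: "(\<Sum>i\<in>J. 1 / real_of_int (int j - i) * (1 / real_of_int (int k - i)))
       = (1 / n) * ((\<Sum>i\<in>J. 1 / real_of_int (int j - i)) - (\<Sum>i\<in>J. 1 / real_of_int (int k - i))) + 2 / n\<^sup>2"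
      unfolding pf by (simp add: sum.distrib sum_distrib_left[symmetric] sum_divide_distrib[symmetric] sum_subtractf del: of_int_diff)
    have "\<bar>(\<Sum>i\<in>J. 1 / real_of_int (int j - i)) - (\<Sum>i\<in>J. 1 / real_of_int (int k - i))\<bar> \<le> 2 * n / real N"
      using harmonic_window_shift[of j k N] jk by (simp add: J_def n_def)
    then have "\<bar>(1 / n) * ((\<Sum>i\<in>J. 1 / real_of_int (int j - i)) - (\<Sum>i\<in>J. 1 / real_of_int (int k - i)))\<bar> \<le> (1 / n) * (2 * n / real N)"
      unfolding abs_mult using n by (intro mult_mono) auto
    also have "\<dots> = 2 / real N" using n by simp
    finally have "\<bar>(1 / n) * ((\<Sum>i\<in>J. 1 / real_of_int (int j - i)) - (\<Sum>i\<in>J. 1 / real_of_int (int k - i)))\<bar> \<le> 2 / real N" .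
    then have "\<bar>(1 / n) * ((\<Sum>i\<in>J. 1 / real_of_int (int j - i)) - (\<Sum>i\<in>J. 1 / real_of_int (int k - i))) + 2 / n\<^sup>2\<bar> \<le> 2 / real N + 2 / n\<^sup>2"
      using n by (intro order_trans[OF abs_triangle_ineq]) auto
    then show ?thesis unfolding eq by (simp add: n_def)
  qed
  show ?thesis
  proof (cases "j < k")
    case True then show ?thesis using main[of j k] jk by (simp add: J_def)
  next
    case False then show ?thesis using main[of k j] jk
      by (simp add: J_def mult.commute power2_commute)
  qed
qed

text \<open>
  Hilbert's inequality, with \<open>14\<close> in place of the optimal \<open>\<pi>\<^sup>2\<close>. Letting \<open>i\<close> range over a longer
  window only increases the left side and makes the Gram matrix of the kernel almost
  \<open>2/(j - k)\<^sup>2\<close>, whose rows are absolutely summable, so that the Schur test applies. In the constant, the diagonal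
  contributes \<open>4\<close>, the other entries \<open>8\<close>, and the finite length of the window \<open>2\<close>.
\<close>

lemma hilbert_inequality:
  fixes x :: "nat \<Rightarrow> 'b::real_inner"
  shows "(\<Sum>i<N. (norm (\<Sum>j<N. (1 / (real j - real i)) *\<^sub>R x j))\<^sup>2) \<le> 14 * (\<Sum>j<N. (norm (x j))\<^sup>2)"
proof -
  define J where "J = {- int N..<2 * int N}"
  define a where "a i j = 1 / real_of_int (int j - i)" for i :: int and j :: nat
  define G where "G j k = (\<Sum>i\<in>J. a i j * a i k)" for j k
  have "(\<Sum>i<N. (norm (\<Sum>j<N. (1 / (real j - real i)) *\<^sub>R x j))\<^sup>2)
      = (\<Sum>i\<in>int ` {..<N}. (norm (\<Sum>j<N. a i j *\<^sub>R x j))\<^sup>2)"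
    by (subst sum.reindex) (auto simp: a_def)
  also have "\<dots> \<le> (\<Sum>i\<in>J. (norm (\<Sum>j<N. a i j *\<^sub>R x j))\<^sup>2)"
    by (intro sum_mono2) (auto simp: J_def)
  also have "\<dots> = (\<Sum>i\<in>J. \<Sum>j<N. \<Sum>k<N. a i j * a i k * (x j \<bullet> x k))"
    by (simp add: power2_norm_eq_inner inner_sum_left inner_sum_right sum_distrib_left mult_ac inner_commute)
  also have "\<dots> = (\<Sum>j<N. \<Sum>k<N. G j k * (x j \<bullet> x k))"
    unfolding G_def sum_distrib_right
    by (subst sum.swap, intro sum.cong refl, subst sum.swap, rule refl)
  also have "\<dots> \<le> (\<Sum>j<N. \<Sum>k<N. \<bar>G j k\<bar> * ((norm (x j))\<^sup>2 / 2 + (norm (x k))\<^sup>2 / 2))"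
  proof (intro sum_mono)
    fix j k
    have "\<bar>x j \<bullet> x k\<bar> \<le> norm (x j) * norm (x k)" by (rule Cauchy_Schwarz_ineq2)
    also have "\<dots> \<le> (norm (x j))\<^sup>2 / 2 + (norm (x k))\<^sup>2 / 2"
      using sum_squares_bound[of "norm (x j)" "norm (x k)"] by simp
    finally have "\<bar>x j \<bullet> x k\<bar> \<le> (norm (x j))\<^sup>2 / 2 + (norm (x k))\<^sup>2 / 2" .
    then have "\<bar>G j k * (x j \<bullet> x k)\<bar> \<le> \<bar>G j k\<bar> * ((norm (x j))\<^sup>2 / 2 + (norm (x k))\<^sup>2 / 2)"
      unfolding abs_mult by (intro mult_left_mono) auto
    then show "G j k * (x j \<bullet> x k) \<le> \<bar>G j k\<bar> * ((norm (x j))\<^sup>2 / 2 + (norm (x k))\<^sup>2 / 2)"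
      using abs_ge_self order_trans by blast
  qed
  also have "\<dots> = (\<Sum>j<N. (\<Sum>k<N. \<bar>G j k\<bar>) * (norm (x j))\<^sup>2)"
  proof -
    have sym: "G j k = G k j" for j k by (simp add: G_def mult.commute)
    have "(\<Sum>j<N. \<Sum>k<N. \<bar>G j k\<bar> * ((norm (x k))\<^sup>2 / 2)) = (\<Sum>j<N. \<Sum>k<N. \<bar>G j k\<bar> * ((norm (x j))\<^sup>2 / 2))"
      by (subst sum.swap) (simp add: sym)
    then show ?thesis
      by (simp add: ring_distribs sum.distrib sum_distrib_right) (simp add: sum_divide_distrib[symmetric])
  qed
  also have "\<dots> \<le> (\<Sum>j<N. 14 * (norm (x j))\<^sup>2)"
  proof (intro sum_mono mult_right_mono)
    fix j assume "j \<in> {..<N}"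
    then have j: "j < N" by simp
    have "G j j = (\<Sum>m\<in>(\<lambda>i. int j - i) ` J. 1 / (real_of_int m)\<^sup>2)"
      unfolding G_def by (subst sum.reindex) (auto simp: a_def inj_on_def power2_eq_square)
    also have "\<dots> \<le> 4" by (rule sum_inverse_squares_le) (simp add: J_def)
    finally have d: "\<bar>G j j\<bar> \<le> 4" by (simp add: G_def sum_nonneg)
    have "(\<Sum>k\<in>{..<N} - {j}. \<bar>G j k\<bar>) \<le> (\<Sum>k\<in>{..<N} - {j}. 2 / (real_of_int (int k - int j))\<^sup>2 + 2 / real N)"
      using hilbert_kernel_correlation[OF j] by (intro sum_mono) (auto simp: G_def a_def J_def)
    also have "\<dots> \<le> (\<Sum>k<N. 2 / (real_of_int (int k - int j))\<^sup>2 + 2 / real N)"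
      by (intro sum_mono2) auto
    also have "\<dots> = 2 * (\<Sum>m\<in>(\<lambda>k. int k - int j) ` {..<N}. 1 / (real_of_int m)\<^sup>2) + 2"
      using j by (subst sum.reindex) (auto simp: inj_on_def sum.distrib sum_distrib_left)
    also have "\<dots> \<le> 2 * 4 + 2" by (intro add_mono mult_left_mono sum_inverse_squares_le) auto
    finally show "(\<Sum>k<N. \<bar>G j k\<bar>) \<le> 14"
      using d j by (subst sum.remove[of _ j]) auto
  qed auto
  finally show ?thesis by (simp add: sum_distrib_left)
qed

section \<open>A cut with close past and future means\<close>

lemma cut_with_small_hilbert_sum:
  fixes x :: "nat \<Rightarrow> 'b::real_inner"
  assumes "n \<ge> 1" and x: "\<And>j. j < 4 * n \<Longrightarrow> (norm (x j))\<^sup>2 \<le> r"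
  shows "\<exists>i\<in>{n..<3 * n}. (norm (\<Sum>j<4 * n. (1 / (real j - real i)) *\<^sub>R x j))\<^sup>2 \<le> 28 * r"
proof (rule ccontr)
  let ?T = "\<lambda>i. (norm (\<Sum>j<4 * n. (1 / (real j - real i)) *\<^sub>R x j))\<^sup>2"
  assume "\<not> (\<exists>i\<in>{n..<3 * n}. ?T i \<le> 28 * r)"
  then have big: "\<And>i. i \<in> {n..<3 * n} \<Longrightarrow> 28 * r < ?T i" by (simp add: not_le)
  have "(\<Sum>i\<in>{n..<3 * n}. 28 * r) < (\<Sum>i\<in>{n..<3 * n}. ?T i)"
    using assms(1) big by (intro sum_strict_mono) auto
  also have "\<dots> \<le> (\<Sum>i<4 * n. ?T i)" by (intro sum_mono2) auto
  also have "\<dots> \<le> 14 * (\<Sum>j<4 * n. (norm (x j))\<^sup>2)" by (rule hilbert_inequality)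
  also have "\<dots> \<le> 14 * (\<Sum>j<4 * n. r)" using x by (intro mult_left_mono sum_mono) auto
  finally show False by simp
qed

lemma sum_past_weights: "(\<Sum>j<i. 1 / (real i - real j)) = harm i"
proof -
  have "(\<Sum>j<i. 1 / (real i - real j)) = (\<Sum>k = 1..i. 1 / real k)"
    by (rule sum.reindex_bij_witness[of _ "\<lambda>k. i - k" "\<lambda>j. i - j"]) (auto simp: of_nat_diff)
  then show ?thesis by (simp add: harm_def inverse_eq_divide)
qed

lemma sum_future_weights: "(\<Sum>j\<in>{i<..<N}. 1 / (real j - real i)) = harm (N - 1 - i)"
proof -
  have "(\<Sum>j\<in>{i<..<N}. 1 / (real j - real i)) = (\<Sum>k = 1..N - 1 - i. 1 / real k)"
    by (rule sum.reindex_bij_witness[of _ "\<lambda>k. i + k" "\<lambda>j. j - i"]) (auto simp: of_nat_diff)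
  then show ?thesis by (simp add: harm_def inverse_eq_divide)
qed

lemma harm_triple_le: "harm (3 * n) \<le> harm n + (2::real)"
proof (cases "n = 0")
  case False
  have "harm (3 * n) = harm n + (\<Sum>k\<in>{n<..3 * n}. inverse (real k))"
    unfolding harm_def by (subst sum.union_disjoint[symmetric]) (auto intro!: sum.cong)
  also have "(\<Sum>k\<in>{n<..3 * n}. inverse (real k)) \<le> (\<Sum>k\<in>{n<..3 * n}. inverse (real n))"
    using False by (intro sum_mono le_imp_inverse_le) auto
  also have "\<dots> = 2" using False by simp
  finally show ?thesis by simp
qed (simp add: harm_def)

text \<open>
  The Hilbert sum at \<open>i\<close> is a weighted sum over the future minus one over the past. Normalised by
  their total weights \<open>W\<close> and \<open>V\<close>, both become means; the last term accounts for \<open>V \<noteq> W\<close>.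
\<close>

lemma hilbert_sum_split:
  fixes y :: "nat \<Rightarrow> 'b::real_vector"
  assumes i: "i < N" and V: "V \<noteq> 0" and W: "W \<noteq> 0"
  shows "W *\<^sub>R ((\<Sum>j\<in>{i<..<N}. (1 / (real j - real i) / W) *\<^sub>R y j) - (\<Sum>j<i. (1 / (real i - real j) / V) *\<^sub>R y j))
       = (\<Sum>j<N. (1 / (real j - real i)) *\<^sub>R y j) + (V - W) *\<^sub>R (\<Sum>j<i. (1 / (real i - real j) / V) *\<^sub>R y j)"
proof -
  have "{..<N} = insert i ({i<..<N} \<union> {..<i})" using i by auto
  then have "(\<Sum>j<N. (1 / (real j - real i)) *\<^sub>R y j) = (\<Sum>j\<in>{i<..<N} \<union> {..<i}. (1 / (real j - real i)) *\<^sub>R y j)"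
    by (simp only:) (subst sum.insert, auto)
  also have "\<dots> = (\<Sum>j\<in>{i<..<N}. (1 / (real j - real i)) *\<^sub>R y j) + (\<Sum>j<i. (1 / (real j - real i)) *\<^sub>R y j)"
    by (rule sum.union_disjoint) auto
  finally have "(\<Sum>j<N. (1 / (real j - real i)) *\<^sub>R y j)
     = (\<Sum>j\<in>{i<..<N}. (1 / (real j - real i)) *\<^sub>R y j) + (\<Sum>j<i. (1 / (real j - real i)) *\<^sub>R y j)" .
  moreover have "(\<Sum>j<i. (1 / (real j - real i)) *\<^sub>R y j) = - V *\<^sub>R (\<Sum>j<i. (1 / (real i - real j) / V) *\<^sub>R y j)"
    unfolding scaleR_sum_right
  proof (intro sum.cong refl)
    fix j assume "j \<in> {..<i}"
    have "1 / (real j - real i) = - (1 / (real i - real j))" by (metis minus_diff_eq minus_divide_right)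
    then show "(1 / (real j - real i)) *\<^sub>R y j = - V *\<^sub>R (1 / (real i - real j) / V) *\<^sub>R y j"
      using V by simp
  qed
  moreover have "(\<Sum>j\<in>{i<..<N}. (1 / (real j - real i)) *\<^sub>R y j) = W *\<^sub>R (\<Sum>j\<in>{i<..<N}. (1 / (real j - real i) / W) *\<^sub>R y j)"
    using W by (simp add: scaleR_sum_right)
  ultimately show ?thesis by (simp add: algebra_simps)
qed

lemma norm_weighted_sum_le:
  fixes y :: "nat \<Rightarrow> 'b::real_normed_vector"
  assumes "\<And>j. j \<in> I \<Longrightarrow> \<mu> j \<ge> 0" "sum \<mu> I = 1" "\<And>j. j \<in> I \<Longrightarrow> norm (y j) \<le> r"
  shows "norm (\<Sum>j\<in>I. \<mu> j *\<^sub>R y j) \<le> r"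
proof -
  have "norm (\<Sum>j\<in>I. \<mu> j *\<^sub>R y j) \<le> (\<Sum>j\<in>I. \<mu> j * r)"
    using assms by (intro sum_norm_le) (auto intro!: mult_left_mono)
  also have "\<dots> = r" using assms(2) by (simp add: sum_distrib_right[symmetric])
  finally show ?thesis .
qed

text \<open>
  With the weights \<open>1/\<bar>j - i\<bar>\<close>, past and future have a total weight of at least \<open>ln n\<close> each, while
  Hilbert's inequality bounds the difference of the two weighted sums for some \<open>i\<close> in the middle. So
  the means differ by \<open>O(R/ln n)\<close>. The values of the functional \<open>\<beta>\<close> need an error of order
  \<open>R\<^sup>2/ln n\<close>, which does not follow from the distance of the means when \<open>\<beta>\<close> is much larger than \<open>R\<close>;
  they are therefore treated as one more coordinate, scaled to the size \<open>R\<close>.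
\<close>

lemma balanced_cut:
  fixes x :: "nat \<Rightarrow> 'b::real_inner"
  assumes n: "n \<ge> 1" and R: "R > 0"
    and x: "\<And>j. j < 4 * n \<Longrightarrow> norm (x j - p) \<le> R"
    and l: "\<And>j. j < 4 * n \<Longrightarrow> \<bar>\<beta> \<bullet> (x j - p) - l\<bar> \<le> 5 / 2 * R\<^sup>2"
  obtains i \<mu> \<nu> where "n \<le> i" "i < 3 * n"
    and "\<And>j. j < i \<Longrightarrow> \<mu> j \<ge> 0" "sum \<mu> {..<i} = 1"
    and "\<And>j. i < j \<Longrightarrow> \<nu> j \<ge> 0" "sum \<nu> {i<..<4 * n} = 1"
    and "norm ((\<Sum>j\<in>{i<..<4 * n}. \<nu> j *\<^sub>R x j) - (\<Sum>j<i. \<mu> j *\<^sub>R x j)) \<le> 10 * R / ln (real n + 1)"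
    and "\<beta> \<bullet> ((\<Sum>j\<in>{i<..<4 * n}. \<nu> j *\<^sub>R x j) - (\<Sum>j<i. \<mu> j *\<^sub>R x j))
          + 2 * R * norm ((\<Sum>j\<in>{i<..<4 * n}. \<nu> j *\<^sub>R x j) - (\<Sum>j<i. \<mu> j *\<^sub>R x j)) \<le> 33 * R\<^sup>2 / ln (real n + 1)"
proof -
  define y where "y j = x j - p" for j
  define z where "z j = \<beta> \<bullet> (x j - p) - l" for j
  have y: "norm (y j) \<le> R" and z: "\<bar>z j\<bar> \<le> 5 / 2 * R\<^sup>2" if "j < 4 * n" for j
    using x[OF that] l[OF that] by (auto simp: y_def z_def)
  \<comment> \<open>the functional as an additional coordinate, scaled to the size \<open>R\<close>\<close>
  define w where "w j = z j / (5 / 2 * R)" for j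
  have yw: "(norm (y j, w j))\<^sup>2 \<le> 2 * R\<^sup>2" if "j < 4 * n" for j
  proof -
    have "\<bar>w j\<bar> \<le> \<bar>R\<bar>" using z[OF that] R by (simp add: w_def abs_mult field_simps power2_eq_square)
    then have "(w j)\<^sup>2 \<le> R\<^sup>2" by (simp only: abs_le_square_iff)
    moreover have "(norm (y j))\<^sup>2 \<le> R\<^sup>2" using y[OF that] by (intro power_mono) auto
    ultimately show ?thesis by (simp add: norm_Pair)
  qed
  have "\<exists>i\<in>{n..<3 * n}. (norm (\<Sum>j<4 * n. (1 / (real j - real i)) *\<^sub>R (y j, w j)))\<^sup>2 \<le> 28 * (2 * R\<^sup>2)"
    by (rule cut_with_small_hilbert_sum[OF n]) (rule yw)
  then obtain i where "i \<in> {n..<3 * n}"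
    and T: "(norm (\<Sum>j<4 * n. (1 / (real j - real i)) *\<^sub>R (y j, w j)))\<^sup>2 \<le> 28 * (2 * R\<^sup>2)"
    by (elim bexE)
  then have i: "n \<le> i" "i < 3 * n" by auto
  define V :: real where "V = harm i"
  define W :: real where "W = harm (4 * n - 1 - i)"
  define \<mu> where "\<mu> j = 1 / (real i - real j) / V" for j
  define \<nu> where "\<nu> j = 1 / (real j - real i) / W" for j
  define A where "A = (\<Sum>j<4 * n. (1 / (real j - real i)) *\<^sub>R y j)"
  define a where "a = (\<Sum>j<4 * n. (1 / (real j - real i)) *\<^sub>R z j)"
  have ln0: "ln (real n + 1) > 0" using n by simp
  have V: "harm n \<le> V" "V \<le> harm (3 * n)" and W: "harm n \<le> W" "W \<le> harm (3 * n)"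
    using i by (auto simp: V_def W_def intro!: harm_mono)
  have pos: "V > 0" "W > 0" "ln (real n + 1) \<le> W"
    using V(1) W(1) ln_le_harm[of n] ln0 by linarith+
  have VW: "\<bar>V - W\<bar> \<le> 2" using V W harm_triple_le[of n] by linarith
  have \<mu>: "\<mu> j \<ge> 0" if "j < i" for j using that pos by (simp add: \<mu>_def)
  have \<nu>: "\<nu> j \<ge> 0" if "i < j" for j using that pos by (simp add: \<nu>_def)
  have \<mu>1: "sum \<mu> {..<i} = 1"
    unfolding \<mu>_def sum_divide_distrib[symmetric] sum_past_weights V_def[symmetric] using pos by simp
  have \<nu>1: "sum \<nu> {i<..<4 * n} = 1"
    unfolding \<nu>_def sum_divide_distrib[symmetric] sum_future_weights W_def[symmetric] using pos by simp
  define P where "P = (\<Sum>j<i. \<mu> j *\<^sub>R x j)"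
  define F where "F = (\<Sum>j\<in>{i<..<4 * n}. \<nu> j *\<^sub>R x j)"
  have Py: "(\<Sum>j<i. \<mu> j *\<^sub>R y j) = P - p"
    by (simp add: y_def P_def scaleR_diff_right sum_subtractf scaleR_sum_left[symmetric] \<mu>1)
  have Fy: "(\<Sum>j\<in>{i<..<4 * n}. \<nu> j *\<^sub>R y j) = F - p"
    by (simp add: y_def F_def scaleR_diff_right sum_subtractf scaleR_sum_left[symmetric] \<nu>1)
  have Pz: "(\<Sum>j<i. \<mu> j *\<^sub>R z j) = \<beta> \<bullet> (P - p) - l"
    unfolding Py[symmetric]
    by (simp add: z_def y_def inner_sum_right right_diff_distrib sum_subtractf sum_distrib_right[symmetric] \<mu>1)
  have Fz: "(\<Sum>j\<in>{i<..<4 * n}. \<nu> j *\<^sub>R z j) = \<beta> \<bullet> (F - p) - l"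
    unfolding Fy[symmetric]
    by (simp add: z_def y_def inner_sum_right right_diff_distrib sum_subtractf sum_distrib_right[symmetric] \<nu>1)
  have Pn: "norm (P - p) \<le> R" unfolding Py[symmetric]
    using i by (intro norm_weighted_sum_le \<mu> \<mu>1 y) auto
  have Pzn: "\<bar>\<beta> \<bullet> (P - p) - l\<bar> \<le> 5 / 2 * R\<^sup>2" unfolding Pz[symmetric] real_norm_def[symmetric]
    using i z by (intro norm_weighted_sum_le \<mu> \<mu>1) auto
  have i4: "i < 4 * n" using i by simp
  have WA: "W *\<^sub>R (F - P) = A + (V - W) *\<^sub>R (P - p)"
    using hilbert_sum_split[OF i4, of V W y] pos Py Fy by (simp add: \<mu>_def \<nu>_def A_def)
  have Wa: "W * (\<beta> \<bullet> (F - P)) = a + (V - W) * (\<beta> \<bullet> (P - p) - l)"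
    using hilbert_sum_split[OF i4, of V W z] pos Pz Fz
    by (simp add: \<mu>_def \<nu>_def a_def inner_diff_right)
  define b where "b = (\<Sum>j<4 * n. (1 / (real j - real i)) *\<^sub>R w j)"
  have zw: "z j = (5 / 2 * R) *\<^sub>R w j" for j using R by (simp add: w_def)
  have ab: "a = 5 / 2 * R * b"
    by (simp add: a_def b_def zw sum_distrib_left mult_ac)
  have Tp: "(\<Sum>j<4 * n. (1 / (real j - real i)) *\<^sub>R (y j, w j)) = (A, b)"
    unfolding A_def b_def by (simp add: prod_eq_iff fst_sum snd_sum)
  have T': "(norm A)\<^sup>2 + b\<^sup>2 \<le> 56 * R\<^sup>2" using T unfolding Tp norm_Pair by simp
  have A: "norm A \<le> 8 * R"
  proof (rule power2_le_imp_le)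
    have "(norm A)\<^sup>2 \<le> 56 * R\<^sup>2" using T' zero_le_power2[of b] by linarith
    also have "\<dots> \<le> (8 * R)\<^sup>2" by (simp add: power2_eq_square)
    finally show "(norm A)\<^sup>2 \<le> (8 * R)\<^sup>2" .
  qed (use R in simp)
  \<comment> \<open>Cauchy-Schwarz: \<open>2\<^sup>2 + (5/2)\<^sup>2 = 41/4\<close>, and \<open>41/4 \<cdot> 56 < 24\<^sup>2\<close>\<close>
  have comb: "2 * norm A + 5 / 2 * \<bar>b\<bar> \<le> 24 * R"
  proof (rule power2_le_imp_le)
    have "(2 * s + 5 / 2 * t)\<^sup>2 = (41 / 4) * (s\<^sup>2 + t\<^sup>2) - (5 / 2 * s - 2 * t)\<^sup>2" for s t :: real
      by (simp add: power2_eq_square algebra_simps)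
    from this[of "norm A" "\<bar>b\<bar>"]
    have "(2 * norm A + 5 / 2 * \<bar>b\<bar>)\<^sup>2 \<le> (41 / 4) * ((norm A)\<^sup>2 + b\<^sup>2)"
      using zero_le_power2[of "5 / 2 * norm A - 2 * \<bar>b\<bar>"] unfolding power2_abs by linarith
    also have "\<dots> \<le> (41 / 4) * (56 * R\<^sup>2)" using T' by simp
    also have "\<dots> \<le> (24 * R)\<^sup>2" by (simp add: power2_eq_square)
    finally show "(2 * norm A + 5 / 2 * \<bar>b\<bar>)\<^sup>2 \<le> (24 * R)\<^sup>2" .
  qed (use R in simp)
  have "R * (2 * norm A + 5 / 2 * \<bar>b\<bar>) \<le> R * (24 * R)" using R comb by (intro mult_left_mono) auto
  moreover have "\<bar>a\<bar> = 5 / 2 * R * \<bar>b\<bar>" using R by (simp add: ab abs_mult)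
  ultimately have comb: "2 * R * norm A + \<bar>a\<bar> \<le> 24 * R\<^sup>2" by (simp add: algebra_simps power2_eq_square)
  have n1: "W * norm (F - P) \<le> norm A + 2 * R"
  proof -
    have "W * norm (F - P) = norm (W *\<^sub>R (F - P))" using pos by simp
    also have "\<dots> \<le> norm A + \<bar>V - W\<bar> * norm (P - p)" unfolding WA
      using norm_triangle_ineq[of A "(V - W) *\<^sub>R (P - p)"] by simp
    also have "\<bar>V - W\<bar> * norm (P - p) \<le> 2 * R" using VW Pn by (intro mult_mono) auto
    finally show ?thesis by simp
  qed
  have n2: "W * (\<beta> \<bullet> (F - P)) \<le> \<bar>a\<bar> + 5 * R\<^sup>2"
  proof -
    have "\<bar>(V - W) * (\<beta> \<bullet> (P - p) - l)\<bar> \<le> 2 * (5 / 2 * R\<^sup>2)" unfolding abs_mult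
      using VW Pzn by (intro mult_mono) auto
    then show ?thesis unfolding Wa by linarith
  qed
  have below: "c / W \<le> c / ln (real n + 1)" if "c \<ge> 0" for c
    using pos(3) that ln0 by (rule divide_left_mono[OF _ _ mult_pos_pos[OF pos(2)]])
  have f1: "norm (F - P) \<le> 10 * R / ln (real n + 1)"
  proof -
    have "norm (F - P) \<le> 10 * R / W"
      using n1 A pos(2) by (simp add: pos_le_divide_eq mult.commute)
    also have "\<dots> \<le> 10 * R / ln (real n + 1)" using R by (intro below) simp
    finally show ?thesis .
  qed
  have f2: "\<beta> \<bullet> (F - P) + 2 * R * norm (F - P) \<le> 33 * R\<^sup>2 / ln (real n + 1)"
  proof -
    have "2 * R * (W * norm (F - P)) \<le> 2 * R * (norm A + 2 * R)" using n1 R by (intro mult_left_mono) auto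
    also have "\<dots> = 2 * R * norm A + 4 * R\<^sup>2" by (simp add: algebra_simps power2_eq_square)
    finally have "W * (\<beta> \<bullet> (F - P)) + 2 * R * (W * norm (F - P)) \<le> 33 * R\<^sup>2"
      using n2 comb by linarith
    moreover have "W * (s + 2 * R * t) = W * s + 2 * R * (W * t)" for s t by (simp add: algebra_simps)
    ultimately have "W * (\<beta> \<bullet> (F - P) + 2 * R * norm (F - P)) \<le> 33 * R\<^sup>2" by simp
    then have "\<beta> \<bullet> (F - P) + 2 * R * norm (F - P) \<le> 33 * R\<^sup>2 / W"
      using pos(2) by (simp only: pos_le_divide_eq mult.commute)
    also have "\<dots> \<le> 33 * R\<^sup>2 / ln (real n + 1)" by (intro below) simp
    finally show ?thesis .
  qed
  show ?thesis
  proof (rule that[of i \<mu> \<nu>])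
    show "\<mu> j \<ge> 0" if "j < i" for j using that by (rule \<mu>)
    show "\<nu> j \<ge> 0" if "i < j" for j using that by (rule \<nu>)
  qed (fact i \<mu>1 \<nu>1 f1[unfolded F_def P_def] f2[unfolded F_def P_def])+
qed

section \<open>Resolvents and their variational inequality\<close>

text \<open>
  The role of \<open>F\<close> will be played by the composition of the given contraction with \<open>T\<close>.
\<close>

locale viscosity_setting =
  fixes C :: "'a::{real_inner, complete_space} set" and T F :: "'a \<Rightarrow> 'a" and d \<tau> :: real
  assumes closed_C: "closed C" and convex_C: "convex C" and C_ne: "C \<noteq> {}"
    and diam: "\<And>x y. x \<in> C \<Longrightarrow> y \<in> C \<Longrightarrow> norm (x - y) \<le> d" and d_ge: "d \<ge> 1"
    and T_in: "\<And>x. x \<in> C \<Longrightarrow> T x \<in> C"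
    and T_nonexp: "\<And>x y. x \<in> C \<Longrightarrow> y \<in> C \<Longrightarrow> norm (T x - T y) \<le> norm (x - y)"
    and F_in: "\<And>x. x \<in> C \<Longrightarrow> F x \<in> C"
    and F_contr: "\<And>x y. x \<in> C \<Longrightarrow> y \<in> C \<Longrightarrow> norm (F x - F y) \<le> \<tau> * norm (x - y)"
    and tau: "0 < \<tau>" "\<tau> < 1"
begin

definition contracts :: "('a \<Rightarrow> 'a) \<Rightarrow> bool" where
  "contracts H \<longleftrightarrow> (\<forall>x\<in>C. H x \<in> C) \<and> (\<forall>x\<in>C. \<forall>y\<in>C. norm (H x - H y) \<le> \<tau> * norm (x - y))"

lemma contracts_F: "contracts F"
  using F_in F_contr by (simp add: contracts_def)

lemma contracts_const: "v \<in> C \<Longrightarrow> contracts (\<lambda>_. v)"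
  using tau by (simp add: contracts_def)

text \<open>
  For \<open>H = F\<close> these are the resolvents \<open>z\<^sub>K\<close>, for a constant map \<open>H\<close> they form Browder's path.
  The parameter is the reciprocal of the usual one, so that it can be compared with the thresholds
  of the stages.
\<close>

definition resolvent :: "('a \<Rightarrow> 'a) \<Rightarrow> real \<Rightarrow> 'a" where
  "resolvent H K = (SOME w. w \<in> C \<and> w = (1 - 1 / K) *\<^sub>R T w + (1 / K) *\<^sub>R H w)"

lemma resolvent_exists:
  assumes H: "contracts H" and K: "K \<ge> 1"
  shows "\<exists>w. w \<in> C \<and> w = (1 - 1 / K) *\<^sub>R T w + (1 / K) *\<^sub>R H w"
proof -
  define t where "t = 1 / K"
  have t: "0 < t" "t \<le> 1" using K by (auto simp: t_def)
  define S where "S w = (1 - t) *\<^sub>R T w + t *\<^sub>R H w" for w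
  have S_in: "S w \<in> C" if "w \<in> C" for w
    unfolding S_def using that H t T_in by (intro convexD_alt[OF convex_C]) (auto simp: contracts_def)
  have "norm (S x - S y) \<le> (1 - t * (1 - \<tau>)) * norm (x - y)" if "x \<in> C" "y \<in> C" for x y
  proof -
    have "S x - S y = (1 - t) *\<^sub>R (T x - T y) + t *\<^sub>R (H x - H y)" by (simp add: S_def algebra_simps)
    then have "norm (S x - S y) \<le> (1 - t) * norm (T x - T y) + t * norm (H x - H y)"
      using norm_triangle_ineq[of "(1 - t) *\<^sub>R (T x - T y)" "t *\<^sub>R (H x - H y)"] t by simp
    also have "\<dots> \<le> (1 - t) * norm (x - y) + t * (\<tau> * norm (x - y))"
      using T_nonexp[OF that] H that t by (intro add_mono mult_left_mono) (auto simp: contracts_def)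
    finally show ?thesis by (simp add: algebra_simps)
  qed
  moreover have "0 \<le> 1 - t * (1 - \<tau>)" "1 - t * (1 - \<tau>) < 1"
    using t tau mult_le_one[of t "1 - \<tau>"] by auto
  ultimately have "\<exists>!w. w \<in> C \<and> S w = w"
    using C_ne S_in closed_C by (intro Banach_fix[of _ "1 - t * (1 - \<tau>)"]) (auto simp: complete_eq_closed dist_norm)
  then show ?thesis unfolding S_def t_def by metis
qed

lemma
  assumes "contracts H" "K \<ge> 1"
  shows resolvent_in: "resolvent H K \<in> C"
    and resolvent_eq: "resolvent H K = (1 - 1 / K) *\<^sub>R T (resolvent H K) + (1 / K) *\<^sub>R H (resolvent H K)"
  using someI_ex[OF resolvent_exists[OF assms]] by (auto simp: resolvent_def)

lemma resolvent_approx_fixed: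
  assumes H: "contracts H" and K: "K \<ge> 1"
  shows "norm (resolvent H K - T (resolvent H K)) \<le> d / K"
proof -
  define w where "w = resolvent H K"
  have w: "w \<in> C" "w = (1 - 1 / K) *\<^sub>R T w + (1 / K) *\<^sub>R H w"
    using resolvent_in[OF assms] resolvent_eq[OF assms] by (auto simp: w_def)
  have "w - T w = (1 / K) *\<^sub>R (H w - T w)" by (subst w(2)) (simp add: algebra_simps)
  then have "norm (w - T w) = (1 / K) * norm (H w - T w)" using K by simp
  also have "\<dots> \<le> (1 / K) * d"
    using w(1) H K T_in diam by (intro mult_left_mono) (auto simp: contracts_def)
  finally show ?thesis by (simp add: w_def)
qed

text \<open>
  The equation for \<open>w\<close> says \<open>w - H w = -(K - 1) (w - T w)\<close>, and \<open>w - T w\<close> can be compared with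
  \<open>y - T y\<close> because \<open>I - T\<close> is monotone.
\<close>

lemma resolvent_variational:
  assumes H: "contracts H" and K: "K \<ge> 1" and y: "y \<in> C"
  shows "(resolvent H K - H (resolvent H K)) \<bullet> (y - resolvent H K) \<ge> - (K * d * norm (y - T y))"
proof -
  define w where "w = resolvent H K"
  have w: "w \<in> C" "w = (1 - 1 / K) *\<^sub>R T w + (1 / K) *\<^sub>R H w"
    using resolvent_in[OF H K] resolvent_eq[OF H K] by (auto simp: w_def)
  have "K *\<^sub>R w = K *\<^sub>R ((1 - 1 / K) *\<^sub>R T w + (1 / K) *\<^sub>R H w)" using w(2) by simp
  also have "\<dots> = (K - 1) *\<^sub>R T w + H w" using K by (simp add: scaleR_add_right right_diff_distrib)
  finally have "H w = K *\<^sub>R w - (K - 1) *\<^sub>R T w" by simp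
  then have "w - H w = (1 - K) *\<^sub>R (w - T w)" by (simp add: algebra_simps)
  then have "(w - H w) \<bullet> (y - w) = (1 - K) * ((w - T w) \<bullet> (y - w))" by simp
  moreover have "(w - T w) \<bullet> (y - w) = - ((w - T w) \<bullet> (w - y))" by (simp add: inner_diff_right)
  ultimately have eq: "(w - H w) \<bullet> (y - w) = (K - 1) * ((w - T w) \<bullet> (w - y))" by (simp add: left_diff_distrib)
  have "(T w - T y) \<bullet> (w - y) \<le> norm (T w - T y) * norm (w - y)" by (rule norm_cauchy_schwarz)
  also have "\<dots> \<le> norm (w - y) * norm (w - y)" using T_nonexp[OF w(1) y] by (intro mult_right_mono) auto
  also have "\<dots> = (w - y) \<bullet> (w - y)" by (simp add: power2_norm_eq_inner[symmetric] power2_eq_square)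
  finally have "(y - T y) \<bullet> (w - y) \<le> (w - T w) \<bullet> (w - y)" by (simp add: inner_diff_left)
  moreover have "\<bar>(y - T y) \<bullet> (w - y)\<bar> \<le> norm (y - T y) * d"
    using Cauchy_Schwarz_ineq2[of "y - T y" "w - y"] mult_left_mono[OF diam[OF w(1) y] norm_ge_zero[of "y - T y"]]
    by linarith
  ultimately have "(w - T w) \<bullet> (w - y) \<ge> - (d * norm (y - T y))" by (simp add: mult.commute)
  then have "(K - 1) * ((w - T w) \<bullet> (w - y)) \<ge> (K - 1) * - (d * norm (y - T y))"
    using K by (intro mult_left_mono) auto
  moreover have "(K - 1) * - (d * norm (y - T y)) \<ge> - (K * d * norm (y - T y))"
    using d_ge by (simp add: algebra_simps)
  ultimately show ?thesis using eq by (simp add: w_def)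
qed

lemma strongly_monotone:
  assumes "x \<in> C" "y \<in> C"
  shows "((x - F x) - (y - F y)) \<bullet> (x - y) \<ge> (1 - \<tau>) * (norm (x - y))\<^sup>2"
proof -
  have "(F x - F y) \<bullet> (x - y) \<le> norm (F x - F y) * norm (x - y)" by (rule norm_cauchy_schwarz)
  also have "\<dots> \<le> \<tau> * norm (x - y) * norm (x - y)" using F_contr[OF assms] by (intro mult_right_mono) auto
  finally have "(F x - F y) \<bullet> (x - y) \<le> \<tau> * (norm (x - y))\<^sup>2" by (simp add: power2_eq_square)
  then show ?thesis
    by (simp add: inner_diff_left power2_norm_eq_inner left_diff_distrib algebra_simps)
qed

end

section \<open>The iteration along a sequence of stages\<close>

text \<open>
  Stage \<open>i\<close> has a threshold \<open>K i\<close> and consists of the indices from \<open>first i\<close> to \<open>last i\<close>. On it,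
  \<open>lam\<close> is at most \<open>1 / K i\<close>, because the stage begins late, and at least \<open>1 / Lam i\<close>, because the
  stage is finite. The thresholds grow so fast that \<open>1 / K (Suc i)\<close> is negligible compared with
  this lower bound, even if the latter is multiplied by a power of \<open>1 / K i\<close> of order
  \<open>1 / (1 - \<tau>)\<close>. All errors are absorbed in the tolerance \<open>\<sigma>\<close>.
\<close>

locale viscosity_stages = viscosity_setting C T F d \<tau>
  for C :: "'a::{real_inner, complete_space} set" and T F d \<tau> +
  fixes lam :: "nat \<Rightarrow> real" and u :: "nat \<Rightarrow> 'a" and K Lam :: "nat \<Rightarrow> real"
    and first last :: "nat \<Rightarrow> nat" and \<sigma> :: real and q :: nat
  assumes lam_pos: "\<And>j. 0 < lam j" and lam_le: "\<And>j. lam j \<le> 1"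
    and u_0: "u 0 \<in> C"
    and u_Suc: "\<And>j. u (Suc j) = (1 - lam (Suc j)) *\<^sub>R T (u j) + lam (Suc j) *\<^sub>R F (u j)"
    and slow: "\<And>j. j \<ge> first 0 \<Longrightarrow> \<bar>lam j - lam (Suc j)\<bar> \<le> (lam (Suc j))\<^sup>2"
    and first_pos: "1 \<le> first 0"
    and first_mono: "\<And>i k. i \<le> k \<Longrightarrow> first i \<le> first k"
    and last_mono: "\<And>i k. i \<le> k \<Longrightarrow> last i \<le> last k"
    and first_le_last: "\<And>i. first i \<le> last i"
    and lam_small: "\<And>i j. first i \<le> j \<Longrightarrow> lam j \<le> 1 / K i"
    and lam_large: "\<And>i j. j \<le> last i \<Longrightarrow> 1 / Lam i \<le> lam j"
    and Lam_ge: "\<And>i. 1 \<le> Lam i"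
    and sigma: "0 < \<sigma>" "\<sigma> \<le> 1"
    and q: "1 \<le> real q * (1 - \<tau>)"
    and K_0: "8 * d\<^sup>2 / ((1 - \<tau>) * \<sigma>) \<le> K 0"
    and K_Suc: "\<And>i. Lam i * K i ^ (2 * q) \<le> K (Suc i)"
begin

lemma u_in: "u j \<in> C"
proof (induction j)
  case (Suc j)
  then show ?case unfolding u_Suc
    using lam_pos[of "Suc j"] lam_le[of "Suc j"] T_in F_in by (intro convexD_alt[OF convex_C]) auto
qed (rule u_0)

lemma q_ge: "q \<ge> 1"
  using q tau by (cases q) auto

lemma K_0_ge: "K 0 \<ge> 8"
proof -
  have "(1 - \<tau>) * \<sigma> \<le> 1 * 1" using tau sigma by (intro mult_mono) auto
  moreover have "1 \<le> d\<^sup>2" using d_ge by simp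
  ultimately have "8 * ((1 - \<tau>) * \<sigma>) \<le> 8 * d\<^sup>2" by linarith
  then have "8 \<le> 8 * d\<^sup>2 / ((1 - \<tau>) * \<sigma>)" using tau sigma by (simp add: pos_le_divide_eq)
  then show ?thesis using K_0 by linarith
qed

lemma K_props: "K i \<ge> 8 \<and> K i \<ge> 8 * d\<^sup>2 / ((1 - \<tau>) * \<sigma>) \<and> Lam i * (K i)\<^sup>2 \<le> K (Suc i)"
proof -
  have step: "Lam i * (K i)\<^sup>2 \<le> K (Suc i)" if "K i \<ge> 8" for i
  proof -
    have "(K i)\<^sup>2 \<le> K i ^ (2 * q)" using that q_ge by (intro power_increasing) auto
    then have "Lam i * (K i)\<^sup>2 \<le> Lam i * K i ^ (2 * q)" using Lam_ge[of i] by (intro mult_left_mono) auto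
    then show ?thesis using K_Suc[of i] by linarith
  qed
  show ?thesis
  proof (induction i)
    case 0
    show ?case using K_0_ge K_0 step by auto
  next
    case (Suc i)
    have "K i * 1 \<le> K i * K i" using Suc by (intro mult_left_mono) auto
    also have "\<dots> \<le> Lam i * (K i)\<^sup>2" using Lam_ge[of i] by (simp add: power2_eq_square mult_le_cancel_right1)
    finally have "K i \<le> K (Suc i)" using Suc by linarith
    then have "K (Suc i) \<ge> 8" "K (Suc i) \<ge> 8 * d\<^sup>2 / ((1 - \<tau>) * \<sigma>)" using Suc by linarith+
    then show ?case using step by blast
  qed
qed

lemma K_ge: "K i \<ge> 8" and K_ge_sigma: "K i \<ge> 8 * d\<^sup>2 / ((1 - \<tau>) * \<sigma>)"
  and K_Suc_ge: "Lam i * (K i)\<^sup>2 \<le> K (Suc i)"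
  using K_props[of i] by auto

lemma K_mono: "i \<le> k \<Longrightarrow> K i \<le> K k"
proof (rule lift_Suc_mono_le[of K])
  fix i
  have "K i * 1 \<le> K i * K i" using K_ge[of i] by (intro mult_left_mono) auto
  also have "\<dots> \<le> Lam i * (K i)\<^sup>2" using Lam_ge[of i] by (simp add: power2_eq_square mult_le_cancel_right1)
  finally show "K i \<le> K (Suc i)" using K_Suc_ge[of i] by linarith
qed

lemma K_far:
  assumes "i < k"
  shows "8 * d\<^sup>2 * K i \<le> (1 - \<tau>) * \<sigma> * K k"
proof -
  have pos: "(1 - \<tau>) * \<sigma> > 0" using tau sigma by simp
  have "8 * d\<^sup>2 / ((1 - \<tau>) * \<sigma>) * K i \<le> K i * K i"
    using K_ge[of i] by (intro mult_right_mono K_ge_sigma) auto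
  also have "\<dots> \<le> Lam i * (K i)\<^sup>2" using Lam_ge[of i] by (simp add: power2_eq_square mult_le_cancel_right1)
  also have "\<dots> \<le> K k" using K_Suc_ge[of i] K_mono[of "Suc i" k] assms by linarith
  finally show ?thesis using pos by (simp add: pos_divide_le_eq mult.commute)
qed


lemma kappa: "0 < 1 - \<tau>" "1 - \<tau> < 1"
  using tau by auto

lemma K_pos: "K i > 0" and K_ge_1: "K i \<ge> 1"
  using K_ge[of i] by auto

lemma inverse_K: "8 * d\<^sup>2 / K i \<le> (1 - \<tau>) * \<sigma>"
proof -
  have "8 * d\<^sup>2 \<le> (1 - \<tau>) * \<sigma> * K i"
    using K_ge_sigma[of i] kappa sigma by (simp add: pos_divide_le_eq mult.commute)
  then show ?thesis using K_pos[of i] by (simp add: pos_divide_le_eq)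
qed

lemma variational_fixed:
  assumes H: "contracts H" and ik: "i < k" and y: "y \<in> C" "norm (y - T y) \<le> d / K k"
  shows "(resolvent H (K i) - H (resolvent H (K i))) \<bullet> (y - resolvent H (K i)) \<ge> - \<sigma>"
proof -
  have "d\<^sup>2 * K i \<le> 8 * d\<^sup>2 * K i" using K_pos[of i] by simp
  also have "\<dots> \<le> (1 - \<tau>) * \<sigma> * K k" by (rule K_far[OF ik])
  also have "\<dots> \<le> 1 * \<sigma> * K k" using kappa sigma K_pos[of k] by (intro mult_right_mono) auto
  finally have "K i * d * (d / K k) \<le> \<sigma>" using K_pos[of k] by (simp add: pos_divide_le_eq power2_eq_square mult_ac)
  moreover have "K i * d * norm (y - T y) \<le> K i * d * (d / K k)"
    using K_pos[of i] d_ge y(2) by (intro mult_left_mono) auto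
  ultimately show ?thesis using resolvent_variational[OF H K_ge_1 y(1), of i] by linarith
qed

text \<open>
  The condition on the differences of \<open>lam\<close> gives \<open>lam b / lam (Suc b) \<le> 1 + lam (Suc b)\<close>, so
  the logarithm of \<open>1 / lam\<close> increases at most by \<open>lam (Suc b)\<close> in one step.
\<close>

lemma log_ratio_le_sum:
  assumes "first 0 \<le> a" "a \<le> b"
  shows "ln (lam a / lam b) \<le> (\<Sum>l\<in>{a<..b}. lam l)"
  using assms(2)
proof (induction b rule: dec_induct)
  case base then show ?case using lam_pos[of a] by simp
next
  case (step b)
  have "lam b \<le> lam (Suc b) + (lam (Suc b))\<^sup>2" using slow[of b] assms(1) step by linarith
  then have "lam b / lam (Suc b) \<le> 1 + lam (Suc b)"
    using lam_pos[of "Suc b"] by (simp add: pos_divide_le_eq power2_eq_square algebra_simps)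
  then have "ln (lam b / lam (Suc b)) \<le> ln (1 + lam (Suc b))"
    using lam_pos[of b] lam_pos[of "Suc b"] by (intro ln_mono) auto
  also have "\<dots> \<le> lam (Suc b)" using lam_pos[of "Suc b"] by (intro ln_add_one_self_le_self) auto
  finally have "ln (lam b / lam (Suc b)) \<le> lam (Suc b)" .
  moreover have "ln (lam a / lam (Suc b)) = ln (lam a / lam b) + ln (lam b / lam (Suc b))"
    using lam_pos[of a] lam_pos[of b] lam_pos[of "Suc b"] by (simp add: ln_div)
  moreover have "{a<..Suc b} = insert (Suc b) {a<..b}" using step by auto
  ultimately show ?case using step.IH by simp
qed

text \<open>
  From the first index of a stage to that of the next one, \<open>lam\<close> drops from at least \<open>1 / Lam i\<close> to
  at most \<open>1 / K (Suc i)\<close>. By \<open>log_ratio_le_sum\<close> the sum of the \<open>lam l\<close> is then at least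
  \<open>2 q ln (K i)\<close>, and \<open>q\<close> is large enough to compensate for the factor \<open>1 - \<tau>\<close>.
\<close>

lemma relaxation:
  assumes "first (Suc i) \<le> j"
  shows "exp (- (1 - \<tau>) * (\<Sum>l\<in>{first i<..j}. lam l)) \<le> 1 / (K i)\<^sup>2"
proof -
  let ?a = "first i" and ?b = "first (Suc i)"
  have ab: "?a \<le> ?b" by (rule first_mono) simp
  have Lam: "Lam i > 0" using Lam_ge[of i] by linarith
  have "Lam i * K i ^ (2 * q) \<le> K (Suc i)" by (rule K_Suc)
  then have "K i ^ (2 * q) \<le> (1 / Lam i) / (1 / K (Suc i))"
    using Lam by (simp add: pos_le_divide_eq mult.commute)
  also have "\<dots> \<le> lam ?a / lam ?b"
  proof (rule frac_le)
    show "lam ?b \<le> 1 / K (Suc i)" by (rule lam_small) simp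
    show "1 / Lam i \<le> lam ?a" by (rule lam_large[OF first_le_last])
  qed (use lam_pos less_imp_le in auto)
  finally have "ln (K i ^ (2 * q)) \<le> ln (lam ?a / lam ?b)"
    using K_pos[of i] by (intro ln_mono) auto
  also have "\<dots> \<le> (\<Sum>l\<in>{?a<..?b}. lam l)"
    using first_mono[of 0 i] by (intro log_ratio_le_sum ab) simp
  also have "\<dots> \<le> (\<Sum>l\<in>{?a<..j}. lam l)"
    using assms lam_pos by (intro sum_mono2) (auto intro: less_imp_le)
  finally have "2 * real q * ln (K i) \<le> (\<Sum>l\<in>{?a<..j}. lam l)" using K_pos[of i] by (simp add: ln_realpow)
  then have "(1 - \<tau>) * (2 * real q * ln (K i)) \<le> (1 - \<tau>) * (\<Sum>l\<in>{?a<..j}. lam l)"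
    using kappa by (intro mult_left_mono) auto
  moreover have "2 * ln (K i) * 1 \<le> 2 * ln (K i) * (real q * (1 - \<tau>))"
    using q K_ge[of i] by (intro mult_left_mono) auto
  moreover have "(1 - \<tau>) * (2 * real q * ln (K i)) = 2 * ln (K i) * (real q * (1 - \<tau>))" by (simp add: mult_ac)
  ultimately have "- (1 - \<tau>) * (\<Sum>l\<in>{?a<..j}. lam l) \<le> - (2 * ln (K i))" by linarith
  then have "exp (- (1 - \<tau>) * (\<Sum>l\<in>{?a<..j}. lam l)) \<le> exp (- (2 * ln (K i)))" by simp
  also have "\<dots> = 1 / (K i)\<^sup>2"
    using K_pos[of i] by (simp add: exp_minus exp_of_nat_mult[of 2, simplified] inverse_eq_divide)
  finally show ?thesis .
qed

text \<open>
  The map that takes \<open>u j\<close> to \<open>u (Suc j)\<close> contracts with the factor \<open>1 - (1 - \<tau>) lam (Suc j)\<close>;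
  the change of \<open>lam\<close> adds at most \<open>lam (Suc j) d / K i\<close>. The increments decay to the fixed point
  of this recursion.
\<close>

lemma increment_bound:
  assumes "first i \<le> j"
  shows "norm (u j - u (j - 1)) \<le> d / ((1 - \<tau>) * K i) + d * exp (- (1 - \<tau>) * (\<Sum>l\<in>{first i<..j}. lam l))"
  using assms
proof (induction j rule: dec_induct)
  case base
  have "norm (u (first i) - u (first i - 1)) \<le> d" by (intro diam u_in)
  moreover have "0 \<le> d / ((1 - \<tau>) * K i)" using d_ge kappa K_pos[of i] by simp
  ultimately show ?case by simp
next
  case (step j)
  define x where "x = lam (Suc j)"
  define E where "E = exp (- (1 - \<tau>) * (\<Sum>l\<in>{first i<..j}. lam l))"
  have x: "0 < x" "x \<le> 1" using lam_pos lam_le by (auto simp: x_def)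
  have "j \<ge> 1" using first_pos first_mono[of 0 i] step by simp
  then obtain m where m: "j = Suc m" by (cases j) auto
  have j0: "first 0 \<le> j" using first_mono[of 0 i] step by simp
  have "u (Suc j) - u j = (1 - x) *\<^sub>R (T (u j) - T (u m)) + x *\<^sub>R (F (u j) - F (u m))
        + (lam j - x) *\<^sub>R (T (u m) - F (u m))"
    unfolding x_def m u_Suc by (simp add: algebra_simps)
  then have "norm (u (Suc j) - u j) \<le> norm ((1 - x) *\<^sub>R (T (u j) - T (u m))) + norm (x *\<^sub>R (F (u j) - F (u m)))
        + norm ((lam j - x) *\<^sub>R (T (u m) - F (u m)))"
    by (metis norm_triangle_mono norm_triangle_ineq order_refl)
  also have "\<dots> = (1 - x) * norm (T (u j) - T (u m)) + x * norm (F (u j) - F (u m))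
        + \<bar>lam j - x\<bar> * norm (T (u m) - F (u m))"
    using x by simp
  also have "\<dots> \<le> (1 - x) * norm (u j - u m) + x * (\<tau> * norm (u j - u m)) + x / K i * d"
  proof (intro add_mono mult_left_mono mult_mono)
    have "\<bar>lam j - x\<bar> \<le> x * x" using slow[OF j0] by (simp add: x_def power2_eq_square)
    also have "\<dots> \<le> x * (1 / K i)"
      using x lam_small[of i "Suc j"] step by (intro mult_left_mono) (auto simp: x_def)
    finally show "\<bar>lam j - x\<bar> \<le> x / K i" by simp
  qed (use x u_in T_in F_in diam T_nonexp F_contr K_pos[of i] in auto)
  also have "\<dots> = (1 - (1 - \<tau>) * x) * norm (u j - u m) + x / K i * d" by (simp add: algebra_simps)
  also have "\<dots> \<le> (1 - (1 - \<tau>) * x) * (d / ((1 - \<tau>) * K i) + d * E) + x / K i * d"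
    using step.IH x kappa mult_le_one[of "1 - \<tau>" x]
    by (intro add_right_mono mult_left_mono) (auto simp: m E_def)
  also have "\<dots> = d / ((1 - \<tau>) * K i) + (1 - (1 - \<tau>) * x) * (d * E)"
    using kappa K_pos[of i] by (simp add: field_simps)
  also have "\<dots> \<le> d / ((1 - \<tau>) * K i) + exp (- (1 - \<tau>) * x) * (d * E)"
  proof (intro add_left_mono mult_right_mono)
    show "1 - (1 - \<tau>) * x \<le> exp (- (1 - \<tau>) * x)"
      using exp_ge_add_one_self[of "- (1 - \<tau>) * x"] by linarith
  qed (use d_ge in \<open>auto simp: E_def\<close>)
  also have "exp (- (1 - \<tau>) * x) * (d * E) = d * exp (- (1 - \<tau>) * (\<Sum>l\<in>{first i<..Suc j}. lam l))"
  proof -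
    have "{first i<..Suc j} = insert (Suc j) {first i<..j}" using step by auto
    then have "(\<Sum>l\<in>{first i<..Suc j}. lam l) = x + (\<Sum>l\<in>{first i<..j}. lam l)" by (simp add: x_def)
    then show ?thesis by (simp add: E_def exp_add[symmetric] algebra_simps)
  qed
  finally show ?case by simp
qed

lemma asymptotic_regularity:
  assumes "first (Suc i) \<le> j"
  shows "norm (u j - T (u j)) \<le> 3 * d / ((1 - \<tau>) * K i)"
proof -
  have ij: "first i \<le> Suc j" using first_mono[of i "Suc i"] assms by simp
  have Kk: "d / K i \<le> d / ((1 - \<tau>) * K i)"
    using kappa K_pos[of i] d_ge by (intro divide_left_mono) (auto simp: mult_le_cancel_right1)
  have "norm (u (Suc j) - u j) \<le> d / ((1 - \<tau>) * K i) + d * exp (- (1 - \<tau>) * (\<Sum>l\<in>{first i<..Suc j}. lam l))"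
    using increment_bound[OF ij] by simp
  also have "\<dots> \<le> d / ((1 - \<tau>) * K i) + d * (1 / (K i)\<^sup>2)"
    using assms d_ge by (intro add_left_mono mult_left_mono relaxation) auto
  also have "d * (1 / (K i)\<^sup>2) \<le> d * (1 / K i)"
    using d_ge K_ge[of i] by (intro mult_left_mono divide_left_mono) (auto simp: power2_eq_square)
  finally have 1: "norm (u (Suc j) - u j) \<le> d / ((1 - \<tau>) * K i) + d / K i" by simp
  have "u (Suc j) - T (u j) = lam (Suc j) *\<^sub>R (F (u j) - T (u j))" unfolding u_Suc by (simp add: algebra_simps)
  then have "norm (u (Suc j) - T (u j)) = lam (Suc j) * norm (F (u j) - T (u j))" using lam_pos[of "Suc j"] by simp
  also have "\<dots> \<le> (1 / K i) * d"
    using lam_small[OF ij] K_pos[of i] u_in T_in F_in diam by (intro mult_mono) auto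
  finally have 2: "norm (u (Suc j) - T (u j)) \<le> d / K i" by simp
  have "norm (u j - T (u j)) \<le> norm (u j - u (Suc j)) + norm (u (Suc j) - T (u j))"
    using norm_triangle_ineq[of "u j - u (Suc j)" "u (Suc j) - T (u j)"] by simp
  then show ?thesis using 1 2 Kk by (simp add: norm_minus_commute)
qed

text \<open>
  The iterates have to be two stages later: the defect \<open>\<parallel>u j - T (u j)\<parallel>\<close> in stage \<open>k\<close> is of the
  order \<open>1 / K (k - 1)\<close>, and this has to be small compared with \<open>1 / K i\<close>.
\<close>

lemma variational_u:
  assumes H: "contracts H" and ik: "i + 2 \<le> k" and j: "first k \<le> j"
  shows "(resolvent H (K i) - H (resolvent H (K i))) \<bullet> (u j - resolvent H (K i)) \<ge> - \<sigma>"
proof -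
  obtain m where m: "k = Suc m" "i < m" using ik by (cases k) auto
  have "K i * d * (3 * d / ((1 - \<tau>) * K m)) \<le> \<sigma>"
  proof -
    have "3 * d\<^sup>2 * K i \<le> 8 * d\<^sup>2 * K i" using K_pos[of i] by simp
    also have "\<dots> \<le> (1 - \<tau>) * \<sigma> * K m" by (rule K_far[OF m(2)])
    finally show ?thesis using K_pos[of m] kappa by (simp add: pos_divide_le_eq power2_eq_square mult_ac)
  qed
  moreover have "K i * d * norm (u j - T (u j)) \<le> K i * d * (3 * d / ((1 - \<tau>) * K m))"
    using K_pos[of i] d_ge j m by (intro mult_left_mono asymptotic_regularity) auto
  ultimately show ?thesis using resolvent_variational[OF H K_ge_1 u_in, of i j] by linarith
qed

text \<open>
  Expansion of the square for \<open>u (Suc j) - y = (T (u j) - y) + lam (Suc j) (F (u j) - T (u j))\<close>.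
  The error terms are the defect of \<open>y\<close>, which is small even compared with \<open>lam (Suc j)\<close> since
  \<open>y\<close> belongs to a later stage, the defect of \<open>u j\<close>, and the square of \<open>lam (Suc j)\<close>.
\<close>

lemma step_towards:
  assumes y: "y \<in> C" "norm (y - T y) \<le> d / K l" and i: "1 \<le> i" "first i \<le> j" and k: "Suc j \<le> last k" "k < l"
  shows "(norm (u (Suc j) - y))\<^sup>2 \<le> (norm (u j - y))\<^sup>2
           + 2 * lam (Suc j) * ((u j - F (u j)) \<bullet> (y - u j) + \<sigma>)"
proof -
  define U x \<omega> \<nu> where "U = u j" and "x = lam (Suc j)" and "\<omega> = norm (y - T y)" and "\<nu> = norm (U - T U)"
  obtain m where m: "i = Suc m" using i by (cases i) auto
  have x: "0 < x" using lam_pos by (simp add: x_def)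
  have U: "U \<in> C" by (simp add: U_def u_in)
  have Kx: "1 / K n \<le> (1 - \<tau>) * \<sigma> / (8 * d\<^sup>2)" for n
  proof -
    have d0: "0 < 8 * d\<^sup>2" using d_ge by simp
    have "8 * d\<^sup>2 * (1 / K n) \<le> (1 - \<tau>) * \<sigma>" using inverse_K[of n] by simp
    then show ?thesis using d0 by (simp only: pos_le_divide_eq mult.commute)
  qed
  have xs: "x \<le> 1 / K i" unfolding x_def by (rule lam_small) (use i in simp)
  have om: "\<omega> * d \<le> x * ((1 - \<tau>) * \<sigma> / 8)"
  proof -
    have Lam: "Lam k > 0" using Lam_ge[of k] by linarith
    have "Lam k * (K k)\<^sup>2 \<le> K l" using K_Suc_ge[of k] K_mono[of "Suc k" l] k by simp
    then have "1 / K l \<le> 1 / (Lam k * (K k)\<^sup>2)"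
      using Lam K_pos[of k] by (intro divide_left_mono mult_pos_pos K_pos) auto
    also have "\<dots> = (1 / Lam k) * (1 / K k) * (1 / K k)" by (simp add: power2_eq_square)
    also have "\<dots> \<le> x * ((1 - \<tau>) * \<sigma> / (8 * d\<^sup>2)) * 1"
      using lam_large[OF k(1)] Kx[of k] K_ge_1[of k] Lam x K_pos[of k] kappa sigma
      by (intro mult_mono) (auto simp: x_def)
    finally have "1 / K l * d\<^sup>2 \<le> x * ((1 - \<tau>) * \<sigma> / (8 * d\<^sup>2)) * d\<^sup>2"
      by (intro mult_right_mono) auto
    also have "\<dots> = x * ((1 - \<tau>) * \<sigma> / 8)" using d_ge by simp
    finally have "d / K l * d \<le> x * ((1 - \<tau>) * \<sigma> / 8)" by (simp add: power2_eq_square)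
    moreover have "\<omega> * d \<le> d / K l * d" using y d_ge by (intro mult_right_mono) (auto simp: \<omega>_def)
    ultimately show ?thesis by linarith
  qed
  have nu: "\<nu> * d \<le> 3 / 8 * \<sigma>"
  proof -
    have "\<nu> \<le> 3 * d / ((1 - \<tau>) * K m)" unfolding \<nu>_def U_def
      using i m by (intro asymptotic_regularity) auto
    also have "\<dots> = 3 * d / (1 - \<tau>) * (1 / K m)" by simp
    also have "\<dots> \<le> 3 * d / (1 - \<tau>) * ((1 - \<tau>) * \<sigma> / (8 * d\<^sup>2))"
      using d_ge kappa by (intro mult_left_mono Kx) auto
    finally have "\<nu> * d \<le> 3 * d / (1 - \<tau>) * ((1 - \<tau>) * \<sigma> / (8 * d\<^sup>2)) * d"
      using d_ge by (intro mult_right_mono) auto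
    also have "\<dots> = 3 / 8 * \<sigma>" using d_ge kappa by (simp add: power2_eq_square)
    finally show ?thesis .
  qed
  have xd: "x * d\<^sup>2 \<le> \<sigma> / 8"
  proof -
    have "x * d\<^sup>2 \<le> (1 - \<tau>) * \<sigma> / (8 * d\<^sup>2) * d\<^sup>2" using xs Kx[of i] by (intro mult_right_mono) auto
    also have "\<dots> = (1 - \<tau>) * \<sigma> / 8" using d_ge by simp
    also have "\<dots> \<le> 1 * \<sigma> / 8" using kappa sigma by (intro divide_right_mono mult_right_mono) auto
    finally show ?thesis by simp
  qed
  have "u (Suc j) - y = (T U - y) + x *\<^sub>R (F U - T U)"
    unfolding u_Suc U_def x_def by (simp add: algebra_simps)
  moreover have "(norm (a + x *\<^sub>R b))\<^sup>2 = (norm a)\<^sup>2 + 2 * x * (b \<bullet> a) + x\<^sup>2 * (norm b)\<^sup>2" for a b :: 'a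
    unfolding power2_norm_eq_inner
    by (simp add: inner_add_left inner_add_right inner_commute) (simp add: power2_eq_square algebra_simps)
  ultimately have "(norm (u (Suc j) - y))\<^sup>2 = (norm (T U - y))\<^sup>2 + 2 * x * ((F U - T U) \<bullet> (T U - y)) + x\<^sup>2 * (norm (F U - T U))\<^sup>2"
    by (simp only:)
  moreover have "(norm (T U - y))\<^sup>2 \<le> (norm (U - y))\<^sup>2 + 3 * (\<omega> * d)"
  proof -
    have "norm (T U - y) \<le> norm (T U - T y) + norm (T y - y)"
      using norm_triangle_ineq[of "T U - T y" "T y - y"] by simp
    also have "\<dots> \<le> norm (U - y) + \<omega>"
      using T_nonexp[OF U y(1)] by (simp add: \<omega>_def norm_minus_commute)
    finally have "(norm (T U - y))\<^sup>2 \<le> (norm (U - y) + \<omega>)\<^sup>2" by (intro power_mono) auto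
    also have "\<dots> = (norm (U - y))\<^sup>2 + (2 * norm (U - y) + \<omega>) * \<omega>" by (simp add: power2_eq_square algebra_simps)
    also have "\<dots> \<le> (norm (U - y))\<^sup>2 + (2 * d + d) * \<omega>"
      using diam[OF U y(1)] diam[OF y(1) T_in[OF y(1)]]
      by (intro add_left_mono mult_right_mono add_mono mult_left_mono) (auto simp: \<omega>_def)
    finally show ?thesis by (simp add: mult_ac)
  qed
  moreover have "(F U - T U) \<bullet> (T U - y) \<le> (U - F U) \<bullet> (y - U) + 2 * (\<nu> * d)"
  proof -
    have eq: "(F U - T U) \<bullet> (T U - y) = (U - F U) \<bullet> (y - U) + ((F U - T U) \<bullet> (T U - U) + (U - T U) \<bullet> (U - y))"
      by (simp add: inner_diff_left inner_diff_right inner_commute)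
    have "(F U - T U) \<bullet> (T U - U) \<le> d * \<nu>"
      using norm_cauchy_schwarz[of "F U - T U" "T U - U"] mult_right_mono[OF diam[OF F_in[OF U] T_in[OF U]], of \<nu>]
      by (simp add: \<nu>_def norm_minus_commute)
    moreover have "(U - T U) \<bullet> (U - y) \<le> \<nu> * d"
      using norm_cauchy_schwarz[of "U - T U" "U - y"] mult_left_mono[OF diam[OF U y(1)], of \<nu>]
      by (simp add: \<nu>_def)
    ultimately show ?thesis using eq by (simp add: mult_ac)
  qed
  then have "2 * x * ((F U - T U) \<bullet> (T U - y)) \<le> 2 * x * ((U - F U) \<bullet> (y - U) + 2 * (\<nu> * d))"
    using x by (intro mult_left_mono) auto
  moreover have "x\<^sup>2 * (norm (F U - T U))\<^sup>2 \<le> x * (x * d\<^sup>2)"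
  proof -
    have "(norm (F U - T U))\<^sup>2 \<le> d\<^sup>2" using diam[OF F_in[OF U] T_in[OF U]] by (intro power_mono) auto
    then have "x\<^sup>2 * (norm (F U - T U))\<^sup>2 \<le> x\<^sup>2 * d\<^sup>2" by (intro mult_left_mono) auto
    then show ?thesis by (simp add: power2_eq_square mult_ac)
  qed
  moreover have "x * (x * d\<^sup>2) \<le> x * (\<sigma> / 8)" "x * (\<nu> * d) \<le> x * (3 / 8 * \<sigma>)" using xd nu x by (auto intro: mult_left_mono)
  moreover have "x * ((1 - \<tau>) * \<sigma> / 8) \<le> x * (\<sigma> / 8)" using x kappa sigma by (intro mult_left_mono) auto
  ultimately have "(norm (u (Suc j) - y))\<^sup>2 \<le> (norm (U - y))\<^sup>2 + 2 * x * ((U - F U) \<bullet> (y - U)) + 2 * x * \<sigma>"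
    using om by (simp add: distrib_left)
  then show ?thesis by (simp add: U_def x_def distrib_left)
qed

end

section \<open>Settling near a mean of later resolvents\<close>

context viscosity_stages
begin

definition z :: "nat \<Rightarrow> 'a" where "z i = resolvent F (K i)"

lemma z_in: "z i \<in> C"
  unfolding z_def by (rule resolvent_in[OF contracts_F K_ge_1])

lemma resolvent_level:
  assumes "contracts H" "l \<le> i"
  shows "norm (resolvent H (K i) - T (resolvent H (K i))) \<le> d / K l"
proof -
  have "norm (resolvent H (K i) - T (resolvent H (K i))) \<le> d / K i" by (rule resolvent_approx_fixed[OF assms(1) K_ge_1])
  also have "\<dots> \<le> d / K l" using K_mono[OF assms(2)] d_ge K_pos by (intro divide_left_mono) auto
  finally show ?thesis .
qed

definition near :: "nat \<Rightarrow> nat \<Rightarrow> 'a \<Rightarrow> real \<Rightarrow> bool" where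
  "near a b p R \<longleftrightarrow> p \<in> C \<and> (\<forall>i\<in>{a..b}. norm (z i - p) \<le> R)
     \<and> (\<forall>j\<in>{first a..last b}. norm (u j - p) \<le> R)"

lemma near_shrink: "near a b p R \<Longrightarrow> a \<le> a' \<Longrightarrow> b' \<le> b \<Longrightarrow> near a' b' p R"
  using first_mono[of a a'] last_mono[of b' b] by (auto simp: near_def)

text \<open>
  The inequality in \<open>step_towards\<close> is affine in \<open>y\<close>, so it extends to convex combinations \<open>M\<close>. With the
  assumption it makes \<open>\<parallel>u j - M\<parallel>\<^sup>2\<close> contract towards \<open>r + \<sigma> / \<alpha>\<close>; one stage is enough for the initial
  distance to be forgotten, which is why the conclusion starts at \<open>Suc a\<close>. Resolvents need no time:
  for them the left side of the assumption is at least \<open>- \<sigma>\<close>.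
\<close>

lemma settle:
  fixes r :: real
  assumes M: "M \<in> convex hull {y \<in> C. norm (y - T y) \<le> d / K l}"
    and ab: "1 \<le> a" "b < l"
    and \<alpha>: "1 - \<tau> \<le> \<alpha>" "\<alpha> \<le> 1"
    and att: "\<And>y. y \<in> z ` {a..b} \<union> u ` {first a..last b} \<Longrightarrow> (y - F y) \<bullet> (M - y) \<le> \<alpha> * (r - (norm (y - M))\<^sup>2)"
    and r: "r \<ge> 0" and R: "r + 3 * \<sigma> / (1 - \<tau>) \<le> R\<^sup>2" "R \<ge> 0"
  shows "near (Suc a) b M R"
proof -
  let ?A = "{y \<in> C. norm (y - T y) \<le> d / K l}"
  have \<alpha>0: "\<alpha> > 0" using \<alpha> kappa by linarith
  have s1: "\<sigma> \<le> \<sigma> / (1 - \<tau>)" using kappa sigma by (simp add: pos_le_divide_eq mult_le_cancel_left1)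
  have s2: "\<sigma> / \<alpha> \<le> \<sigma> / (1 - \<tau>)" using \<alpha> kappa sigma by (intro divide_left_mono) auto
  have s3: "r + 3 * (\<sigma> / (1 - \<tau>)) \<le> R\<^sup>2" using R(1) by simp
  have hull: "convex hull ?A \<subseteq> S" if "convex S" "?A \<subseteq> S" for S using that by (rule hull_minimal[rotated])
  have MC: "M \<in> C" using M hull[OF convex_C] by auto
  have near_z: "norm (z i - M) \<le> R" if i: "i \<in> {a..b}" for i
  proof -
    have "convex {y. (z i - F (z i)) \<bullet> y \<ge> (z i - F (z i)) \<bullet> z i - \<sigma>}"
      by (rule convex_halfspace_ge)
    moreover have "?A \<subseteq> {y. (z i - F (z i)) \<bullet> y \<ge> (z i - F (z i)) \<bullet> z i - \<sigma>}"
    proof (intro subsetI CollectI)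
      fix y assume "y \<in> ?A"
      then have "(z i - F (z i)) \<bullet> (y - z i) \<ge> - \<sigma>"
        unfolding z_def using i ab by (intro variational_fixed[OF contracts_F, of i l]) auto
      then show "(z i - F (z i)) \<bullet> y \<ge> (z i - F (z i)) \<bullet> z i - \<sigma>"
        by (simp only: inner_diff_right)
    qed
    ultimately have "M \<in> {y. (z i - F (z i)) \<bullet> y \<ge> (z i - F (z i)) \<bullet> z i - \<sigma>}" using M hull by blast
    then have "- \<sigma> \<le> (z i - F (z i)) \<bullet> (M - z i)" by (simp add: inner_diff_right)
    also have "\<dots> \<le> \<alpha> * (r - (norm (z i - M))\<^sup>2)" using i by (intro att) auto
    finally have "(norm (z i - M))\<^sup>2 \<le> r + \<sigma> / \<alpha>" using \<alpha>0 by (simp add: field_simps)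
    also have "\<dots> \<le> R\<^sup>2" using s2 s3 s1 sigma by linarith
    finally show ?thesis using R(2) power2_le_imp_le by blast
  qed
  have towards: "(norm (u (Suc j) - M))\<^sup>2 \<le> (norm (u j - M))\<^sup>2 + 2 * lam (Suc j) * ((u j - F (u j)) \<bullet> (M - u j) + \<sigma>)"
    if j: "first a \<le> j" "Suc j \<le> last b" for j
  proof -
    \<comment> \<open>the claim as membership of \<open>M\<close> in a half-space\<close>
    define v where "v = 2 *\<^sub>R (u (Suc j) - u j) + (2 * lam (Suc j)) *\<^sub>R (u j - F (u j))"
    define c where "c = (norm (u (Suc j)))\<^sup>2 - (norm (u j))\<^sup>2 + 2 * lam (Suc j) * ((u j - F (u j)) \<bullet> u j - \<sigma>)"
    have eq: "(norm (u (Suc j) - y))\<^sup>2 \<le> (norm (u j - y))\<^sup>2 + 2 * lam (Suc j) * ((u j - F (u j)) \<bullet> (y - u j) + \<sigma>)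
        \<longleftrightarrow> v \<bullet> y \<ge> c" for y
      unfolding v_def c_def power2_norm_eq_inner
      by (simp add: inner_add_left inner_diff_left inner_diff_right inner_commute algebra_simps)
    have "?A \<subseteq> {y. v \<bullet> y \<ge> c}" using step_towards[of _ l a j b] ab j by (auto simp: eq[symmetric])
    then have "M \<in> {y. v \<bullet> y \<ge> c}" using hull[OF convex_halfspace_ge] M by blast
    then show ?thesis by (simp add: eq)
  qed
  define r' where "r' = r + \<sigma> / \<alpha>"
  have decay: "(norm (u j - M))\<^sup>2 \<le> r' + d\<^sup>2 * exp (- (2 * \<alpha>) * (\<Sum>l\<in>{first a<..j}. lam l))"
    if "first a \<le> j" "j \<le> last b" for j
    using that
  proof (induction j rule: dec_induct)
    case base
    have "(norm (u (first a) - M))\<^sup>2 \<le> d\<^sup>2" using diam[OF u_in MC] by (intro power_mono) auto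
    moreover have "r' \<ge> 0" using r \<alpha>0 sigma by (simp add: r'_def)
    ultimately show ?case by simp
  next
    case (step j)
    define x where "x = lam (Suc j)"
    define E where "E = d\<^sup>2 * exp (- (2 * \<alpha>) * (\<Sum>l\<in>{first a<..j}. lam l))"
    have "x \<le> 1 / K a" unfolding x_def using step by (intro lam_small) auto
    also have "\<dots> \<le> 1 / 8" using K_ge[of a] by (intro divide_left_mono) auto
    finally have x: "0 < x" "x \<le> 1 / 8" using lam_pos by (auto simp: x_def)
    have x\<alpha>: "0 \<le> 1 - 2 * \<alpha> * x" using x \<alpha> \<alpha>0 mult_mono[of \<alpha> 1 x "1 / 8"] by auto
    have "(norm (u (Suc j) - M))\<^sup>2 \<le> (norm (u j - M))\<^sup>2 + 2 * x * ((u j - F (u j)) \<bullet> (M - u j) + \<sigma>)"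
      unfolding x_def using step.hyps step.prems by (intro towards) auto
    also have "\<dots> \<le> (norm (u j - M))\<^sup>2 + 2 * x * (\<alpha> * (r - (norm (u j - M))\<^sup>2) + \<sigma>)"
      using x step by (intro add_left_mono mult_left_mono add_right_mono att) auto
    also have "\<dots> = (1 - 2 * \<alpha> * x) * (norm (u j - M))\<^sup>2 + 2 * \<alpha> * x * r'"
      using \<alpha>0 by (simp add: r'_def field_simps)
    also have "\<dots> \<le> (1 - 2 * \<alpha> * x) * (r' + E) + 2 * \<alpha> * x * r'"
      using step x\<alpha> by (intro add_right_mono mult_left_mono) (auto simp: E_def)
    also have "\<dots> = r' + (1 - 2 * \<alpha> * x) * E" by (simp add: algebra_simps)
    also have "\<dots> \<le> r' + exp (- (2 * \<alpha>) * x) * E"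
    proof (intro add_left_mono mult_right_mono)
      show "1 - 2 * \<alpha> * x \<le> exp (- (2 * \<alpha>) * x)" using exp_ge_add_one_self[of "- (2 * \<alpha>) * x"] by linarith
    qed (simp add: E_def)
    also have "exp (- (2 * \<alpha>) * x) * E = d\<^sup>2 * exp (- (2 * \<alpha>) * (\<Sum>l\<in>{first a<..Suc j}. lam l))"
    proof -
      have "{first a<..Suc j} = insert (Suc j) {first a<..j}" using step by auto
      then have "(\<Sum>l\<in>{first a<..Suc j}. lam l) = x + (\<Sum>l\<in>{first a<..j}. lam l)" by (simp add: x_def)
      then show ?thesis by (simp add: E_def exp_add[symmetric] algebra_simps)
    qed
    finally show ?case .
  qed
  have near_u: "norm (u j - M) \<le> R" if j: "first (Suc a) \<le> j" "j \<le> last b" for j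
  proof -
    let ?S = "\<Sum>l\<in>{first a<..j}. lam l"
    have "first a \<le> j" using j first_mono[of a "Suc a"] by simp
    then have "(norm (u j - M))\<^sup>2 \<le> r' + d\<^sup>2 * exp (- (2 * \<alpha>) * ?S)" using j by (intro decay)
    also have "\<dots> \<le> r' + d\<^sup>2 * exp (- (1 - \<tau>) * ?S)"
    proof -
      have "(1 - \<tau>) * ?S \<le> (2 * \<alpha>) * ?S"
        using \<alpha> \<alpha>0 lam_pos by (intro mult_right_mono sum_nonneg) (auto intro: less_imp_le)
      then have "- (2 * \<alpha>) * ?S \<le> - (1 - \<tau>) * ?S" by linarith
      then show ?thesis by (intro add_left_mono mult_left_mono) auto
    qed
    also have "\<dots> \<le> r' + d\<^sup>2 * (1 / (K a)\<^sup>2)" using j by (intro add_left_mono mult_left_mono relaxation) auto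
    also have "d\<^sup>2 * (1 / (K a)\<^sup>2) \<le> d\<^sup>2 * (1 / K a)"
      using K_ge[of a] by (intro mult_left_mono divide_left_mono) (auto simp: power2_eq_square)
    also have "\<dots> \<le> \<sigma> / (1 - \<tau>)"
    proof -
      have "d\<^sup>2 * (1 / K a) \<le> 8 * d\<^sup>2 / K a" using K_pos[of a] divide_right_mono[of "d\<^sup>2" "8 * d\<^sup>2" "K a"] by simp
      also have "\<dots> \<le> (1 - \<tau>) * \<sigma>" by (rule inverse_K)
      also have "\<dots> \<le> \<sigma>" using kappa sigma by (simp add: mult_le_cancel_right1)
      finally show ?thesis using s1 by linarith
    qed
    finally have "(norm (u j - M))\<^sup>2 \<le> R\<^sup>2" using s3 s2 sigma s1 unfolding r'_def by linarith
    then show ?thesis using R(2) power2_le_imp_le by blast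
  qed
  show ?thesis using near_z near_u MC by (auto simp: near_def)
qed

end

section \<open>Reducing the radius by stabilising a resolvent path\<close>

lemma small_increment_exists:
  fixes E :: "nat \<Rightarrow> real"
  assumes "Q > 0" "E Q - E 0 \<le> e"
  shows "\<exists>k<Q. E (Suc k) - E k \<le> e / real Q"
proof (rule ccontr)
  assume "\<not> ?thesis"
  then have "(\<Sum>k<Q. e / real Q) < (\<Sum>k<Q. E (Suc k) - E k)"
    using assms(1) by (intro sum_strict_mono) (auto simp: not_le)
  also have "\<dots> = E Q - E 0" by (rule sum_lessThan_telescope)
  finally show False using assms by simp
qed

context viscosity_stages
begin

text \<open>
  With \<open>v = F p\<close>, the squared distance of the path \<open>w i\<close> to \<open>v\<close> is nondecreasing up to \<open>2 \<sigma>\<close> and bounded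
  by \<open>d\<^sup>2\<close>. So over one of the \<open>Q\<close> blocks it grows by at most \<open>d\<^sup>2/Q\<close>, and the squared distance of the end
  points \<open>W\<close> and \<open>V\<close> of this block is at most \<open>d\<^sup>2/Q + 2 \<sigma>\<close>. Points \<open>y\<close> in between satisfy
  the variational inequality of \<open>W\<close>, and \<open>V\<close> is a better approximate fixed point than they are; as
  \<open>W\<close> and \<open>V\<close> are close, \<open>y\<close> is attracted by \<open>V\<close> up to \<open>\<parallel>F y - v\<parallel> \<le> \<tau> R\<close>. A block has four extra stages: two for
  \<open>variational_u\<close>, one for \<open>settle\<close>, and the one of \<open>V\<close>.
\<close>

lemma picard_step:
  assumes near: "near a b p R" and a: "1 \<le> a" and Q: "0 < Q" and b: "a + Q * (m + 4) \<le> b"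
    and \<eta>: "d\<^sup>2 / real Q + 2 * \<sigma> \<le> \<eta>\<^sup>2" "0 \<le> \<eta>"
    and R: "0 \<le> R" and R': "\<tau> * R\<^sup>2 + 5 * \<sigma> / (1 - \<tau>) + 4 * d * \<eta> \<le> R'\<^sup>2" "0 \<le> R'"
  shows "\<exists>a' p'. a \<le> a' \<and> a' + m \<le> b \<and> near a' (a' + m) p' R'"
proof -
  define s where "s = m + 4"
  define v where "v = F p"
  have pC: "p \<in> C" using near by (simp add: near_def)
  have vC: "v \<in> C" by (simp add: v_def F_in pC)
  have con: "contracts (\<lambda>_. v)" by (rule contracts_const[OF vC])
  define w where "w i = resolvent (\<lambda>_. v) (K i)" for i
  have wC: "w i \<in> C" for i unfolding w_def by (rule resolvent_in[OF con K_ge_1])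
  define E where "E k = (norm (w (a + k * s) - v))\<^sup>2" for k
  have "E Q \<le> d\<^sup>2" unfolding E_def using diam[OF wC vC] by (intro power_mono) auto
  then have "E Q - E 0 \<le> d\<^sup>2" unfolding E_def using zero_le_power2[of "norm (w (a + 0 * s) - v)"] by linarith
  then obtain k where k: "k < Q" "E (Suc k) - E k \<le> d\<^sup>2 / real Q"
    using small_increment_exists[of Q E, OF Q] by blast
  define c where "c = a + k * s"
  have E': "E k = (norm (w c - v))\<^sup>2" "E (Suc k) = (norm (w (c + s) - v))\<^sup>2"
    by (simp_all add: E_def c_def add_ac)
  have "Suc k * s \<le> Q * s" using k by (intro mult_right_mono) auto
  then have cb: "a \<le> c" "c + s \<le> b" using b by (auto simp: c_def s_def)
  define W V where "W = w c" and "V = w (c + s)"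
  have WC: "W \<in> C" "V \<in> C" by (simp_all add: W_def V_def wC)
  have viV: "(W - v) \<bullet> (V - W) \<ge> - \<sigma>"
    unfolding W_def w_def V_def using resolvent_level[OF con order_refl] wC[of "c + s"]
    by (intro variational_fixed[OF con, of c "c + s"]) (auto simp: w_def s_def)
  have close: "norm (W - V) \<le> \<eta>"
  proof -
    have "(norm (V - v))\<^sup>2 = (norm (W - v))\<^sup>2 + 2 * ((W - v) \<bullet> (V - W)) + (norm (W - V))\<^sup>2"
      unfolding power2_norm_eq_inner by (simp add: inner_diff_left inner_diff_right inner_commute)
    then have "(norm (W - V))\<^sup>2 \<le> \<eta>\<^sup>2" using viV k(2) \<eta>(1) unfolding E' W_def[symmetric] V_def[symmetric] by linarith
    then show ?thesis using \<eta>(2) power2_le_imp_le by blast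
  qed
  define r where "r = \<tau> * R\<^sup>2 + 2 * \<sigma> + 4 * d * \<eta>"
  \<comment> \<open>\<open>V\<close> attracts at the rate \<open>1 - \<tau>/2\<close>, since \<open>\<tau> R \<parallel>y - V\<parallel> \<le> \<tau>/2 (R\<^sup>2 + \<parallel>y - V\<parallel>\<^sup>2)\<close>\<close>
  have att: "(y - F y) \<bullet> (V - y) \<le> (1 - \<tau> / 2) * (r - (norm (y - V))\<^sup>2)"
    if y: "y \<in> C" "norm (y - p) \<le> R" and vi: "(W - v) \<bullet> (y - W) \<ge> - \<sigma>" for y
  proof -
    have eq: "(y - F y) \<bullet> (V - y) = (v - W) \<bullet> (y - W) + (W - V) \<bullet> (y - V) + (v - W) \<bullet> (W - V)
        + (F y - v) \<bullet> (y - V) - (y - V) \<bullet> (y - V)"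
      by (simp add: inner_diff_left inner_diff_right inner_commute)
    have "(v - W) \<bullet> (y - W) \<le> \<sigma>"
      using vi by (simp add: inner_diff_left)
    moreover have "(W - V) \<bullet> (y - V) \<le> \<eta> * d"
      using norm_cauchy_schwarz[of "W - V" "y - V"] mult_mono[OF close diam[OF y(1) WC(2)] \<eta>(2) norm_ge_zero] by linarith
    moreover have "(v - W) \<bullet> (W - V) \<le> d * \<eta>"
      using norm_cauchy_schwarz[of "v - W" "W - V"] mult_mono[OF diam[OF vC WC(1)] close] d_ge by fastforce
    moreover have "(F y - v) \<bullet> (y - V) \<le> \<tau> / 2 * (R\<^sup>2 + (norm (y - V))\<^sup>2)"
    proof -
      have "norm (F y - v) \<le> \<tau> * norm (y - p)" unfolding v_def by (rule F_contr[OF y(1) pC])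
      also have "\<dots> \<le> \<tau> * R" using y tau by (intro mult_left_mono) auto
      finally have "norm (F y - v) * norm (y - V) \<le> \<tau> * R * norm (y - V)" by (intro mult_right_mono) auto
      then have "(F y - v) \<bullet> (y - V) \<le> \<tau> / 2 * (2 * R * norm (y - V))"
        using norm_cauchy_schwarz[of "F y - v" "y - V"] by simp
      also have "\<dots> \<le> \<tau> / 2 * (R\<^sup>2 + (norm (y - V))\<^sup>2)"
        using sum_squares_bound[of R "norm (y - V)"] tau by (intro mult_left_mono) auto
      finally show ?thesis .
    qed
    ultimately have "(y - F y) \<bullet> (V - y) \<le> \<sigma> + 2 * d * \<eta> + \<tau> / 2 * R\<^sup>2 - (1 - \<tau> / 2) * (norm (y - V))\<^sup>2"
      unfolding eq by (simp add: power2_norm_eq_inner[symmetric] algebra_simps)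
    also have "\<dots> \<le> (1 - \<tau> / 2) * r - (1 - \<tau> / 2) * (norm (y - V))\<^sup>2"
    proof -
      have "0 \<le> r" using tau sigma d_ge \<eta>(2) by (simp add: r_def)
      then have "(1 / 2) * r \<le> (1 - \<tau> / 2) * r" using tau by (intro mult_right_mono) auto
      then show ?thesis by (simp add: r_def)
    qed
    finally show ?thesis by (simp add: right_diff_distrib)
  qed
  have "near (Suc (c + 2)) (c + s - 1) V R'"
  proof (rule settle)
    show "V \<in> convex hull {y \<in> C. norm (y - T y) \<le> d / K (c + s)}"
      unfolding V_def w_def using resolvent_level[OF con order_refl] wC by (intro hull_inc) (auto simp: w_def)
    show "1 \<le> c + 2" "c + s - 1 < c + s" using s_def by auto
    show "1 - \<tau> \<le> 1 - \<tau> / 2" "1 - \<tau> / 2 \<le> 1" using tau by auto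
    show "0 \<le> r" using tau sigma d_ge \<eta>(2) by (simp add: r_def)
    have "2 * \<sigma> \<le> 2 * (\<sigma> / (1 - \<tau>))"
      using kappa sigma by (simp add: pos_le_divide_eq mult_le_cancel_left1)
    then show "r + 3 * \<sigma> / (1 - \<tau>) \<le> R'\<^sup>2" using R'(1) by (simp add: r_def add_divide_distrib)
    show "0 \<le> R'" by (rule R')
  next
    fix y assume "y \<in> z ` {c + 2..c + s - 1} \<union> u ` {first (c + 2)..last (c + s - 1)}"
    then consider i where "y = z i" "c + 2 \<le> i" "i \<le> c + s - 1"
      | j where "y = u j" "first (c + 2) \<le> j" "j \<le> last (c + s - 1)" by auto
    then show "(y - F y) \<bullet> (V - y) \<le> (1 - \<tau> / 2) * (r - (norm (y - V))\<^sup>2)"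
    proof cases
      case 1
      show ?thesis
      proof (rule att)
        show "y \<in> C" unfolding 1 by (rule z_in)
        show "norm (y - p) \<le> R" using near 1 cb by (auto simp: near_def)
        show "(W - v) \<bullet> (y - W) \<ge> - \<sigma>" unfolding W_def w_def
          using 1 resolvent_level[OF contracts_F, of i i] z_in by (intro variational_fixed[OF con, of c i]) (auto simp: z_def)
      qed
    next
      case 2
      show ?thesis
      proof (rule att)
        show "y \<in> C" unfolding 2 by (rule u_in)
        have "c + s - 1 \<le> b" using cb by linarith
        then have "first a \<le> j" "j \<le> last b"
          using 2 first_mono[of a "c + 2"] last_mono[of "c + s - 1" b] cb by simp_all
        then show "norm (y - p) \<le> R" using near 2 by (auto simp: near_def)
        show "(W - v) \<bullet> (y - W) \<ge> - \<sigma>" unfolding W_def w_def 2(1)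
          using 2 by (intro variational_u[OF con]) auto
      qed
    qed
  qed
  moreover have "c + s - 1 = Suc (c + 2) + m" by (simp add: s_def)
  ultimately have "near (Suc (c + 2)) (Suc (c + 2) + m) V R'" by simp
  moreover have "a \<le> Suc (c + 2)" "Suc (c + 2) + m \<le> b" using cb by (auto simp: s_def)
  ultimately show ?thesis by blast
qed

end

section \<open>Reducing the radius by a cut\<close>

lemma norm_weighted_mean_square_le:
  fixes x :: "nat \<Rightarrow> 'b::real_inner"
  assumes "\<And>j. j \<in> I \<Longrightarrow> \<mu> j \<ge> 0" "sum \<mu> I = 1"
  shows "(norm (y - (\<Sum>j\<in>I. \<mu> j *\<^sub>R x j)))\<^sup>2 \<le> (\<Sum>j\<in>I. \<mu> j * (norm (y - x j))\<^sup>2)"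
proof -
  define M where "M = (\<Sum>j\<in>I. \<mu> j *\<^sub>R x j)"
  have "0 \<le> (\<Sum>j\<in>I. \<mu> j * (norm (M - x j))\<^sup>2)" using assms(1) by (intro sum_nonneg) auto
  also have "\<dots> = (\<Sum>j\<in>I. \<mu> j * (norm (y - x j))\<^sup>2 - \<mu> j * (norm (y - M))\<^sup>2
      + \<mu> j * (2 * ((y - M) \<bullet> x j)) - \<mu> j * (2 * ((y - M) \<bullet> M)))"
    unfolding power2_norm_eq_inner
    by (intro sum.cong refl) (simp add: inner_diff_left inner_diff_right inner_commute algebra_simps)
  also have "\<dots> = (\<Sum>j\<in>I. \<mu> j * (norm (y - x j))\<^sup>2) - (norm (y - M))\<^sup>2 + 2 * ((y - M) \<bullet> M) - 2 * ((y - M) \<bullet> M)"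
  proof -
    have "(\<Sum>j\<in>I. \<mu> j * (2 * ((y - M) \<bullet> x j))) = 2 * ((y - M) \<bullet> M)"
      by (subst (2) M_def) (simp add: inner_sum_right sum_distrib_left mult_ac)
    then show ?thesis
      using assms(2) by (simp add: sum.distrib sum_subtractf sum_distrib_right[symmetric])
  qed
  finally show ?thesis by (simp add: M_def)
qed

context viscosity_stages
begin

text \<open>
  If \<open>p - F p\<close> were replaced by \<open>z i - F (z i)\<close>, this would be the variational inequality of \<open>z i\<close>. The
  replacement costs \<open>2 R\<^sup>2\<close> for the values of \<open>F\<close> and only \<open>R\<^sup>2/4\<close> for the points, because
  \<open>\<langle>e, f - e\<rangle> \<le> \<parallel>e\<parallel> R - \<parallel>e\<parallel>\<^sup>2\<close>.
\<close>

lemma nearly_monotone: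
  assumes p: "p \<in> C" and x: "norm (z i - p) \<le> R" "norm (z k - p) \<le> R" and ik: "i < k"
  shows "(p - F p) \<bullet> (z k - p) - (p - F p) \<bullet> (z i - p) \<ge> - (9 / 4 * R\<^sup>2 + \<sigma>)"
proof -
  define e f where "e = z i - p" and "f = z k - p"
  have R: "R \<ge> 0" using x(1) norm_ge_zero order_trans by blast
  have "(z i - F (z i)) \<bullet> (z k - z i) \<ge> - \<sigma>"
    unfolding z_def using resolvent_level[OF contracts_F order_refl, of k] z_in[of k] ik
    by (intro variational_fixed[OF contracts_F, of i k]) (auto simp: z_def)
  moreover have "(p - F p) \<bullet> (z k - p) - (p - F p) \<bullet> (z i - p)
     = (z i - F (z i)) \<bullet> (z k - z i) + (norm e)\<^sup>2 - e \<bullet> f + (F (z i) - F p) \<bullet> (f - e)"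
    unfolding e_def f_def power2_norm_eq_inner
    by (simp add: inner_diff_left inner_diff_right inner_commute)
  moreover have "(norm e)\<^sup>2 - e \<bullet> f \<ge> - (R\<^sup>2 / 4)"
  proof -
    have "e \<bullet> f \<le> norm e * norm f" by (rule norm_cauchy_schwarz)
    also have "\<dots> \<le> norm e * R" using x by (intro mult_left_mono) (auto simp: f_def)
    finally have "(norm e)\<^sup>2 - e \<bullet> f \<ge> (norm e - R / 2)\<^sup>2 - R\<^sup>2 / 4" by (simp add: power2_eq_square algebra_simps)
    then show ?thesis using zero_le_power2[of "norm e - R / 2"] by linarith
  qed
  moreover have "(F (z i) - F p) \<bullet> (f - e) \<ge> - (2 * R\<^sup>2)"
  proof -
    have "norm (F (z i) - F p) \<le> \<tau> * norm (z i - p)" by (rule F_contr[OF z_in p])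
    also have "\<dots> \<le> 1 * R" using x tau by (intro mult_mono) auto
    finally have "norm (F (z i) - F p) \<le> R" by simp
    moreover have "norm (f - e) \<le> R + R" using norm_triangle_ineq4[of f e] x by (simp add: e_def f_def)
    ultimately have "norm (F (z i) - F p) * norm (f - e) \<le> R * (R + R)" using R by (intro mult_mono) auto
    then show ?thesis using Cauchy_Schwarz_ineq2[of "F (z i) - F p" "f - e"] by (simp add: power2_eq_square)
  qed
  ultimately show ?thesis by linarith
qed

text \<open>
  The function \<open>L i = \<langle>p - F p, z i - p\<rangle>\<close> is nearly increasing, so among \<open>P\<close> blocks there is one on
  which its oscillation is of order \<open>R\<^sup>2\<close>, as \<open>balanced_cut\<close> requires. That lemma yields a cut \<open>i\<close> among the \<open>4 n\<close>
  sampled resolvents of this block, with a mean \<open>M\<close> of the earlier and a mean \<open>N\<close> of the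
  later ones. For points \<open>y\<close> near the cut, averaging the variational inequalities of the earlier
  resolvents and using strong monotonicity gives
  \<open>\<langle>B y, M - y\<rangle> \<le> \<sigma> - (1 - \<tau>) \<parallel>y - M\<parallel>\<^sup>2\<close>; replacing \<open>M\<close> by \<open>N\<close> costs at most about
  \<open>(1 - \<tau>) R\<^sup>2 (33/160 + 1/60)\<close>, which is below \<open>(1 - \<tau>) R\<^sup>2/4\<close>. So \<open>N\<close> attracts as \<open>settle\<close> demands.
\<close>

lemma kernel_step:
  assumes near: "near a b p R" and a: "1 \<le> a" and n: "1 \<le> n" and R: "0 < R"
    and W: "160 / (1 - \<tau>) \<le> ln (real n + 1)" and \<tau>: "1 - \<tau> \<le> 1 / 16"
    and P: "8 * d / R \<le> real P" and b: "a + P * (4 * n) * (m + 4) \<le> b"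
    and \<sigma>: "\<sigma> \<le> (1 - \<tau>) * R\<^sup>2 / 160"
  shows "\<exists>a' p'. a \<le> a' \<and> a' + m \<le> b \<and> near a' (a' + m) p' (R / 2)"
proof -
  define s where "s = m + 4"
  have pC: "p \<in> C" using near by (simp add: near_def)
  have P0: "P > 0" using P R d_ge by (cases P) (auto simp: field_simps)
  define \<beta> where "\<beta> = p - F p"
  define L where "L i = \<beta> \<bullet> (z i - p)" for i
  define B where "B k = a + k * (4 * n * s)" for k
  have zR: "norm (z i - p) \<le> R" if "a \<le> i" "i \<le> b" for i using near that by (auto simp: near_def)
  have BP: "B P \<le> b" using b by (simp add: B_def s_def mult_ac)
  have "L (B P) - L (B 0) = \<beta> \<bullet> (z (B P) - z (B 0))" by (simp add: L_def inner_diff_right)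
  also have "\<dots> \<le> norm \<beta> * norm (z (B P) - z (B 0))" by (rule norm_cauchy_schwarz)
  also have "\<dots> \<le> d * (2 * R)"
  proof (intro mult_mono)
    show "norm \<beta> \<le> d" unfolding \<beta>_def by (rule diam[OF pC F_in[OF pC]])
    have "norm (z (B P) - p) \<le> R" "norm (z (B 0) - p) \<le> R" using BP by (auto intro!: zR simp: B_def)
    then show "norm (z (B P) - z (B 0)) \<le> 2 * R"
      using norm_triangle_ineq4[of "z (B P) - p" "z (B 0) - p"] by simp
  qed (use d_ge in auto)
  finally obtain k where k: "k < P" "L (B (Suc k)) - L (B k) \<le> d * (2 * R) / real P"
    using small_increment_exists[of P "\<lambda>k. L (B k)", OF P0] by blast
  have "d * (2 * R) / real P \<le> R\<^sup>2 / 4"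
  proof -
    have "8 * d \<le> R * real P" using P R by (simp add: pos_divide_le_eq mult.commute)
    then have "R * (8 * d) \<le> R * (R * real P)" using R by (intro mult_left_mono) auto
    then show ?thesis using P0 by (simp add: pos_divide_le_eq power2_eq_square mult_ac)
  qed
  with k have k2: "L (B (Suc k)) - L (B k) \<le> R\<^sup>2 / 4" by linarith
  define c where "c = B k"
  have cs: "B (Suc k) = c + 4 * n * s" by (simp add: B_def c_def)
  have "B (Suc k) \<le> B P" using k unfolding B_def by (intro add_left_mono mult_right_mono) auto
  then have cb: "a \<le> c" "c + 4 * n * s \<le> b" using BP cs by (auto simp: c_def B_def)
  define x where "x j = z (c + j * s)" for j
  have js: "c + j * s + s \<le> c + 4 * n * s" if "j < 4 * n" for j
  proof -
    have "Suc j * s \<le> 4 * n * s" using that by (intro mult_right_mono) auto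
    then show ?thesis by simp
  qed
  have xR: "norm (x j - p) \<le> R" if "j < 4 * n" for j
    unfolding x_def using js[OF that] cb by (intro zR) auto
  have \<sigma>R: "\<sigma> \<le> R\<^sup>2 / 160"
  proof -
    have "(1 - \<tau>) * R\<^sup>2 \<le> 1 * R\<^sup>2" using kappa by (intro mult_right_mono) auto
    then show ?thesis using \<sigma> by simp
  qed
  have range: "\<bar>\<beta> \<bullet> (x j - p) - (L c + R\<^sup>2 / 8)\<bar> \<le> 5 / 2 * R\<^sup>2" if j: "j < 4 * n" for j
  proof -
    have s: "s > 0" by (simp add: s_def)
    have lo: "L (c + j * s) - L c \<ge> - (9 / 4 * R\<^sup>2 + \<sigma>)"
    proof (cases "j = 0")
      case True
      have "0 \<le> 9 / 4 * R\<^sup>2 + \<sigma>" using sigma by simp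
      with True show ?thesis by simp
    next
      case False
      then show ?thesis unfolding L_def \<beta>_def
        using js[OF j] cb s by (intro nearly_monotone pC zR) auto
    qed
    have hi: "L (c + 4 * n * s) - L (c + j * s) \<ge> - (9 / 4 * R\<^sup>2 + \<sigma>)"
      unfolding L_def \<beta>_def using j js[OF j] cb s by (intro nearly_monotone pC zR) auto
    have "\<beta> \<bullet> (x j - p) = L (c + j * s)" by (simp add: L_def x_def)
    moreover have "L (c + 4 * n * s) - L c \<le> R\<^sup>2 / 4" using k2 cs by (simp add: c_def)
    ultimately show ?thesis using lo hi \<sigma>R by (intro abs_leI) (linarith+)
  qed
  obtain i \<mu> \<nu> where i: "n \<le> i" "i < 3 * n"
    and \<mu>: "\<And>j. j < i \<Longrightarrow> \<mu> j \<ge> 0" "sum \<mu> {..<i} = 1"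
    and \<nu>: "\<And>j. i < j \<Longrightarrow> \<nu> j \<ge> 0" "sum \<nu> {i<..<4 * n} = 1"
    and MM: "norm ((\<Sum>j\<in>{i<..<4 * n}. \<nu> j *\<^sub>R x j) - (\<Sum>j<i. \<mu> j *\<^sub>R x j)) \<le> 10 * R / ln (real n + 1)"
    and bMM: "\<beta> \<bullet> ((\<Sum>j\<in>{i<..<4 * n}. \<nu> j *\<^sub>R x j) - (\<Sum>j<i. \<mu> j *\<^sub>R x j))
          + 2 * R * norm ((\<Sum>j\<in>{i<..<4 * n}. \<nu> j *\<^sub>R x j) - (\<Sum>j<i. \<mu> j *\<^sub>R x j)) \<le> 33 * R\<^sup>2 / ln (real n + 1)"
    using balanced_cut[OF n R, of x p \<beta> "L c + R\<^sup>2 / 8"] xR range by blast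
  define M N where "M = (\<Sum>j<i. \<mu> j *\<^sub>R x j)" and "N = (\<Sum>j\<in>{i<..<4 * n}. \<nu> j *\<^sub>R x j)"
  have MN: "norm (N - M) \<le> 10 * R / ln (real n + 1)"
    and bMN: "\<beta> \<bullet> (N - M) + 2 * R * norm (N - M) \<le> 33 * R\<^sup>2 / ln (real n + 1)"
    using MM bMM by (simp_all add: M_def N_def)
  have W0: "160 / (1 - \<tau>) > 0" using kappa by simp
  have invW: "X / ln (real n + 1) \<le> (1 - \<tau>) * X / 160" if "X \<ge> 0" for X
  proof -
    have "X / ln (real n + 1) \<le> X / (160 / (1 - \<tau>))"
      using W W0 that n by (intro divide_left_mono mult_pos_pos) auto
    then show ?thesis by (simp add: mult.commute)
  qed
  have \<beta>MN: "\<beta> \<bullet> (N - M) + 2 * R * norm (N - M) \<le> (1 - \<tau>) * (33 / 160 * R\<^sup>2)"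
    using bMN invW[of "33 * R\<^sup>2"] by simp
  have nMN: "norm (N - M) \<le> (1 - \<tau>) * (R / 16)"
  proof -
    have "10 * R / ln (real n + 1) \<le> (1 - \<tau>) * (10 * R) / 160" using R by (intro invW) simp
    also have "\<dots> = (1 - \<tau>) * (R / 16)" by simp
    finally show ?thesis using MN by linarith
  qed
  have MR: "norm (M - p) \<le> R"
  proof -
    have "M - p = (\<Sum>j<i. \<mu> j *\<^sub>R (x j - p))"
      by (simp add: M_def scaleR_diff_right sum_subtractf scaleR_sum_left[symmetric] \<mu>(2))
    then show ?thesis using i \<mu> xR norm_weighted_sum_le[of "{..<i}" \<mu> "\<lambda>j. x j - p" R] by auto
  qed
  define t where "t = c + i * s"
  have t: "a \<le> t" "t + s \<le> b" using js[of i] i cb by (auto simp: t_def)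
  define r where "r = (33 / 160 + 1 / 60) * R\<^sup>2 + \<sigma> / (1 - \<tau>)"
  have att: "(y - F y) \<bullet> (N - y) \<le> (1 - \<tau>) * (r - (norm (y - N))\<^sup>2)"
    if y: "y \<in> C" "norm (y - p) \<le> R" and vi: "\<And>j. j < i \<Longrightarrow> (x j - F (x j)) \<bullet> (y - x j) \<ge> - \<sigma>" for y
  proof -
    have "(y - F y) \<bullet> (M - y) = (\<Sum>j<i. \<mu> j * ((y - F y) \<bullet> (x j - y)))"
    proof -
      have "M - y = (\<Sum>j<i. \<mu> j *\<^sub>R (x j - y))"
        by (simp add: M_def scaleR_diff_right sum_subtractf scaleR_sum_left[symmetric] \<mu>(2))
      then show ?thesis by (simp add: inner_sum_right)
    qed
    also have "\<dots> \<le> (\<Sum>j<i. \<mu> j * (\<sigma> - (1 - \<tau>) * (norm (y - x j))\<^sup>2))"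
    proof (intro sum_mono mult_left_mono)
      fix j assume "j \<in> {..<i}"
      then have j: "j < i" by simp
      have "((y - F y) - (x j - F (x j))) \<bullet> (y - x j) \<ge> (1 - \<tau>) * (norm (y - x j))\<^sup>2"
        by (rule strongly_monotone[OF y(1)]) (simp add: x_def z_in)
      then show "(y - F y) \<bullet> (x j - y) \<le> \<sigma> - (1 - \<tau>) * (norm (y - x j))\<^sup>2"
        using vi[OF j] by (simp add: inner_diff_left inner_diff_right)
      show "0 \<le> \<mu> j" by (rule \<mu>(1)[OF j])
    qed
    also have "\<dots> = \<sigma> - (1 - \<tau>) * (\<Sum>j<i. \<mu> j * (norm (y - x j))\<^sup>2)"
    proof -
      have "(\<Sum>j<i. \<mu> j * (\<sigma> - (1 - \<tau>) * (norm (y - x j))\<^sup>2))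
         = (\<Sum>j<i. \<mu> j) * \<sigma> - (1 - \<tau>) * (\<Sum>j<i. \<mu> j * (norm (y - x j))\<^sup>2)"
        unfolding sum_distrib_left sum_distrib_right sum_subtractf[symmetric]
        by (intro sum.cong refl) (simp add: algebra_simps)
      then show ?thesis by (simp add: \<mu>(2))
    qed
    also have "\<dots> \<le> \<sigma> - (1 - \<tau>) * (norm (y - M))\<^sup>2"
      using norm_weighted_mean_square_le[of "{..<i}" \<mu> y x] \<mu> kappa
      by (intro diff_left_mono mult_left_mono) (auto simp: M_def)
    finally have yM: "(y - F y) \<bullet> (M - y) \<le> \<sigma> - (1 - \<tau>) * (norm (y - M))\<^sup>2" .
    have "(y - F y) \<bullet> (N - M) = \<beta> \<bullet> (N - M) + ((y - p) - (F y - F p)) \<bullet> (N - M)"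
      by (simp add: \<beta>_def inner_diff_left)
    also have "((y - p) - (F y - F p)) \<bullet> (N - M) \<le> 2 * R * norm (N - M)"
    proof -
      have "norm (F y - F p) \<le> \<tau> * norm (y - p)" by (rule F_contr[OF y(1) pC])
      also have "\<dots> \<le> 1 * R" using y tau by (intro mult_mono) auto
      finally have "norm ((y - p) - (F y - F p)) \<le> 2 * R"
        using norm_triangle_ineq4[of "y - p" "F y - F p"] y(2) by simp
      then show ?thesis
        using norm_cauchy_schwarz[of "(y - p) - (F y - F p)" "N - M"]
          mult_right_mono[of "norm ((y - p) - (F y - F p))" "2 * R" "norm (N - M)"] by simp
    qed
    finally have yNM: "(y - F y) \<bullet> (N - M) \<le> (1 - \<tau>) * (33 / 160 * R\<^sup>2)" using \<beta>MN by linarith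
    have sq: "(norm (y - N))\<^sup>2 \<le> (norm (y - M))\<^sup>2 + R\<^sup>2 / 60"
    proof -
      have yM2: "norm (y - M) \<le> 2 * R"
        using norm_triangle_ineq4[of "y - p" "M - p"] y(2) MR by simp
      have "(1 - \<tau>) * (R / 16) \<le> 1 / 16 * (R / 16)" using \<tau> R by (intro mult_right_mono) auto
      then have nMN': "norm (N - M) \<le> R / 256" using nMN by linarith
      have "norm (y - N) \<le> norm (y - M) + R / 256"
        using norm_triangle_ineq4[of "y - M" "N - M"] nMN' by simp
      then have "(norm (y - N))\<^sup>2 \<le> (norm (y - M) + R / 256)\<^sup>2" by (intro power_mono) auto
      also have "\<dots> = (norm (y - M))\<^sup>2 + norm (y - M) * (R / 128) + R\<^sup>2 / 65536"
        by (simp add: power2_eq_square algebra_simps)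
      also have "norm (y - M) * (R / 128) \<le> 2 * R * (R / 128)" using yM2 R by (intro mult_right_mono) auto
      also have "2 * R * (R / 128) = R\<^sup>2 / 64" by (simp add: power2_eq_square)
      finally show ?thesis using zero_le_power2[of R] by linarith
    qed
    have "(y - F y) \<bullet> (N - y) = (y - F y) \<bullet> (M - y) + (y - F y) \<bullet> (N - M)" by (simp add: inner_diff_right)
    also have "\<dots> \<le> \<sigma> - (1 - \<tau>) * (norm (y - M))\<^sup>2 + (1 - \<tau>) * (33 / 160 * R\<^sup>2)" using yM yNM by linarith
    also have "\<dots> = (1 - \<tau>) * (33 / 160 * R\<^sup>2 + \<sigma> / (1 - \<tau>) - (norm (y - M))\<^sup>2)"
      using kappa by (simp add: right_diff_distrib distrib_left)
    also have "\<dots> \<le> (1 - \<tau>) * (r - (norm (y - N))\<^sup>2)"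
      using sq kappa by (intro mult_left_mono) (auto simp: r_def)
    finally show ?thesis .
  qed
  have "near (Suc t) (t + s - 1) N (R / 2)"
  proof (rule settle)
    let ?A = "{y \<in> C. norm (y - T y) \<le> d / K (t + s)}"
    have xA: "x j \<in> ?A" if "i < j" for j
    proof -
      have "Suc i * s \<le> j * s" using that by (intro mult_right_mono) auto
      then have "norm (z (c + j * s) - T (z (c + j * s))) \<le> d / K (t + s)"
        unfolding z_def by (intro resolvent_level contracts_F) (simp add: t_def)
      then show ?thesis by (simp add: x_def z_in)
    qed
    show "N \<in> convex hull ?A"
      unfolding N_def
    proof (rule convex_sum)
      show "x j \<in> convex hull ?A" if "j \<in> {i<..<4 * n}" for j
        using that xA[of j] by (intro hull_inc) auto
    qed (use \<nu> in auto)
    show "1 \<le> t" "t + s - 1 < t + s" using a t s_def by auto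
    show "1 - \<tau> \<le> 1 - \<tau>" "1 - \<tau> \<le> 1" using kappa by auto
    show "0 \<le> r" using kappa sigma by (simp add: r_def)
    have "4 * (\<sigma> / (1 - \<tau>)) \<le> 4 * (R\<^sup>2 / 160)"
      using \<sigma> kappa by (simp add: pos_divide_le_eq mult.commute)
    moreover have "3 * \<sigma> / (1 - \<tau>) = 3 * (\<sigma> / (1 - \<tau>))" "(R / 2)\<^sup>2 = R\<^sup>2 / 4"
      by (simp_all add: power2_eq_square)
    moreover have "X * c + x + y \<le> q" if "4 * x \<le> 4 * (c / 160)" "y = 3 * x" "q = c / 4" "0 \<le> c" "X = 33 / 160 + 1 / 60"
      for X x y q c :: real
      unfolding that(2,3,5) using that(1,4) by (simp add: field_simps)
    ultimately show "r + 3 * \<sigma> / (1 - \<tau>) \<le> (R / 2)\<^sup>2"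
      unfolding r_def using zero_le_power2[of R] by blast
    show "0 \<le> R / 2" using R by simp
  next
    fix y assume "y \<in> z ` {t..t + s - 1} \<union> u ` {first t..last (t + s - 1)}"
    then consider k where "y = z k" "t \<le> k" "k \<le> t + s - 1"
      | j where "y = u j" "first t \<le> j" "j \<le> last (t + s - 1)" by auto
    then show "(y - F y) \<bullet> (N - y) \<le> (1 - \<tau>) * (r - (norm (y - N))\<^sup>2)"
    proof cases
      case (1 k)
      show ?thesis
      proof (rule att)
        show "y \<in> C" unfolding 1 by (rule z_in)
        show "norm (y - p) \<le> R" unfolding 1 using 1 t by (intro zR) auto
        fix j assume "j < i"
        then have "Suc j * s \<le> i * s" by (intro mult_right_mono) auto
        then have "c + j * s < k" using 1 by (simp add: t_def s_def)
        then show "(x j - F (x j)) \<bullet> (y - x j) \<ge> - \<sigma>" unfolding x_def 1(1)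
          unfolding z_def[of "c + j * s"]
          using resolvent_level[OF contracts_F order_refl, of k] z_in[of k]
          by (intro variational_fixed[OF contracts_F, of _ k]) (auto simp: z_def)
      qed
    next
      case (2 l)
      show ?thesis
      proof (rule att)
        show "y \<in> C" unfolding 2 by (rule u_in)
        have "t + s - 1 \<le> b" using t by linarith
        then have "first a \<le> l" "l \<le> last b"
          using 2 first_mono[of a t] last_mono[of "t + s - 1" b] t by simp_all
        then show "norm (y - p) \<le> R" using near 2 by (auto simp: near_def)
        fix j assume "j < i"
        then have "Suc j * s \<le> i * s" by (intro mult_right_mono) auto
        then have "c + j * s + 2 \<le> t" by (simp add: t_def s_def)
        then show "(x j - F (x j)) \<bullet> (y - x j) \<ge> - \<sigma>" unfolding x_def 2(1) z_def
          using 2 by (intro variational_u[OF contracts_F]) auto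
      qed
    qed
  qed
  then have "near (Suc t) (Suc t + m) N (R / 2)" by (rule near_shrink) (auto simp: s_def)
  moreover have "a \<le> Suc t" "Suc t + m \<le> b" using t by (auto simp: s_def)
  ultimately show ?thesis by blast
qed

end

section \<open>Repeated reduction\<close>

context viscosity_stages
begin

text \<open>
  The number \<open>4 (A + 1)\<^sup>k - 4\<close> is a sufficient length for \<open>k\<close> nested reductions: it vanishes for
  \<open>k = 0\<close>, and for \<open>k + 1\<close> it covers \<open>A\<close> blocks that each exceed the length for \<open>k\<close> by four.
\<close>

lemma block_length: "(4 * (A + 1) ^ k - 4) + 4 = 4 * (A + 1) ^ (k::nat)" for A :: nat
proof -
  have "1 \<le> (A + 1) ^ k" by simp
  then show ?thesis by linarith
qed

lemma block_length_Suc: "A * ((4 * (A + 1) ^ k - 4) + 4) \<le> 4 * (A + 1) ^ Suc k - 4" for A :: nat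
proof -
  have "1 \<le> (A + 1) ^ k" by simp
  then have "A * (4 * (A + 1) ^ k) + 4 \<le> A * (4 * (A + 1) ^ k) + 4 * (A + 1) ^ k" by linarith
  also have "\<dots> = 4 * (A + 1) ^ Suc k" by (simp add: algebra_simps)
  finally show ?thesis unfolding block_length by linarith
qed

lemma picard_iterate:
  assumes Q: "0 < Q" and \<eta>: "d\<^sup>2 / real Q + 2 * \<sigma> \<le> \<eta>\<^sup>2" "0 \<le> \<eta>"
    and e: "e = 5 * \<sigma> / (1 - \<tau>) + 4 * d * \<eta>"
  shows "near a b p R \<Longrightarrow> 1 \<le> a \<Longrightarrow> 0 \<le> R \<Longrightarrow> a + (4 * (Q + 1) ^ k - 4) \<le> b \<Longrightarrow>
    \<exists>a' p' R'. a \<le> a' \<and> a' \<le> b \<and> near a' a' p' R' \<and> 0 \<le> R' \<and> R'\<^sup>2 \<le> \<tau> ^ k * R\<^sup>2 + e * (1 - \<tau> ^ k) / (1 - \<tau>)"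
proof (induction k arbitrary: a b p R)
  case 0
  then have "near a a p R" by (auto intro: near_shrink)
  with 0 show ?case by (intro exI[of _ a] exI[of _ p] exI[of _ R]) auto
next
  case (Suc k)
  define m where "m = 4 * (Q + 1) ^ k - 4"
  define R1 where "R1 = sqrt (\<tau> * R\<^sup>2 + e)"
  have e0: "e \<ge> 0" unfolding e using kappa sigma d_ge \<eta>(2) by simp
  have R1: "R1\<^sup>2 = \<tau> * R\<^sup>2 + e" "R1 \<ge> 0" unfolding R1_def using tau e0 by auto
  have "Q * (m + 4) \<le> 4 * (Q + 1) ^ Suc k - 4" unfolding m_def by (rule block_length_Suc)
  then have "a + Q * (m + 4) \<le> b" using Suc.prems(4) by linarith
  then obtain a1 p1 where 1: "a \<le> a1" "a1 + m \<le> b" "near a1 (a1 + m) p1 R1"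
    using picard_step[OF Suc.prems(1,2) Q _ \<eta> Suc.prems(3), of m R1] R1 e by auto
  have "1 \<le> a1" using 1 Suc.prems by simp
  from Suc.IH[OF 1(3) this R1(2)] obtain a' p' R' where 2: "a1 \<le> a'" "a' \<le> a1 + m" "near a' a' p' R'" "0 \<le> R'"
    "R'\<^sup>2 \<le> \<tau> ^ k * R1\<^sup>2 + e * (1 - \<tau> ^ k) / (1 - \<tau>)"
    by (auto simp: m_def)
  have "\<tau> ^ k * R1\<^sup>2 + e * (1 - \<tau> ^ k) / (1 - \<tau>) = \<tau> ^ Suc k * R\<^sup>2 + e * (1 - \<tau> ^ Suc k) / (1 - \<tau>)"
    unfolding R1(1) using kappa by (simp add: field_simps)
  then show ?case using 1 2 by (intro exI[of _ a'] exI[of _ p'] exI[of _ R']) auto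
qed

text \<open>
  The number \<open>\<rho>\<close> is a lower bound for the radius before each halving, so that the same \<open>P\<close> and \<open>\<sigma>\<close>
  serve all of them.
\<close>

lemma kernel_iterate:
  assumes n: "1 \<le> n" and W: "160 / (1 - \<tau>) \<le> ln (real n + 1)" and \<tau>: "1 - \<tau> \<le> 1 / 16"
    and \<rho>: "0 < \<rho>" "8 * d / \<rho> \<le> real P" "\<sigma> \<le> (1 - \<tau>) * \<rho>\<^sup>2 / 160"
  shows "near a b p R \<Longrightarrow> 1 \<le> a \<Longrightarrow> \<rho> * 2 ^ k \<le> 2 * R \<Longrightarrow> a + (4 * (P * (4 * n) + 1) ^ k - 4) \<le> b \<Longrightarrow>
    \<exists>a' p'. a \<le> a' \<and> a' \<le> b \<and> near a' a' p' (R / 2 ^ k)"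
proof (induction k arbitrary: a b p R)
  case 0
  then have "near a a p R" by (auto intro: near_shrink)
  with 0 show ?case by (intro exI[of _ a] exI[of _ p]) auto
next
  case (Suc k)
  define m where "m = 4 * (P * (4 * n) + 1) ^ k - 4"
  have "\<rho> * 1 \<le> \<rho> * 2 ^ k" using \<rho> by (intro mult_left_mono) auto
  also have "\<dots> \<le> R" using Suc.prems(3) by simp
  finally have R: "\<rho> \<le> R" by simp
  have "P * (4 * n) * (m + 4) \<le> 4 * (P * (4 * n) + 1) ^ Suc k - 4" unfolding m_def by (rule block_length_Suc)
  then have len: "a + P * (4 * n) * (m + 4) \<le> b" using Suc.prems(4) by linarith
  have "8 * d / R \<le> 8 * d / \<rho>" using R \<rho> d_ge by (intro divide_left_mono) auto
  then have P: "8 * d / R \<le> real P" using \<rho> by linarith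
  have "(1 - \<tau>) * \<rho>\<^sup>2 / 160 \<le> (1 - \<tau>) * R\<^sup>2 / 160"
    using R \<rho> kappa by (intro divide_right_mono mult_left_mono power_mono) auto
  then have \<sigma>: "\<sigma> \<le> (1 - \<tau>) * R\<^sup>2 / 160" using \<rho> by linarith
  have "0 < R" using R \<rho> by linarith
  from kernel_step[OF Suc.prems(1,2) n this W \<tau> P len \<sigma>]
  obtain a1 p1 where 1: "a \<le> a1" "a1 + m \<le> b" "near a1 (a1 + m) p1 (R / 2)" by blast
  have "1 \<le> a1" using 1 Suc.prems by simp
  from Suc.IH[OF 1(3) this] obtain a' p' where 2: "a1 \<le> a'" "a' \<le> a1 + m" "near a' a' p' (R / 2 / 2 ^ k)"
    using Suc.prems(3) by (auto simp: m_def)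
  then show ?case using 1 by (intro exI[of _ a'] exI[of _ p']) (auto simp: mult.commute)
qed

lemma near_diam: "p \<in> C \<Longrightarrow> near a b p d"
  using diam z_in u_in by (auto simp: near_def)

end

section \<open>Growth of the iterated functionals\<close>

lemma argument_le_square: "n \<le> 16 * d * n\<^sup>2" if "d \<ge> 1" for n d :: nat
proof -
  have "n * 1 \<le> n * n" by (simp add: le_square)
  also have "\<dots> \<le> (16 * d) * (n * n)" using that by simp
  finally show ?thesis by (simp add: power2_eq_square)
qed

lemma maj_ge: "m \<le> n \<Longrightarrow> F m \<le> maj F n"
  unfolding maj_def by (rule Max_ge) auto

lemma maj_mono: "m \<le> n \<Longrightarrow> maj F m \<le> maj F n"
  unfolding maj_def by (rule Max_mono) auto

context
  fixes d :: nat and F :: "nat \<Rightarrow> nat"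
  assumes d: "d \<ge> 1"
begin

lemma tilde_pos_ge_square: "16 * d * n\<^sup>2 \<le> tilde_pos d F n"
  by (simp add: tilde_pos_def)

lemma tilde_pos_ge_power2: "n\<^sup>2 \<le> tilde_pos d F n"
proof -
  have "n\<^sup>2 \<le> 16 * d * n\<^sup>2" using d by simp
  then show ?thesis using tilde_pos_ge_square[of n] by linarith
qed

lemma tilde_pos_ge_self: "n \<le> tilde_pos d F n"
  using argument_le_square[OF d, of n] tilde_pos_ge_square[of n] by linarith

lemma tilde_pos_ge_apply: "1 \<le> n \<Longrightarrow> F n \<le> tilde_pos d F n"
  unfolding tilde_pos_def maj_pos_def
  using argument_le_square[OF d, of n] by (intro max.coboundedI1 Max_ge) auto

lemma tilde_pos_mono: "1 \<le> m \<Longrightarrow> m \<le> n \<Longrightarrow> tilde_pos d F m \<le> tilde_pos d F n"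
proof -
  assume mn: "1 \<le> m" "m \<le> n"
  then have le: "16 * d * m\<^sup>2 \<le> 16 * d * n\<^sup>2" by (intro mult_left_mono power_mono) auto
  have "1 \<le> 16 * d * m\<^sup>2" using argument_le_square[OF d, of m] mn(1) by (rule order_trans[rotated])
  moreover have "maj_pos F M \<le> maj_pos F N" if "1 \<le> M" "M \<le> N" for M N
    unfolding maj_pos_def using that by (intro Max_mono image_mono) auto
  ultimately have "maj_pos F (16 * d * m\<^sup>2) \<le> maj_pos F (16 * d * n\<^sup>2)" using le by blast
  then show ?thesis unfolding tilde_pos_def using le by (intro max.mono)
qed

lemma iterate_ge_self: "n \<le> (tilde_pos d F ^^ k) n"
  by (induction k) (auto intro: order_trans[OF _ tilde_pos_ge_self])

lemma iterate_mono_arg: "1 \<le> m \<Longrightarrow> m \<le> n \<Longrightarrow> (tilde_pos d F ^^ k) m \<le> (tilde_pos d F ^^ k) n"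
proof (induction k)
  case (Suc k)
  then show ?case using iterate_ge_self[of m k] by (auto intro!: tilde_pos_mono)
qed simp

lemma iterate_mono_count: "k \<le> l \<Longrightarrow> (tilde_pos d F ^^ k) n \<le> (tilde_pos d F ^^ l) n"
proof -
  assume "k \<le> l"
  then have "(tilde_pos d F ^^ l) n = (tilde_pos d F ^^ (l - k)) ((tilde_pos d F ^^ k) n)"
    using funpow_add[of "l - k" k "tilde_pos d F"] by simp
  then show ?thesis using iterate_ge_self by simp
qed

lemma iterate_ge_power: "n ^ 2 ^ k \<le> (tilde_pos d F ^^ k) n"
proof (induction k)
  case (Suc k)
  have "n ^ 2 ^ Suc k = (n ^ 2 ^ k)\<^sup>2" by (simp add: power_mult[symmetric] mult.commute)
  also have "\<dots> \<le> ((tilde_pos d F ^^ k) n)\<^sup>2" using Suc by (intro power_mono) auto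
  also have "\<dots> \<le> (tilde_pos d F ^^ Suc k) n" using tilde_pos_ge_power2 by simp
  finally show ?case .
qed simp

lemma iterate_ge_two_power: "2 ^ k \<le> (tilde_pos d F ^^ k) 1"
proof (induction k)
  case (Suc k)
  define y where "y = (tilde_pos d F ^^ k) 1"
  have "2 ^ Suc k \<le> 2 * y" using Suc by (simp add: y_def)
  also have "\<dots> \<le> 16 * d * (y * y)" using d le_square[of y] by (intro mult_mono) auto
  also have "\<dots> = 16 * d * y\<^sup>2" by (simp add: power2_eq_square)
  also have "\<dots> \<le> tilde_pos d F y" by (rule tilde_pos_ge_square)
  finally show ?case by (simp add: y_def)
qed simp

end

lemma iterate_tilde_ge:
  assumes d: "d \<ge> 1" and ge: "\<And>n. 1 \<le> n \<Longrightarrow> n \<le> H n"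
    and mono: "\<And>m n. 1 \<le> m \<Longrightarrow> m \<le> n \<Longrightarrow> H m \<le> H n" and n: "1 \<le> n"
  shows "(H ^^ k) n \<le> (tilde_pos d H ^^ k) n"
proof (induction k)
  case (Suc k)
  have 1: "1 \<le> (H ^^ k) n"
  proof (induction k)
    case (Suc k) then show ?case using ge[of "(H ^^ k) n"] by simp
  qed (use n in simp)
  have "H ((H ^^ k) n) \<le> H ((tilde_pos d H ^^ k) n)" by (rule mono[OF 1 Suc])
  also have "\<dots> \<le> tilde_pos d H ((tilde_pos d H ^^ k) n)" using 1 Suc by (intro tilde_pos_ge_apply d) simp
  finally show ?case by simp
qed simp

text \<open>
  The functional \<open>f_seq i\<close> is an iterate of \<open>f\<^sup>~\<close>, hence increasing and above the identity, so the
  additional tilde in \<open>k_seq\<close> only increases it. The exponent is \<open>1\<close> for \<open>i = 0\<close> because \<open>k\<^sub>0\<close> already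
  contains \<open>N\<^sub>0\<close> iterations.
\<close>

lemma k_seq_ge_iterate:
  assumes d: "d \<ge> 1"
  shows "(tilde_pos d (f_base \<tau> chi h d \<epsilon> g) ^^ (N_0 \<tau> d \<epsilon> ^ max 1 i)) 1 \<le> k_seq \<tau> chi h d \<epsilon> g i"
proof -
  define t where "t = tilde_pos d (f_base \<tau> chi h d \<epsilon> g)"
  define N where "N = N_0 \<tau> d \<epsilon>"
  have fs: "f_seq \<tau> chi h d \<epsilon> g i = t ^^ (N ^ i)" for i by (simp add: f_seq_def t_def N_def)
  have step: "(t ^^ (N ^ Suc i)) n \<le> (tilde_pos d (f_seq \<tau> chi h d \<epsilon> g i) ^^ N) n" if "1 \<le> n" for i n
  proof -
    have "((t ^^ (N ^ i)) ^^ N) n \<le> (tilde_pos d (t ^^ (N ^ i)) ^^ N) n"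
      using that by (intro iterate_tilde_ge d) (auto simp: t_def intro: iterate_ge_self[OF d] iterate_mono_arg[OF d])
    then show ?thesis by (simp add: fs funpow_mult mult.commute)
  qed
  have "(t ^^ (N ^ max 1 i)) 1 \<le> k_seq \<tau> chi h d \<epsilon> g i"
  proof (cases i)
    case 0
    then show ?thesis using step[of 1 0] by (simp add: N_def)
  next
    case (Suc k)
    have kpos: "1 \<le> k_seq \<tau> chi h d \<epsilon> g j" for j
    proof (induction j)
      case 0
      show ?case using iterate_ge_self[OF d, where n = 1 and F = "f_seq \<tau> chi h d \<epsilon> g 0"] by simp
    next
      case (Suc j)
      show ?case using order_trans[OF Suc iterate_ge_self[OF d]] by simp
    qed
    have "(t ^^ (N ^ Suc k)) 1 \<le> (t ^^ (N ^ Suc k)) (k_seq \<tau> chi h d \<epsilon> g k)"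
      unfolding t_def by (rule iterate_mono_arg[OF d order_refl kpos])
    also have "\<dots> \<le> k_seq \<tau> chi h d \<epsilon> g (Suc k)"
      using step[OF kpos, of k k] by (simp add: N_def)
    finally show ?thesis using Suc by simp
  qed
  then show ?thesis by (simp add: t_def N_def)
qed

lemma f_base_ge:
  assumes d: "d \<ge> 1" and \<epsilon>: "0 < \<epsilon>" "\<epsilon> \<le> 1" and \<tau>: "\<tau> < 1"
  shows "(1 - \<tau>) * real (maj h (maj (g_tilde g) (chi (d * n)))) \<le> real (f_base \<tau> chi h d \<epsilon> g n)"
proof -
  let ?L = "real (maj h (maj (g_tilde g) (chi (d * n))))"
  have "(\<epsilon> / 2)\<^sup>2 \<le> 1\<^sup>2" using \<epsilon> by (intro power_mono) auto
  then have e: "0 < (\<epsilon> / 2)\<^sup>2" "(\<epsilon> / 2)\<^sup>2 \<le> 6 * real d" using \<epsilon> d by auto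
  have "(1 - \<tau>) * ?L * (\<epsilon> / 2)\<^sup>2 \<le> (1 - \<tau>) * ?L * (6 * real d)"
    using e \<tau> by (intro mult_left_mono) auto
  also have "\<dots> = 6 * real d * (1 - \<tau>) * ?L" by (simp only: mult_ac)
  finally have "(1 - \<tau>) * ?L \<le> 6 * real d * (1 - \<tau>) * ?L / (\<epsilon> / 2)\<^sup>2"
    by (simp only: pos_le_divide_eq[OF e(1)])
  also have "\<dots> \<le> real (f_base \<tau> chi h d \<epsilon> g n)" unfolding f_base_def by (rule real_nat_ceiling_ge)
  finally show ?thesis .
qed

text \<open>
  One application of \<open>f\<^sup>~\<close> dominates both \<open>n\<^sup>2\<close> and \<open>(1 - \<tau>)\<close> times the value of \<open>h\<close>. The remaining
  applications square the result \<open>q + 2\<close> times, which is more than its power \<open>q + 2\<close>; one factor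
  supplies the value of \<open>h\<close>, one \<open>n\<^sup>2\<close> cancels \<open>1 - \<tau>\<close>, and \<open>q\<close> factors \<open>n\<^sup>2\<close> are left.
\<close>

lemma stage_growth:
  fixes q n d :: nat and \<tau> \<epsilon> :: real and chi h g :: "nat \<Rightarrow> nat"
  defines "t \<equiv> tilde_pos d (f_base \<tau> chi h d \<epsilon> g)"
  assumes d: "d \<ge> 1" and \<epsilon>: "0 < \<epsilon>" "\<epsilon> \<le> 1" and \<tau>: "\<tau> < 1" and n: "1 \<le> (1 - \<tau>) * real n"
  shows "real (maj h (maj (g_tilde g) (chi (d * n)))) * real n ^ (2 * q) \<le> real ((t ^^ (q + 3)) n)"
proof -
  define L where "L = real (maj h (maj (g_tilde g) (chi (d * n))))"
  have n1: "1 \<le> n" using n by (cases n) auto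
  have tn1: "1 \<le> t n" unfolding t_def by (rule order_trans[OF n1 tilde_pos_ge_self[OF d]])
  have "(1 - \<tau>) * L \<le> real (f_base \<tau> chi h d \<epsilon> g n)" unfolding L_def by (rule f_base_ge[OF d \<epsilon> \<tau>])
  also have "\<dots> \<le> real (t n)" unfolding t_def using tilde_pos_ge_apply[OF d n1] by simp
  finally have a: "(1 - \<tau>) * L \<le> real (t n)" .
  have b: "real n ^ 2 \<le> real (t n)" unfolding t_def
    using tilde_pos_ge_power2[OF d] by (simp flip: of_nat_power)
  have "1 \<le> 1 * real n" using n1 by simp
  also have "\<dots> \<le> (1 - \<tau>) * real n * real n" using n by (intro mult_right_mono) auto
  finally have c: "1 \<le> (1 - \<tau>) * (real n)\<^sup>2" by (simp only: power2_eq_square mult.assoc)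
  have "L * real n ^ (2 * q) * 1 \<le> L * real n ^ (2 * q) * ((1 - \<tau>) * (real n)\<^sup>2)"
    using c by (intro mult_left_mono) (auto simp: L_def)
  also have "\<dots> = ((1 - \<tau>) * L) * (real n ^ 2) ^ (q + 1)" by (simp add: power_mult[symmetric] power_add mult_ac)
  also have "\<dots> \<le> real (t n) * real (t n) ^ (q + 1)"
    using a b \<tau> by (intro mult_mono power_mono) (auto simp: L_def)
  also have "\<dots> = real (t n ^ (q + 2))" by simp
  also have "t n ^ (q + 2) \<le> t n ^ 2 ^ (q + 2)"
    using tn1 less_exp[of "q + 2"] by (intro power_increasing) auto
  also have "\<dots> \<le> (t ^^ (q + 2)) (t n)" unfolding t_def by (rule iterate_ge_power[OF d])
  also have "\<dots> = (t ^^ (q + 3)) n" by (simp add: funpow_swap1 numeral_3_eq_3)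
  finally show ?thesis by (simp add: L_def)
qed

section \<open>Counting the available stages\<close>

lemma inverse_eps_tilde:
  assumes d: "d \<ge> 1" and \<tau>: "\<tau> < 1" and \<delta>: "0 < \<delta>"
  shows "0 < eps_tilde \<tau> d (\<delta> / 6)" "2322432 * ((real d)\<^sup>2 / \<delta> ^ 4) \<le> 1 / eps_tilde \<tau> d (\<delta> / 6)"
proof -
  have eq: "eps_tilde \<tau> d (\<delta> / 6) = \<delta> ^ 4 / (165888 * (real d)\<^sup>2 * (6 + 8 * real d))"
  proof -
    have "k / a * (x / (8 * k * b)) = x / (8 * b * a)" if "k \<noteq> 0" for k a b x :: real
      using that by simp
    from this[of "(1 - \<tau>)\<^sup>2" "6 + 8 * real d" "(\<delta> / 6 / 2) ^ 4" "(real d)\<^sup>2"]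
    have "eps_tilde \<tau> d (\<delta> / 6) = (\<delta> / 6 / 2) ^ 4 / (8 * (real d)\<^sup>2 * (6 + 8 * real d))"
      using \<tau> unfolding eps_tilde_def eps_d_def by simp
    then show ?thesis by (simp add: power_divide)
  qed
  show "0 < eps_tilde \<tau> d (\<delta> / 6)" unfolding eq using d \<delta> by simp
  have "165888 * (real d)\<^sup>2 * 14 \<le> 165888 * (real d)\<^sup>2 * (6 + 8 * real d)" using d by (intro mult_left_mono) auto
  then have "165888 * (real d)\<^sup>2 * 14 / \<delta> ^ 4 \<le> 165888 * (real d)\<^sup>2 * (6 + 8 * real d) / \<delta> ^ 4"
    using \<delta> by (intro divide_right_mono) auto
  then show "2322432 * ((real d)\<^sup>2 / \<delta> ^ 4) \<le> 1 / eps_tilde \<tau> d (\<delta> / 6)" unfolding eq by simp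
qed

text \<open>
  The factors \<open>(1 - \<tau>)\<^sup>2\<close> in \<open>eps_d\<close> and \<open>eps_tilde\<close> cancel, so this lower bound does not depend on \<open>\<tau>\<close>.
\<close>

lemma N_0_lower_bound:
  assumes d: "d \<ge> 1" and \<tau>: "\<tau> < 1" and \<delta>: "0 < \<delta>" "\<delta> \<le> 1"
  shows "10 ^ 26 * (real d / \<delta>) ^ 12 \<le> real (N_0 \<tau> d (\<delta> / 6))"
proof -
  let ?e = "eps_tilde \<tau> d (\<delta> / 6)"
  have "(2322432 * ((real d)\<^sup>2 / \<delta> ^ 4)) ^ 4 \<le> (1 / ?e) ^ 4"
    using inverse_eps_tilde[OF d \<tau> \<delta>(1)] d \<delta> by (intro power_mono) auto
  then have "8 * real d ^ 4 * (2322432 * ((real d)\<^sup>2 / \<delta> ^ 4)) ^ 4 \<le> 8 * real d ^ 4 * (1 / ?e) ^ 4"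
    by (intro mult_left_mono) auto
  also have "\<dots> = 8 * real d ^ 4 / ?e ^ 4" by (simp add: power_divide)
  also have "\<dots> \<le> real (N_0 \<tau> d (\<delta> / 6))" unfolding N_0_def by (rule real_nat_ceiling_ge)
  finally have 1: "8 * real d ^ 4 * (2322432 * ((real d)\<^sup>2 / \<delta> ^ 4)) ^ 4 \<le> real (N_0 \<tau> d (\<delta> / 6))" .
  have "\<delta> ^ 16 \<le> \<delta> ^ 12" using \<delta> by (intro power_decreasing) auto
  then have "real d ^ 12 / \<delta> ^ 12 \<le> real d ^ 12 / \<delta> ^ 16" using \<delta> by (intro divide_left_mono) auto
  then have "10 ^ 26 * (real d ^ 12 / \<delta> ^ 12) \<le> (8 * 2322432 ^ 4) * (real d ^ 12 / \<delta> ^ 16)"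
    using d \<delta> by (intro mult_mono) auto
  also have "\<dots> = 8 * real d ^ 4 * (2322432 * ((real d)\<^sup>2 / \<delta> ^ 4)) ^ 4"
    by (simp add: power_mult_distrib power_divide power_mult[symmetric] power_add[symmetric] mult_ac)
  finally show ?thesis using 1 by (simp add: power_divide)
qed

lemma tau_0_upper_bound:
  assumes d: "d \<ge> 1" and \<tau>: "\<tau> < 1" and \<delta>: "0 < \<delta>"
  shows "0 < eps_tilde \<tau> d (\<delta> / 6) / (6 * (real d)\<^sup>2)"
    and "13000000 * (real d / \<delta>) ^ 4 \<le> 1 / (eps_tilde \<tau> d (\<delta> / 6) / (6 * (real d)\<^sup>2))"
proof -
  let ?e = "eps_tilde \<tau> d (\<delta> / 6)"
  show "0 < ?e / (6 * (real d)\<^sup>2)" using inverse_eps_tilde[OF d \<tau> \<delta>] d by simp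
  have "6 * (real d)\<^sup>2 * (2322432 * ((real d)\<^sup>2 / \<delta> ^ 4)) \<le> 6 * (real d)\<^sup>2 * (1 / ?e)"
    using inverse_eps_tilde[OF d \<tau> \<delta>] by (intro mult_left_mono) auto
  moreover have "6 * (real d)\<^sup>2 * (2322432 * ((real d)\<^sup>2 / \<delta> ^ 4)) = 13934592 * (real d / \<delta>) ^ 4"
    by (simp add: power_divide power_add[symmetric])
  moreover have "13000000 * (real d / \<delta>) ^ 4 \<le> 13934592 * (real d / \<delta>) ^ 4"
    using d \<delta> by (intro mult_right_mono) auto
  moreover have "1 / (?e / (6 * (real d)\<^sup>2)) = 6 * (real d)\<^sup>2 * (1 / ?e)" by simp
  ultimately show "13000000 * (real d / \<delta>) ^ 4 \<le> 1 / (?e / (6 * (real d)\<^sup>2))" by linarith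
qed

lemma i_0_lower_bound:
  "log \<tau> (eps_tilde \<tau> d \<epsilon> / (6 * (real d)\<^sup>2)) \<le> real (i_0 \<tau> d \<epsilon>) + 1"
  unfolding i_0_def using real_nat_ceiling_ge[of "log \<tau> (eps_tilde \<tau> d \<epsilon> / (6 * (real d)\<^sup>2)) - 1"] by linarith

text \<open>
  By definition of \<open>i_0\<close>, the power \<open>i\<^sub>0 + 1\<close> of \<open>\<tau>\<close> is at most the argument \<open>t\<close> of the logarithm. The
  exponent here is at least half of \<open>i\<^sub>0 + 1\<close>, so the bound is \<open>\<surd>t\<close>, which is of order \<open>(\<delta>/d)\<^sup>2\<close>.
\<close>

lemma contraction_power_small:
  assumes d: "d \<ge> 1" and \<tau>: "0 < \<tau>" "\<tau> < 1" and \<delta>: "0 < \<delta>"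
  shows "\<tau> ^ max 1 (i_0 \<tau> d (\<delta> / 6)) * (real d)\<^sup>2 \<le> \<delta>\<^sup>2 / 3000"
proof -
  let ?t = "eps_tilde \<tau> d (\<delta> / 6) / (6 * (real d)\<^sup>2)" and ?i = "i_0 \<tau> d (\<delta> / 6)" and ?L = "max 1 (i_0 \<tau> d (\<delta> / 6))"
  define D where "D = real d / \<delta>"
  have D: "D > 0" using d \<delta> by (simp add: D_def)
  have t: "0 < ?t" "13000000 * D ^ 4 \<le> 1 / ?t" using tau_0_upper_bound[OF d \<tau>(2) \<delta>] by (simp_all add: D_def)
  have "\<tau> ^ (?i + 1) = \<tau> powr (real ?i + 1)" using \<tau> by (simp add: powr_add powr_realpow)
  also have "\<dots> \<le> \<tau> powr (log \<tau> ?t)" using i_0_lower_bound[of \<tau> d "\<delta> / 6"] \<tau> by (intro powr_mono') auto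
  also have "\<dots> = ?t" using \<tau> t by (intro powr_log_cancel) auto
  finally have "\<tau> ^ (?i + 1) \<le> ?t" .
  moreover have "\<tau> ^ (2 * ?L) \<le> \<tau> ^ (?i + 1)" using \<tau> by (intro power_decreasing) auto
  ultimately have "(\<tau> ^ ?L)\<^sup>2 \<le> ?t" by (simp add: power_mult[symmetric] mult.commute)
  also have "?t \<le> 1 / (13000000 * D ^ 4)"
  proof -
    have "a \<le> 1 / b" if "0 < a" "0 < b" "b \<le> 1 / a" for a b :: real
      using that by (simp add: field_simps)
    then show ?thesis using t D by simp
  qed
  also have "\<dots> \<le> (1 / (3000 * D\<^sup>2))\<^sup>2"
    using D by (simp add: power_divide power_mult_distrib power_mult[symmetric] field_simps)
  finally have "\<tau> ^ ?L \<le> 1 / (3000 * D\<^sup>2)" using power2_le_imp_le by fastforce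
  then have "\<tau> ^ ?L * (real d)\<^sup>2 \<le> 1 / (3000 * D\<^sup>2) * (real d)\<^sup>2" by (intro mult_right_mono) auto
  also have "\<dots> = \<delta>\<^sup>2 / 3000" using d \<delta> by (simp add: D_def power_divide)
  finally show ?thesis .
qed

lemma nat_ceiling_le_add_one: "0 \<le> x \<Longrightarrow> real (nat \<lceil>x\<rceil>) \<le> x + 1"
  by linarith

text \<open>
  In each of the \<open>L\<close> rounds, \<open>Q + 1\<close> times a constant stays below \<open>N\<^sub>0\<close>: for \<open>1 - \<tau> \<ge> 1/16\<close> the
  former is of order \<open>D^4\<close>, the latter at least \<open>10^26 * D^12\<close>. The numbers \<open>s\<close> and \<open>q + 3\<close> are the
  applications of \<open>f\<^sup>~\<close> spent before the first stage and on each stage.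
\<close>

lemma picard_budget:
  fixes \<tau> \<delta> :: real and d :: nat
  defines "D \<equiv> real d / \<delta>" and "L \<equiv> max 1 (i_0 \<tau> d (\<delta> / 6))"
  assumes d: "d \<ge> 1" and \<tau>: "\<tau> < 1" "0 < \<tau>" "1 / 16 \<le> 1 - \<tau>" and \<delta>: "0 < \<delta>" "\<delta> \<le> 1"
    and Q: "Q = nat \<lceil>10000 * D ^ 4 / (1 - \<tau>)\<^sup>2\<rceil>" and q: "q = nat \<lceil>1 / (1 - \<tau>)\<rceil>"
    and s: "s = nat \<lceil>160000 * D ^ 4 / (1 - \<tau>) ^ 3\<rceil>"
  shows "s + (q + 3) * (4 * (Q + 1) ^ L + 4) \<le> N_0 \<tau> d (\<delta> / 6) ^ L"
proof -
  define \<kappa> where "\<kappa> = 1 - \<tau>"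
  have \<kappa>: "0 < \<kappa>" "1 / 16 \<le> \<kappa>" using \<tau> by (auto simp: \<kappa>_def)
  have D1: "1 \<le> D" using d \<delta> by (simp add: D_def)
  have D4: "1 \<le> D ^ 4" "D ^ 4 \<le> D ^ 12" using D1 by (auto intro: one_le_power power_increasing)
  have L1: "1 \<le> L" by (simp add: L_def)
  have inv: "1 / \<kappa> \<le> 16" using \<kappa> by (simp add: field_simps)
  have inv2: "1 / \<kappa>\<^sup>2 \<le> 256" "1 / \<kappa> ^ 3 \<le> 4096"
    using power_mono[OF inv, of 2] power_mono[OF inv, of 3] \<kappa> by (auto simp: power_divide)
  define X where "X = real (Q + 1)"
  have q': "real q \<le> 17" unfolding q using inv \<kappa> by (simp add: \<kappa>_def[symmetric])
  have s': "real s \<le> 655360001 * D ^ 4"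
  proof -
    have "real s \<le> 160000 * D ^ 4 * (1 / \<kappa> ^ 3) + 1"
      unfolding s using D4 \<kappa> by (simp add: \<kappa>_def[symmetric])
    also have "\<dots> \<le> 160000 * D ^ 4 * 4096 + 1" using inv2 D4 by (intro add_right_mono mult_left_mono) auto
    finally show ?thesis using D4 by linarith
  qed
  have X: "X \<le> 2560002 * D ^ 4"
  proof -
    have "real Q \<le> 10000 * D ^ 4 * (1 / \<kappa>\<^sup>2) + 1"
      unfolding Q using D4 \<kappa> by (simp add: \<kappa>_def[symmetric])
    also have "\<dots> \<le> 10000 * D ^ 4 * 256 + 1" using inv2 D4 by (intro add_right_mono mult_left_mono) auto
    finally show ?thesis using D4 by (simp add: X_def)
  qed
  have XD: "D ^ 4 \<le> X"
  proof -
    have "\<kappa>\<^sup>2 \<le> 1\<^sup>2" using \<kappa> \<tau> by (intro power_mono) (auto simp: \<kappa>_def)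
    then have "D ^ 4 * \<kappa>\<^sup>2 \<le> D ^ 4 * 10000" using D4 by (intro mult_left_mono) auto
    then have "D ^ 4 \<le> 10000 * D ^ 4 / \<kappa>\<^sup>2" using \<kappa> by (simp add: pos_le_divide_eq mult.commute)
    also have "\<dots> \<le> real Q" unfolding Q \<kappa>_def by (rule real_nat_ceiling_ge)
    finally show ?thesis by (simp add: X_def)
  qed
  have XL: "X \<le> X ^ L" "1 \<le> X ^ L" using XD D4 L1 by (auto intro: self_le_power)
  have "real (s + (q + 3) * (4 * (Q + 1) ^ L + 4)) = real s + (real q + 3) * (4 * X ^ L + 4)" by (simp add: X_def)
  also have "\<dots> \<le> 655360001 * X ^ L + 20 * (4 * X ^ L + 4 * X ^ L)"
    using s' q' XL XD by (intro add_mono mult_mono) auto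
  also have "\<dots> \<le> 655360161 ^ 1 * X ^ L" by simp
  also have "\<dots> \<le> 655360161 ^ L * X ^ L" using L1 XL by (intro mult_right_mono power_increasing) auto
  also have "\<dots> = (655360161 * X) ^ L" by (simp add: power_mult_distrib)
  also have "\<dots> \<le> real (N_0 \<tau> d (\<delta> / 6)) ^ L"
  proof (rule power_mono)
    have "655360161 * X \<le> 10 ^ 26 * D ^ 12" using X D4 by simp
    also have "\<dots> \<le> real (N_0 \<tau> d (\<delta> / 6))" unfolding D_def using N_0_lower_bound d \<tau> \<delta> by simp
    finally show "655360161 * X \<le> real (N_0 \<tau> d (\<delta> / 6))" .
  qed (simp add: X_def)
  finally show ?thesis by (simp flip: of_nat_power of_nat_le_iff[where 'a = real])
qed

text \<open>
  The argument of the logarithm in \<open>i_0\<close> is at most \<open>16\<close> to the power \<open>-(S + 3)\<close>, and \<open>- ln \<tau>\<close> is at most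
  \<open>16/15 (1 - \<tau>)\<close>. As \<open>ln 16 \<ge> 8/3\<close>, the quotient of the logarithms is at least
  \<open>5/2 (S + 3) / (1 - \<tau>)\<close>; subtracting \<open>1\<close> is paid for by \<open>1 - \<tau> \<le> 1/16\<close>.
\<close>

lemma i_0_large:
  fixes \<tau> \<delta> :: real and d S :: nat
  assumes d: "d \<ge> 1" and \<tau>: "0 < \<tau>" "\<tau> < 1" "1 - \<tau> \<le> 1 / 16" and \<delta>: "0 < \<delta>"
    and S: "2 ^ S \<le> 4 * (real d / \<delta>)"
  shows "(7 + 5 / 2 * real S) / (1 - \<tau>) \<le> real (i_0 \<tau> d (\<delta> / 6))"
proof -
  define D where "D = real d / \<delta>"
  define t where "t = eps_tilde \<tau> d (\<delta> / 6) / (6 * (real d)\<^sup>2)"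
  have t: "0 < t" "13000000 * D ^ 4 \<le> 1 / t"
    using tau_0_upper_bound[OF d \<tau>(2) \<delta>] by (simp_all add: D_def t_def)
  have "(2 ^ S) ^ 4 \<le> (4 * D) ^ 4" using S by (intro power_mono) (auto simp: D_def)
  also have "\<dots> = 256 * D ^ 4" by (simp add: power_mult_distrib)
  finally have "16 ^ S \<le> 256 * D ^ 4" by (simp add: power_mult[symmetric] mult.commute[of S 4]) (simp add: power_mult)
  moreover have "16 ^ (S + 3) = 4096 * (16::real) ^ S" by (simp add: power_add)
  moreover have "0 \<le> D ^ 4" by simp
  ultimately have "16 ^ (S + 3) \<le> 13000000 * D ^ 4" by linarith
  then have "16 ^ (S + 3) \<le> 1 / t" using t by linarith
  then have "ln ((16::real) ^ (S + 3)) \<le> ln (1 / t)" by (intro ln_mono) auto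
  then have "real (S + 3) * ln 16 \<le> ln (1 / t)" by (simp add: ln_realpow)
  moreover have "8 / 3 \<le> ln (16::real)"
  proof -
    have "ln (16::real) = ln (2 ^ 4)" by simp
    also have "\<dots> = 4 * ln 2" by (subst ln_realpow) auto
    finally show ?thesis using ln2_ge_two_thirds by simp
  qed
  then have "real (S + 3) * (8 / 3) \<le> real (S + 3) * ln 16" by (intro mult_left_mono) auto
  ultimately have lt: "real (S + 3) * (8 / 3) \<le> - ln t" using t by (simp add: ln_div)
  have "ln (1 / \<tau>) \<le> 1 / \<tau> - 1" using \<tau> by (intro ln_le_minus_one) auto
  also have "1 / \<tau> - 1 = (1 - \<tau>) / \<tau>" using \<tau> by (simp add: diff_divide_distrib)
  also have "\<dots> \<le> (1 - \<tau>) / (15 / 16)" using \<tau> by (intro divide_left_mono) auto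
  finally have l\<tau>: "- ln \<tau> \<le> 16 / 15 * (1 - \<tau>)" using \<tau> by (simp add: ln_div)
  have l\<tau>0: "0 < - ln \<tau>" using \<tau> by simp
  have "5 / 2 * x / k = x * (8 / 3) / (16 / 15 * k)" for x k :: real
    by (cases "k = 0") (simp_all add: field_simps)
  then have "(5 / 2 * real (S + 3)) / (1 - \<tau>) = real (S + 3) * (8 / 3) / (16 / 15 * (1 - \<tau>))" .
  also have "\<dots> \<le> - ln t / - ln \<tau>"
    using lt l\<tau> l\<tau>0 \<tau> by (intro frac_le) auto
  also have "\<dots> = log \<tau> t" by (simp add: log_def)
  also have "\<dots> \<le> real (i_0 \<tau> d (\<delta> / 6)) + 1" unfolding t_def by (rule i_0_lower_bound)
  finally have "(5 / 2 * real (S + 3)) / (1 - \<tau>) \<le> real (i_0 \<tau> d (\<delta> / 6)) + 1" .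
  moreover have "1 \<le> (1 / 2) / (1 - \<tau>)" using \<tau> by (simp add: pos_le_divide_eq)
  moreover have "(5 / 2 * real (S + 3)) / (1 - \<tau>) = (7 + 5 / 2 * real S) / (1 - \<tau>) + (1 / 2) / (1 - \<tau>)"
  proof -
    have "5 / 2 * real (S + 3) = (7 + 5 / 2 * real S) + 1 / 2" by simp
    then show ?thesis by (simp only: add_divide_distrib)
  qed
  ultimately show ?thesis by linarith
qed

text \<open>
  Write \<open>k = 1/(1 - \<tau>)\<close>. Each of the \<open>S\<close> halvings multiplies the length by at most
  \<open>D exp (161 k)\<close>. On the other side \<open>N\<^sub>0 \<ge> D exp 65\<close> and \<open>i\<^sub>0 \<ge> (7 + 5/2 S) k\<close>, and the product
  \<open>65 (7 + 5/2 S) k\<close> exceeds \<open>161 S k\<close> by at least \<open>455 k\<close>, which absorbs the remaining factors.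
\<close>

lemma kernel_budget:
  fixes \<tau> \<delta> :: real and d S :: nat
  defines "D \<equiv> real d / \<delta>" and "L \<equiv> max 1 (i_0 \<tau> d (\<delta> / 6))"
  assumes d: "d \<ge> 1" and \<tau>: "0 < \<tau>" "\<tau> < 1" "1 - \<tau> \<le> 1 / 16" and \<delta>: "0 < \<delta>" "\<delta> \<le> 1 / 4"
    and S: "2 ^ S \<le> 4 * D"
    and n: "n = nat \<lceil>exp (160 / (1 - \<tau>))\<rceil>" and P: "P = nat \<lceil>16 * D\<rceil>" and q: "q = nat \<lceil>1 / (1 - \<tau>)\<rceil>"
    and s: "s = nat \<lceil>160000 * D ^ 4 / (1 - \<tau>) ^ 3\<rceil>"
  shows "s + (q + 3) * (4 * (P * (4 * n) + 1) ^ S + 4) \<le> N_0 \<tau> d (\<delta> / 6) ^ L"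
proof -
  define k where "k = 1 / (1 - \<tau>)"
  define i where "i = i_0 \<tau> d (\<delta> / 6)"
  define E where "E = exp (160 * k)"
  define Y where "Y = (D * exp (161 * k)) ^ S"
  have k: "16 \<le> k" using \<tau> by (simp add: k_def pos_le_divide_eq)
  have D: "4 \<le> D" using d \<delta> by (simp add: D_def pos_le_divide_eq)
  have i: "(7 + 5 / 2 * real S) * k \<le> real i"
    using i_0_large[OF d \<tau> \<delta>(1), of S] S by (simp add: D_def k_def i_def)
  have "(7 + 5 / 2 * real S) * 1 \<le> (7 + 5 / 2 * real S) * k" using k by (intro mult_left_mono) auto
  also note i
  finally have "(7 + 5 / 2 * real S) * 1 \<le> real i" .
  then have "real S + 4 \<le> real i" unfolding mult_1_right by linarith
  then have iS: "S + 4 \<le> i" by linarith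
  have Li: "L = i" using iS by (simp add: L_def i_def)
  have e: "2 ^ m \<le> exp (real m)" for m
    using power_mono[OF exp_ge_add_one_self[of 1], of m] by (simp add: exp_of_nat_mult[of m 1, simplified])
  have A: "real (P * (4 * n) + 1) \<le> D * exp (161 * k)"
  proof -
    have "1 \<le> E" using k by (simp add: E_def)
    have P': "real P \<le> 17 * D" unfolding P using D by simp linarith
    have nE: "n = nat \<lceil>E\<rceil>" by (simp add: n E_def k_def)
    have n': "real n \<le> 2 * E" unfolding nE using nat_ceiling_le_add_one[of E] \<open>1 \<le> E\<close> by linarith
    have "real (P * (4 * n) + 1) = real P * (4 * real n) + 1" by simp
    also have "\<dots> \<le> 17 * D * (4 * (2 * E)) + 1" using P' n' D by (intro add_right_mono mult_mono) auto
    also have "\<dots> \<le> 137 * (D * E)"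
    proof -
      have "1 * 1 \<le> D * E" using D \<open>1 \<le> E\<close> by (intro mult_mono) auto
      then show ?thesis by simp
    qed
    also have "\<dots> \<le> exp k * (D * E)"
    proof (rule mult_right_mono)
      have "(137::real) \<le> 2 ^ 16" by simp
      also have "\<dots> \<le> exp 16" using e[of 16] by simp
      also have "\<dots> \<le> exp k" using k by simp
      finally show "137 \<le> exp k" .
    qed (use D \<open>1 \<le> E\<close> in auto)
    also have "\<dots> = D * exp (161 * k)" by (simp add: E_def exp_add[symmetric] mult.left_commute[of "exp k"] ring_distribs)
    finally show ?thesis .
  qed
  have DE: "1 \<le> D * exp (161 * k)"
  proof -
    have "1 * 1 \<le> D * exp (161 * k)" using D k by (intro mult_mono) auto
    then show ?thesis by simp
  qed
  then have Y1: "1 \<le> Y" by (simp add: Y_def one_le_power)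
  have AY: "real (P * (4 * n) + 1) ^ S \<le> Y" unfolding Y_def by (intro power_mono A) simp
  have D4: "1 \<le> D ^ 4" using D by (intro one_le_power) auto
  have k3: "1 \<le> k ^ 3" "k \<le> k ^ 3" using k by (auto intro: one_le_power self_le_power)
  have q': "real q + 3 \<le> 2 * k ^ 3" unfolding q k_def[symmetric] using k k3 by simp linarith
  have s': "real s \<le> 160001 * k ^ 3 * D ^ 4"
  proof -
    have "real s \<le> 160000 * D ^ 4 * k ^ 3 + 1"
      unfolding s using D4 \<tau> by (simp add: k_def power_divide)
    moreover have "1 * 1 \<le> D ^ 4 * k ^ 3" using D4 k3 by (intro mult_mono) auto
    ultimately show ?thesis by (simp add: mult_ac)
  qed
  have DY: "1 \<le> D ^ 4 * Y" "D ^ 4 \<le> D ^ 4 * Y" "Y \<le> D ^ 4 * Y"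
    using mult_mono[OF D4 Y1] mult_left_mono[OF Y1, of "D ^ 4"] mult_right_mono[OF D4, of Y] D4 Y1 by auto
  have "real (s + (q + 3) * (4 * (P * (4 * n) + 1) ^ S + 4))
      = real s + (real q + 3) * (4 * real (P * (4 * n) + 1) ^ S + 4)" by simp
  also have "\<dots> \<le> 160001 * k ^ 3 * (D ^ 4 * Y) + 2 * k ^ 3 * (4 * (D ^ 4 * Y) + 4 * (D ^ 4 * Y))"
  proof (rule add_mono)
    have "160001 * k ^ 3 * D ^ 4 \<le> 160001 * k ^ 3 * (D ^ 4 * Y)" using DY(2) k by (intro mult_left_mono) auto
    then show "real s \<le> 160001 * k ^ 3 * (D ^ 4 * Y)" using s' by linarith
    have "4 * real (P * (4 * n) + 1) ^ S + 4 \<le> 4 * (D ^ 4 * Y) + 4 * (D ^ 4 * Y)" using AY DY by linarith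
    then show "(real q + 3) * (4 * real (P * (4 * n) + 1) ^ S + 4) \<le> 2 * k ^ 3 * (4 * (D ^ 4 * Y) + 4 * (D ^ 4 * Y))"
      using q' k by (intro mult_mono) auto
  qed
  also have "\<dots> = (160017 * k ^ 3) * (D ^ 4 * Y)" by (simp add: algebra_simps)
  also have "\<dots> \<le> exp (455 * k) * (D ^ 4 * Y)"
  proof (rule mult_right_mono)
    have "(160017::real) \<le> 2 ^ 18" by simp
    also have "\<dots> \<le> exp 18" using e[of 18] by simp
    also have "\<dots> \<le> exp (2 * k)" using k by simp
    finally have c: "160017 \<le> exp (2 * k)" .
    have "k \<le> exp k" using exp_ge_add_one_self[of k] by linarith
    then have "k ^ 3 \<le> exp k ^ 3" using k by (intro power_mono) auto
    also have "\<dots> = exp (3 * k)" by (simp add: exp_of_nat_mult[of 3, simplified])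
    finally have "160017 * k ^ 3 \<le> exp (2 * k) * exp (3 * k)" using c k by (intro mult_mono) auto
    also have "\<dots> = exp (5 * k)" by (simp add: exp_add[symmetric])
    also have "\<dots> \<le> exp (455 * k)" using k by simp
    finally show "160017 * k ^ 3 \<le> exp (455 * k)" .
  qed (use DY in auto)
  also have "\<dots> = exp (455 * k + real S * (161 * k)) * D ^ (S + 4)"
    by (simp add: Y_def power_mult_distrib power_add exp_add exp_of_nat_mult)
  also have "\<dots> \<le> exp (65 * real i) * D ^ i"
  proof (intro mult_mono power_increasing iS)
    have "65 * ((7 + 5 / 2 * real S) * k) \<le> 65 * real i" using i by simp
    moreover have "455 * k + real S * (161 * k) \<le> 65 * ((7 + 5 / 2 * real S) * k)"
      using k by (simp add: algebra_simps)
    ultimately show "exp (455 * k + real S * (161 * k)) \<le> exp (65 * real i)" by simp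
  qed (use D in auto)
  also have "\<dots> = (exp 65 * D) ^ i" by (simp add: power_mult_distrib exp_of_nat_mult[symmetric] mult.commute)
  also have "\<dots> \<le> real (N_0 \<tau> d (\<delta> / 6)) ^ i"
  proof (rule power_mono)
    have "exp (65::real) = exp 1 ^ 65" by (simp add: exp_of_nat_mult[of 65 1, simplified])
    also have "\<dots> \<le> 3 ^ 65" by (intro power_mono exp_le) auto
    also have "\<dots> \<le> 10 ^ 26 * 4 ^ 11" by simp
    also have "\<dots> \<le> 10 ^ 26 * D ^ 11" using D by (intro mult_left_mono power_mono) auto
    finally have "exp 65 * D \<le> 10 ^ 26 * D ^ 11 * D" using D by (intro mult_right_mono) auto
    also have "\<dots> = 10 ^ 26 * D ^ 12" by (simp add: power_Suc2[symmetric] mult.assoc del: power_Suc2)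
    also have "\<dots> \<le> real (N_0 \<tau> d (\<delta> / 6))" unfolding D_def using N_0_lower_bound d \<tau> \<delta> by simp
    finally show "exp 65 * D \<le> real (N_0 \<tau> d (\<delta> / 6))" .
  qed (use D in simp)
  finally show ?thesis unfolding Li by (simp flip: of_nat_power of_nat_le_iff[where 'a = real])
qed

section \<open>A settled stage within the bound\<close>

context viscosity_stages
begin

text \<open>
  For \<open>1 - \<tau> \<ge> 1/16\<close> the radius is reduced \<open>max 1 i\<^sub>0\<close> times by \<open>picard_step\<close>, otherwise it is halved about
  \<open>log\<^sub>2 (2 d/\<delta>)\<close> times by \<open>kernel_step\<close>. In both cases, the number of applications of \<open>f\<^sup>~\<close> needed to reach
  the stage after the settled one is within the budget.
\<close>

lemma settled_stage_exists:
  fixes \<delta> :: real and dn :: nat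
  assumes dn: "d = real dn" and \<delta>: "0 < \<delta>" "\<delta> \<le> 1 / 4"
    and \<sigma>: "\<sigma> = (1 - \<tau>)\<^sup>2 * \<delta> ^ 4 / (20000 * d\<^sup>2)"
    and qd: "q = nat \<lceil>1 / (1 - \<tau>)\<rceil>" and s: "s = nat \<lceil>160000 * (d / \<delta>) ^ 4 / (1 - \<tau>) ^ 3\<rceil>"
  shows "\<exists>a p. near a a p (\<delta> / 2) \<and> s + (q + 3) * Suc a \<le> N_0 \<tau> dn (\<delta> / 6) ^ max 1 (i_0 \<tau> dn (\<delta> / 6))"
proof -
  define L where "L = max 1 (i_0 \<tau> dn (\<delta> / 6))"
  define D where "D = d / \<delta>"
  obtain p0 where p0: "p0 \<in> C" using C_ne by blast
  have d1: "dn \<ge> 1" using d_ge dn by simp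
  have D: "4 \<le> D" using d_ge \<delta> by (simp add: D_def pos_le_divide_eq)
  have bound: ?thesis if a: "near a a p R" "a \<le> 1 + (4 * (A + 1) ^ k - 4)" "R \<le> \<delta> / 2"
    and budget: "s + (q + 3) * (4 * (A + 1) ^ k + 4) \<le> N_0 \<tau> dn (\<delta> / 6) ^ L" for a p R A k
  proof -
    have "near a a p (\<delta> / 2)" using a(1,3) by (auto simp: near_def intro: order_trans)
    moreover have "s + (q + 3) * Suc a \<le> s + (q + 3) * (4 * (A + 1) ^ k + 4)"
      using a(2) by (intro add_left_mono mult_left_mono) auto
    ultimately show ?thesis using budget by (auto simp: L_def intro: order_trans)
  qed
  show ?thesis
  proof (cases "1 / 16 \<le> 1 - \<tau>")
    case True
    define \<eta> where "\<eta> = (1 - \<tau>) * \<delta>\<^sup>2 / (64 * d)"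
    define Q where "Q = nat \<lceil>10000 * D ^ 4 / (1 - \<tau>)\<^sup>2\<rceil>"
    define e where "e = 5 * \<sigma> / (1 - \<tau>) + 4 * d * \<eta>"
    have Qge: "10000 * D ^ 4 / (1 - \<tau>)\<^sup>2 \<le> real Q" unfolding Q_def by (rule real_nat_ceiling_ge)
    have pos: "0 < 10000 * D ^ 4 / (1 - \<tau>)\<^sup>2" using D kappa by simp
    have Q0: "0 < Q" using Qge pos by linarith
    have \<eta>0: "0 \<le> \<eta>" using kappa d_ge by (simp add: \<eta>_def)
    have \<eta>: "d\<^sup>2 / real Q + 2 * \<sigma> \<le> \<eta>\<^sup>2"
    proof -
      define X where "X = (1 - \<tau>)\<^sup>2 * \<delta> ^ 4 / d\<^sup>2"
      have X0: "0 \<le> X" by (simp add: X_def)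
      have "d\<^sup>2 / real Q \<le> d\<^sup>2 / (10000 * D ^ 4 / (1 - \<tau>)\<^sup>2)"
        by (rule divide_left_mono[OF Qge _ mult_pos_pos]) (use Q0 pos in auto)
      also have "\<dots> = X / 10000"
        using d_ge \<delta> kappa by (simp add: D_def X_def power_divide field_simps power2_eq_square power4_eq_xxxx)
      finally have 1: "d\<^sup>2 / real Q \<le> X / 10000" .
      have 2: "2 * \<sigma> = X / 10000" by (simp add: \<sigma> X_def mult_ac)
      have "\<eta>\<^sup>2 = X / 4096"
        by (simp add: \<eta>_def X_def power_divide power_mult_distrib power_mult[symmetric])
      then show ?thesis using 1 2 X0 by linarith
    qed
    obtain a p R where a: "a \<le> 1 + (4 * (Q + 1) ^ L - 4)" "near a a p R" "0 \<le> R"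
      "R\<^sup>2 \<le> \<tau> ^ L * d\<^sup>2 + e * (1 - \<tau> ^ L) / (1 - \<tau>)"
      using picard_iterate[OF Q0 \<eta> \<eta>0 e_def near_diam[OF p0] order_refl, where k = L, OF _ order_refl] d_ge by auto
    have "R\<^sup>2 \<le> (\<delta> / 2)\<^sup>2"
    proof -
      have "\<tau> ^ L * d\<^sup>2 \<le> \<delta>\<^sup>2 / 3000"
        unfolding L_def dn by (rule contraction_power_small[OF d1 tau \<delta>(1)])
      moreover have "e * (1 - \<tau> ^ L) / (1 - \<tau>) \<le> \<delta>\<^sup>2 / 12"
      proof -
        have e0: "0 \<le> e" using sigma kappa d_ge \<eta>0 by (simp add: e_def)
        have "\<sigma> / (1 - \<tau>) = (1 - \<tau>) * \<delta>\<^sup>2 / 20000 * (\<delta>\<^sup>2 / d\<^sup>2)"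
          using kappa by (simp add: \<sigma> power2_eq_square power4_eq_xxxx)
        also have "\<dots> \<le> (1 - \<tau>) * \<delta>\<^sup>2 / 20000 * 1"
        proof (rule mult_left_mono)
          have "\<delta>\<^sup>2 \<le> d\<^sup>2" using \<delta> d_ge by (intro power_mono) auto
          then show "\<delta>\<^sup>2 / d\<^sup>2 \<le> 1" using d_ge by (simp add: divide_le_eq_1)
        qed (use kappa in auto)
        finally have 1: "\<sigma> / (1 - \<tau>) \<le> (1 - \<tau>) * \<delta>\<^sup>2 / 20000" by simp
        have 2: "4 * d * \<eta> = (1 - \<tau>) * \<delta>\<^sup>2 / 16" using d_ge by (simp add: \<eta>_def)
        have "e = 5 * (\<sigma> / (1 - \<tau>)) + 4 * d * \<eta>" by (simp add: e_def)
        also have "\<dots> \<le> 5 * ((1 - \<tau>) * \<delta>\<^sup>2 / 20000) + (1 - \<tau>) * \<delta>\<^sup>2 / 16" using 1 2 by linarith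
        also have "\<dots> \<le> (1 - \<tau>) * (\<delta>\<^sup>2 / 12)"
        proof -
          have "0 \<le> (1 - \<tau>) * \<delta>\<^sup>2" using kappa by simp
          then show ?thesis by simp
        qed
        finally have e1: "e \<le> (1 - \<tau>) * (\<delta>\<^sup>2 / 12)" .
        have "0 \<le> \<tau> ^ L" using tau by simp
        then have "e * (1 - \<tau> ^ L) \<le> e * 1" using e0 by (intro mult_left_mono) auto
        then have "e * (1 - \<tau> ^ L) / (1 - \<tau>) \<le> (1 - \<tau>) * (\<delta>\<^sup>2 / 12) / (1 - \<tau>)"
          using e1 kappa by (intro divide_right_mono) linarith+
        also have "\<dots> = \<delta>\<^sup>2 / 12" using kappa by (intro nonzero_mult_div_cancel_left) simp
        finally show ?thesis .
      qed
      moreover have "(\<delta> / 2)\<^sup>2 = \<delta>\<^sup>2 / 4" by (simp add: power2_eq_square)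
      ultimately show ?thesis using a(4) zero_le_power2[of \<delta>] by linarith
    qed
    then have "R \<le> \<delta> / 2" by (rule power2_le_imp_le) (use \<delta> in simp)
    moreover have "s + (q + 3) * (4 * (Q + 1) ^ L + 4) \<le> N_0 \<tau> dn (\<delta> / 6) ^ L"
    proof -
      have "\<delta> \<le> 1" using \<delta> by simp
      from picard_budget[OF d1 tau(2,1) True \<delta>(1) this Q_def[unfolded D_def dn] qd s[unfolded dn]]
      show ?thesis by (simp only: L_def)
    qed
    ultimately show ?thesis by (intro bound[OF a(2,1)])
  next
    case False
    then have \<tau>: "1 - \<tau> \<le> 1 / 16" by simp
    define P where "P = nat \<lceil>16 * D\<rceil>"
    define n where "n = nat \<lceil>exp (160 / (1 - \<tau>))\<rceil>"
    define S where "S = nat \<lceil>log 2 (2 * D)\<rceil>"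
    have l0: "0 \<le> log 2 (2 * D)" using D by simp
    have "2 * D = 2 powr (log 2 (2 * D))" using D by simp
    also have "\<dots> \<le> 2 powr real S" unfolding S_def by (intro powr_mono real_nat_ceiling_ge) auto
    also have "\<dots> = 2 ^ S" by (simp add: powr_realpow)
    finally have S1: "2 * D \<le> 2 ^ S" .
    have "2 ^ S = 2 powr real S" by (simp add: powr_realpow)
    also have "\<dots> \<le> 2 powr (log 2 (2 * D) + 1)" unfolding S_def using l0 by (intro powr_mono nat_ceiling_le_add_one) auto
    also have "\<dots> = 4 * D" using D by (simp add: powr_add)
    finally have S2: "2 ^ S \<le> 4 * D" .
    have nge: "exp (160 / (1 - \<tau>)) \<le> real n" unfolding n_def by (rule real_nat_ceiling_ge)
    have n1: "1 \<le> n"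
    proof -
      have "0 < real n" using nge exp_gt_zero less_le_trans by blast
      then show ?thesis by simp
    qed
    have "ln (exp (160 / (1 - \<tau>))) \<le> ln (real n + 1)" using nge exp_gt_zero[of "160 / (1 - \<tau>)"] by (intro ln_mono) linarith+
    then have W: "160 / (1 - \<tau>) \<le> ln (real n + 1)" by simp
    have \<rho>: "0 < \<delta> / 2" "8 * d / (\<delta> / 2) \<le> real P" "\<sigma> \<le> (1 - \<tau>) * (\<delta> / 2)\<^sup>2 / 160"
    proof -
      show "0 < \<delta> / 2" using \<delta> by simp
      have "8 * d / (\<delta> / 2) = 16 * D" by (simp add: D_def)
      also have "\<dots> \<le> real P" unfolding P_def by (rule real_nat_ceiling_ge)
      finally show "8 * d / (\<delta> / 2) \<le> real P" .
      have "\<sigma> = ((1 - \<tau>) * \<delta>\<^sup>2 / 20000) * ((1 - \<tau>) * \<delta>\<^sup>2 / d\<^sup>2)"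
        by (simp add: \<sigma> power2_eq_square power4_eq_xxxx)
      also have "\<dots> \<le> ((1 - \<tau>) * \<delta>\<^sup>2 / 20000) * 1"
      proof (rule mult_left_mono)
        have "\<delta>\<^sup>2 \<le> d\<^sup>2" using \<delta> d_ge by (intro power_mono) auto
        moreover have "(1 - \<tau>) * \<delta>\<^sup>2 \<le> 1 * \<delta>\<^sup>2" using kappa by (intro mult_right_mono) auto
        ultimately show "(1 - \<tau>) * \<delta>\<^sup>2 / d\<^sup>2 \<le> 1" using d_ge by (simp add: divide_le_eq_1)
      qed (use kappa in auto)
      also have "\<dots> \<le> (1 - \<tau>) * (\<delta> / 2)\<^sup>2 / 160"
        using kappa by (simp add: power_divide)
      finally show "\<sigma> \<le> (1 - \<tau>) * (\<delta> / 2)\<^sup>2 / 160" .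
    qed
    have R0: "\<delta> / 2 * 2 ^ S \<le> 2 * d" using S2 \<delta> by (simp add: D_def pos_le_divide_eq mult.commute)
    obtain a p where a: "a \<le> 1 + (4 * (P * (4 * n) + 1) ^ S - 4)" "near a a p (d / 2 ^ S)"
      using kernel_iterate[OF n1 W \<tau> \<rho> near_diam[OF p0] order_refl R0 order_refl] by auto
    have "d / 2 ^ S \<le> \<delta> / 2" using S1 \<delta> by (simp add: D_def field_simps)
    moreover have "s + (q + 3) * (4 * (P * (4 * n) + 1) ^ S + 4) \<le> N_0 \<tau> dn (\<delta> / 6) ^ L"
      using kernel_budget[OF d1 tau \<tau> \<delta> S2[unfolded D_def dn] n_def P_def[unfolded D_def dn] qd s[unfolded dn]]
      by (simp only: L_def)
    ultimately show ?thesis by (intro bound[OF a(2,1)])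
  qed
qed

end

section \<open>Metastability and the approximate variational inequality\<close>

theorem theorem6p11:
  fixes C :: "'a :: {real_inner, complete_space} set"
    and T G :: "'a \<Rightarrow> 'a"
    and d :: nat
    and \<tau> :: real
    and lam :: "nat \<Rightarrow> real"
    and h chi :: "nat \<Rightarrow> nat"
    and \<phi>1 \<phi>2 :: "real \<Rightarrow> nat"
    and u :: "nat \<Rightarrow> 'a"
  assumes "d \<ge> 1"
    and "C \<noteq> {}" and "bounded C" and "closed C" and "convex C"
    and "diameter C \<le> real d"
    and "T \<in> C \<rightarrow> C" and "1-lipschitz_on C T"
    and "0 < \<tau>" and "\<tau> < 1"
    and "G \<in> C \<rightarrow> C" and "\<tau>-lipschitz_on C G"
    and "\<And>n. 0 < lam n \<and> lam n \<le> 1"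
    and "lam \<longlonglongrightarrow> 0"
    and "\<And>n. h n > 0" and "\<And>n. lam n \<ge> 1 / real (h n)"
    and "\<And>n i. i \<ge> chi n \<Longrightarrow> lam i \<le> 1 / (real n + 1)"
    and "\<And>k. k > 0 \<Longrightarrow> (\<Sum>i=1..\<phi>1 k. lam i) \<ge> k"
    and "\<And>e n. e > 0 \<Longrightarrow> n \<ge> \<phi>2 e \<Longrightarrow> \<bar>lam n - lam (n + 1)\<bar> / (lam (n + 1))\<^sup>2 \<le> e"
    and "u 0 \<in> C"
    and "\<And>n. u (n + 1) = (1 - lam (n + 1)) *\<^sub>R T (u n) + lam (n + 1) *\<^sub>R G (T (u n))"
  shows "\<forall>\<epsilon>. 0 < \<epsilon> \<and> \<epsilon> \<le> 1 \<longrightarrow> (\<forall>g :: nat \<Rightarrow> nat. \<forall>x\<in>C.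
    (let \<delta> = \<epsilon> / (2 * real d * (2 + \<tau>));
         c = \<phi>1 (1 / \<tau> * (real (\<phi>2 (\<delta> / 6)) + ln (6 * real d / \<delta>)));
         g_c = (\<lambda>n. n + c + g (n + c));
         \<epsilon>' = 1 / real (k_i0 \<tau> chi h d (\<delta> / 6) g_c)
     in \<exists>n \<le> Xi \<tau> (\<delta> / 6) g_c chi h d + c.
          (\<forall>i\<in>{n..n + g n}. \<forall>j\<in>{n..n + g n}. norm (u i - u j) \<le> \<epsilon>) \<and>
          (norm (T x - x) \<le> \<epsilon>' \<longrightarrow> inner (G (u n) - u n) (x - u n) \<le> \<epsilon>)))"
proof (intro allI impI ballI)
  fix \<epsilon> :: real and g :: "nat \<Rightarrow> nat" and x
  assume \<epsilon>: "0 < \<epsilon> \<and> \<epsilon> \<le> 1" and x: "x \<in> C"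
  note d1 = assms(1) and tau = assms(9,10)
  define \<delta> where "\<delta> = \<epsilon> / (2 * real d * (2 + \<tau>))"
  define c where "c = \<phi>1 (1 / \<tau> * (real (\<phi>2 (\<delta> / 6)) + ln (6 * real d / \<delta>)))"
  define g_c where "g_c = (\<lambda>n. n + c + g (n + c))"
  define \<sigma> where "\<sigma> = (1 - \<tau>)\<^sup>2 * \<delta> ^ 4 / (20000 * (real d)\<^sup>2)"
  define q where "q = nat \<lceil>1 / (1 - \<tau>)\<rceil>"
  define s where "s = nat \<lceil>160000 * (real d / \<delta>) ^ 4 / (1 - \<tau>) ^ 3\<rceil>"
  define t where "t = tilde_pos d (f_base \<tau> chi h d (\<delta> / 6) g_c)"
  define k where "k i = (t ^^ (s + (q + 3) * i)) 1" for i
  \<comment> \<open>the largest nondecreasing function below \<open>chi\<close>; it is still a modulus for the convergence of \<open>lam\<close>\<close>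
  define chi' where "chi' m = (LEAST v. \<exists>m'\<ge>m. v = chi m')" for m
  define first where "first i = chi' (d * k i) + c" for i
  define last where "last i = maj (g_tilde g_c) (chi' (d * k i))" for i
  define K where "K i = real (k i)" for i
  define Lam where "Lam i = real (maj h (maj (g_tilde g_c) (chi (d * k i))))" for i
  have \<delta>: "0 < \<delta>" "\<delta> \<le> 1 / 4" "\<delta> \<le> \<epsilon>" "(2 + \<tau>) * \<delta> * real d = \<epsilon> / 2"
  proof -
    have "2 * real d * (2 + \<tau>) \<ge> 2 * 1 * 2" using d1 tau by (intro mult_mono) auto
    then have b: "4 \<le> 2 * real d * (2 + \<tau>)" by simp
    show "0 < \<delta>" using \<epsilon> b by (simp add: \<delta>_def)
    have "\<delta> \<le> \<epsilon> / 4" unfolding \<delta>_def using b \<epsilon> by (intro divide_left_mono) auto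
    then show "\<delta> \<le> 1 / 4" "\<delta> \<le> \<epsilon>" using \<epsilon> by linarith+
    show "(2 + \<tau>) * \<delta> * real d = \<epsilon> / 2" 
    proof -
      have "A * (e / (2 * D * A)) * D = e / 2" if "A \<noteq> 0" "D \<noteq> 0" for A D e :: real using that by simp
      then show ?thesis unfolding \<delta>_def using d1 tau by simp
    qed
  qed
  \<comment> \<open>\<open>c\<close> terms of size at most \<open>1\<close> sum up to at least \<open>\<phi>2 (\<delta>/6)\<close>\<close>
  have c: "1 \<le> c" "\<phi>2 (\<delta> / 6) \<le> c"
  proof -
    let ?k = "1 / \<tau> * (real (\<phi>2 (\<delta> / 6)) + ln (6 * real d / \<delta>))"
    have "\<delta> < 6 * real d" using \<delta> d1 by linarith
    then have "0 < ln (6 * real d / \<delta>)" using \<delta> by (intro ln_gt_zero) (simp add: pos_less_divide_eq)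
    then have l: "0 < real (\<phi>2 (\<delta> / 6)) + ln (6 * real d / \<delta>)"
      "real (\<phi>2 (\<delta> / 6)) \<le> real (\<phi>2 (\<delta> / 6)) + ln (6 * real d / \<delta>)" by linarith+
    then have k0: "0 < ?k" using tau by simp
    have "1 * (real (\<phi>2 (\<delta> / 6)) + ln (6 * real d / \<delta>)) \<le> ?k"
      using tau l by (intro mult_right_mono) (auto simp: pos_le_divide_eq)
    then have k1: "real (\<phi>2 (\<delta> / 6)) \<le> ?k" using l(2) unfolding mult_1_left by (rule order_trans[rotated])
    have "?k \<le> (\<Sum>i=1..c. lam i)" unfolding c_def by (rule assms(18)[OF k0])
    also have "\<dots> \<le> (\<Sum>i=1..c. 1)" using assms(13) by (intro sum_mono) auto
    finally have "?k \<le> real c" by simp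
    then have "0 < real c" "real (\<phi>2 (\<delta> / 6)) \<le> real c" using k0 k1 by linarith+
    then show "1 \<le> c" "\<phi>2 (\<delta> / 6) \<le> c" by auto
  qed
  have chi': "\<exists>m'\<ge>m. chi' m = chi m'" "m \<le> m'' \<Longrightarrow> chi' m \<le> chi m''" for m m''
  proof -
    have "\<exists>v. \<exists>m'\<ge>m. v = chi m'" by blast
    from LeastI_ex[OF this] show "\<exists>m'\<ge>m. chi' m = chi m'" by (simp add: chi'_def)
    show "m \<le> m'' \<Longrightarrow> chi' m \<le> chi m''" unfolding chi'_def by (rule Least_le) blast
  qed
  have chi'_mono: "chi' m \<le> chi' m''" if "m \<le> m''" for m m''
    using chi'(1)[of m''] chi'(2)[of m] that by (metis order_trans)
  have chi'_lam: "lam i \<le> 1 / (real m + 1)" if "chi' m \<le> i" for i m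
  proof -
    obtain m' where m': "m \<le> m'" "chi' m = chi m'" using chi'(1)[of m] by blast
    then have "lam i \<le> 1 / (real m' + 1)" using assms(17)[of m' i] that by simp
    also have "\<dots> \<le> 1 / (real m + 1)" using m' by (intro divide_left_mono) auto
    finally show ?thesis .
  qed
  have k_Suc: "k (Suc i) = (t ^^ (q + 3)) (k i)" for i
  proof -
    have "k (Suc i) = (t ^^ ((q + 3) + (s + (q + 3) * i))) 1" by (simp add: k_def add_ac)
    also have "\<dots> = (t ^^ (q + 3)) (k i)" unfolding funpow_add k_def by simp
    finally show ?thesis .
  qed
  have k_mono: "k i \<le> k j" if "i \<le> j" for i j
    unfolding k_def t_def using that by (intro iterate_mono_count[OF d1]) simp
  have kappa: "0 < 1 - \<tau>" using tau by simp
  have d2: "1 \<le> (real d)\<^sup>2" by (rule one_le_power) (use d1 in simp)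
  have \<sigma>: "0 < \<sigma>" "\<sigma> \<le> 1" "\<sigma> \<le> \<delta> / 8"
  proof -
    have "0 < (1 - \<tau>)\<^sup>2 * \<delta> ^ 4" using kappa \<delta> by simp
    then show "0 < \<sigma>" using d1 by (simp add: \<sigma>_def)
    have "(1 - \<tau>)\<^sup>2 * \<delta> ^ 4 \<le> 1 * \<delta> ^ 1"
      using kappa tau \<delta> by (intro mult_mono power_decreasing) (auto intro: power_le_one)
    moreover have "8 \<le> 20000 * (real d)\<^sup>2" using d2 by linarith
    ultimately show "\<sigma> \<le> \<delta> / 8" unfolding \<sigma>_def using \<delta> by (intro frac_le) auto
    then show "\<sigma> \<le> 1" using \<delta> by linarith
  qed
  have K_0: "8 * (real d)\<^sup>2 / ((1 - \<tau>) * \<sigma>) \<le> K 0"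
  proof -
    have "8 * (real d)\<^sup>2 / ((1 - \<tau>) * \<sigma>) = 160000 * (real d / \<delta>) ^ 4 / (1 - \<tau>) ^ 3"
      using kappa d1 \<delta> by (simp add: \<sigma>_def power_divide power2_eq_square power3_eq_cube power4_eq_xxxx mult_ac)
    also have "\<dots> \<le> real s" unfolding s_def by (rule real_nat_ceiling_ge)
    also have "s \<le> 2 ^ s" using less_exp[of s] by simp
    also have "\<dots> \<le> k 0" unfolding k_def t_def using iterate_ge_two_power[OF d1] by simp
    finally show ?thesis by (simp add: K_def)
  qed
  have kappa_k: "1 \<le> (1 - \<tau>) * real (k i)" for i
  proof -
    have "\<sigma> \<le> 8 * (real d)\<^sup>2" using \<sigma>(2) d2 by linarith
    then have "1 \<le> 8 * (real d)\<^sup>2 / \<sigma>" using \<sigma>(1) by (simp add: pos_le_divide_eq)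
    also have "\<dots> = (1 - \<tau>) * (8 * (real d)\<^sup>2 / ((1 - \<tau>) * \<sigma>))" using kappa by simp
    also have "\<dots> \<le> (1 - \<tau>) * K 0" using K_0 kappa by (intro mult_left_mono) auto
    also have "\<dots> \<le> (1 - \<tau>) * real (k i)" unfolding K_def
      using kappa k_mono[of 0 i] by (intro mult_left_mono) auto
    finally show ?thesis .
  qed
  have k_pos: "1 \<le> k i" for i using kappa_k[of i] by (cases "k i") auto
  have dist_C: "norm (y - w) \<le> real d" if "y \<in> C" "w \<in> C" for y w
    using diameter_bounded_bound[OF assms(3) that] assms(6) by (simp add: dist_norm)
  have T_in: "T y \<in> C" and G_in: "G y \<in> C" if "y \<in> C" for y
    using assms(7,11) that by auto
  have T_ne: "norm (T y - T w) \<le> norm (y - w)" if "y \<in> C" "w \<in> C" for y w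
    using lipschitz_onD[OF assms(8) that] by (simp add: dist_norm)
  have G_contr: "norm (G y - G w) \<le> \<tau> * norm (y - w)" if "y \<in> C" "w \<in> C" for y w
    using lipschitz_onD[OF assms(12) that] by (simp add: dist_norm)
  have g_c_le: "g_c (chi' (d * k i)) \<le> last i" for i
    unfolding last_def using maj_ge[of "chi' (d * k i)" "chi' (d * k i)" "g_tilde g_c"]
    by (simp add: g_tilde_def)
  interpret V: viscosity_stages C T "\<lambda>y. G (T y)" "real d" \<tau> lam u K Lam first last \<sigma> q
  proof unfold_locales
    show "norm (G (T y) - G (T w)) \<le> \<tau> * norm (y - w)" if "y \<in> C" "w \<in> C" for y w
      using G_contr[OF T_in[OF that(1)] T_in[OF that(2)]] mult_left_mono[OF T_ne[OF that], of \<tau>] tau by linarith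
    show "u (Suc j) = (1 - lam (Suc j)) *\<^sub>R T (u j) + lam (Suc j) *\<^sub>R G (T (u j))" for j
      using assms(21)[of j] by simp
    show "\<bar>lam j - lam (Suc j)\<bar> \<le> (lam (Suc j))\<^sup>2" if "first 0 \<le> j" for j
    proof -
      have l: "0 < (lam (Suc j))\<^sup>2" using assms(13)[of "Suc j"] by simp
      have "\<bar>lam j - lam (Suc j)\<bar> / (lam (Suc j))\<^sup>2 \<le> \<delta> / 6"
        using assms(19)[of "\<delta> / 6" j] \<delta> that c by (simp add: first_def)
      also have "\<dots> \<le> 1" using \<delta> by linarith
      finally show ?thesis using l by (simp add: pos_divide_le_eq)
    qed
    show "1 \<le> first 0" using c by (simp add: first_def)
    show "first i \<le> first j" if "i \<le> j" for i j
      using chi'_mono k_mono[OF that] by (simp add: first_def)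
    show "last i \<le> last j" if "i \<le> j" for i j
      unfolding last_def using k_mono[OF that] by (intro maj_mono chi'_mono mult_left_mono) auto
    show "first i \<le> last i" for i
      using g_c_le[of i] by (simp add: first_def g_c_def)
    show "lam j \<le> 1 / K i" if "first i \<le> j" for i j
    proof -
      have "lam j \<le> 1 / (real (d * k i) + 1)" using that by (intro chi'_lam) (simp add: first_def)
      also have "\<dots> \<le> 1 / K i"
      proof (rule divide_left_mono)
        have "1 * k i \<le> d * k i" using d1 by (intro mult_right_mono) auto
        then have "real (k i) \<le> real (d * k i)" by (simp only: of_nat_le_iff mult_1)
        then show "K i \<le> real (d * k i) + 1" unfolding K_def by linarith
      qed (use k_pos[of i] in \<open>auto simp: K_def intro!: mult_pos_pos add_nonneg_pos\<close>)
      finally show ?thesis .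
    qed
    show "1 / Lam i \<le> lam j" if "j \<le> last i" for i j
    proof -
      have "h j \<le> maj h (last i)" using that by (rule maj_ge)
      also have "\<dots> \<le> maj h (maj (g_tilde g_c) (chi (d * k i)))"
        unfolding last_def by (intro maj_mono chi'(2)) simp
      finally have "1 / Lam i \<le> 1 / real (h j)"
        unfolding Lam_def using assms(15)[of j] by (intro divide_left_mono) auto
      then show ?thesis using assms(16)[of j] by linarith
    qed
    show "1 \<le> Lam i" for i
      using maj_ge[of 0 "maj (g_tilde g_c) (chi (d * k i))" h] assms(15)[of 0] by (simp add: Lam_def)
    show "1 \<le> real q * (1 - \<tau>)"
    proof -
      have "1 / (1 - \<tau>) \<le> real q" unfolding q_def by (rule real_nat_ceiling_ge)
      then show ?thesis using kappa by (simp only: pos_divide_le_eq)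
    qed
    show "8 * (real d)\<^sup>2 / ((1 - \<tau>) * \<sigma>) \<le> K 0" by (rule K_0)
    show "Lam i * K i ^ (2 * q) \<le> K (Suc i)" for i
      unfolding Lam_def K_def k_Suc t_def
      by (rule stage_growth[OF d1 _ _ tau(2) kappa_k]) (use \<delta> in auto)
  qed (use assms(1-5,13,20) dist_C T_in T_ne G_in tau \<sigma> in auto)
  obtain a p where near: "V.near a a p (\<delta> / 2)"
    and budget: "s + (q + 3) * Suc a \<le> N_0 \<tau> d (\<delta> / 6) ^ max 1 (i_0 \<tau> d (\<delta> / 6))"
    using V.settled_stage_exists[OF refl \<delta>(1,2) \<sigma>_def q_def s_def] by blast
  define k\<^sub>i\<^sub>0 where "k\<^sub>i\<^sub>0 = k_i0 \<tau> chi h d (\<delta> / 6) g_c"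
  have k_le: "k (Suc a) \<le> k\<^sub>i\<^sub>0"
  proof -
    have "k (Suc a) \<le> (t ^^ (N_0 \<tau> d (\<delta> / 6) ^ max 1 (i_0 \<tau> d (\<delta> / 6)))) 1"
      unfolding k_def t_def using budget by (rule iterate_mono_count[OF d1])
    also have "\<dots> \<le> k\<^sub>i\<^sub>0" unfolding k\<^sub>i\<^sub>0_def k_i0_def t_def by (rule k_seq_ge_iterate[OF d1])
    finally show ?thesis .
  qed
  define n where "n = first a"
  have n_le: "n \<le> Xi \<tau> (\<delta> / 6) g_c chi h d + c"
  proof -
    have "k a \<le> k\<^sub>i\<^sub>0" using k_mono[of a "Suc a"] k_le by simp
    then show ?thesis unfolding n_def first_def Xi_def k\<^sub>i\<^sub>0_def by (simp add: chi'(2))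
  qed
  have n_last: "n + g n \<le> last a" using g_c_le[of a] by (simp add: n_def first_def g_c_def)
  have u_p: "norm (u j - p) \<le> \<delta> / 2" if "j \<in> {n..n + g n}" for j
    using near that n_last unfolding V.near_def n_def by auto
  have osc: "norm (u i - u j) \<le> \<epsilon>" if "i \<in> {n..n + g n}" "j \<in> {n..n + g n}" for i j
    using norm_triangle_ineq4[of "u i - p" "u j - p"] u_p[OF that(1)] u_p[OF that(2)] \<delta>(3) by simp
  \<comment> \<open>the inequality for the resolvent \<open>z\<close> of stage \<open>a\<close> against \<open>x\<close>, transferred to \<open>u n\<close> at distance \<open>\<delta>\<close>\<close>
  have vi: "inner (G (u n) - u n) (x - u n) \<le> \<epsilon>" if res: "norm (T x - x) \<le> 1 / real k\<^sub>i\<^sub>0"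
  proof -
    define z U where "z = V.z a" and "U = u n"
    have zC: "z \<in> C" and UC: "U \<in> C" by (simp_all add: z_def U_def V.z_in V.u_in)
    have Uz: "norm (U - z) \<le> \<delta>"
    proof -
      have "norm (z - p) \<le> \<delta> / 2" using near by (auto simp: V.near_def z_def)
      moreover have "norm (U - p) \<le> \<delta> / 2" unfolding U_def by (rule u_p) simp
      ultimately show ?thesis using norm_triangle_ineq4[of "U - p" "z - p"] by simp
    qed
    have "norm (x - T x) \<le> 1 / K (Suc a)"
    proof -
      have "1 / real k\<^sub>i\<^sub>0 \<le> 1 / K (Suc a)" unfolding K_def
        using k_le k_pos[of "Suc a"] by (intro divide_left_mono) auto
      then show ?thesis using res by (simp add: norm_minus_commute)
    qed
    also have "\<dots> \<le> real d / K (Suc a)" using d1 V.K_pos[of "Suc a"] by (intro divide_right_mono) auto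
    finally have "(z - G (T z)) \<bullet> (x - z) \<ge> - \<sigma>"
      unfolding z_def V.z_def by (intro V.variational_fixed[OF V.contracts_F _ x, of a "Suc a"]) auto
    then have 1: "(G (T z) - z) \<bullet> (x - z) \<le> \<sigma>" by (simp add: inner_diff_left)
    have zT: "norm (z - T z) * real d \<le> \<sigma>"
    proof -
      have "norm (z - T z) \<le> real d / K a" unfolding z_def V.z_def by (rule V.resolvent_level[OF V.contracts_F order_refl])
      then have "norm (z - T z) * real d \<le> real d / K a * real d" by (intro mult_right_mono) auto
      also have "\<dots> \<le> 8 * (real d)\<^sup>2 / K a"
        using V.K_pos[of a] by (simp add: power2_eq_square divide_right_mono)
      also have "\<dots> \<le> (1 - \<tau>) * \<sigma>" by (rule V.inverse_K)
      also have "\<dots> \<le> 1 * \<sigma>" using tau \<sigma> by (intro mult_right_mono) auto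
      finally show ?thesis by simp
    qed
    have "norm (G U - G (T z)) \<le> \<tau> * (\<delta> + norm (z - T z))"
    proof -
      have "norm (U - T z) \<le> \<delta> + norm (z - T z)" using norm_triangle_ineq[of "U - z" "z - T z"] Uz by simp
      then have "\<tau> * norm (U - T z) \<le> \<tau> * (\<delta> + norm (z - T z))" using tau by (intro mult_left_mono) auto
      then show ?thesis using G_contr[OF UC T_in[OF zC]] by linarith
    qed
    then have "norm ((G U - G (T z)) - (U - z)) \<le> \<tau> * (\<delta> + norm (z - T z)) + \<delta>"
      using norm_triangle_ineq4[of "G U - G (T z)" "U - z"] Uz by linarith
    then have "norm ((G U - G (T z)) - (U - z)) * norm (x - U) \<le> (\<tau> * (\<delta> + norm (z - T z)) + \<delta>) * real d"
      using dist_C[OF x UC] tau \<delta>(1) by (intro mult_mono) auto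
    then have 2: "((G U - G (T z)) - (U - z)) \<bullet> (x - U) \<le> (\<tau> * (\<delta> + norm (z - T z)) + \<delta>) * real d"
      using norm_cauchy_schwarz[of "(G U - G (T z)) - (U - z)" "x - U"] by linarith
    have "norm (G (T z) - z) * norm (z - U) \<le> real d * \<delta>"
      using dist_C[OF G_in[OF T_in[OF zC]] zC] Uz by (intro mult_mono) (auto simp: norm_minus_commute)
    then have 3: "(G (T z) - z) \<bullet> (z - U) \<le> real d * \<delta>"
      using norm_cauchy_schwarz[of "G (T z) - z" "z - U"] by linarith
    have "(G U - U) \<bullet> (x - U) = (G (T z) - z) \<bullet> (x - z) + ((G U - G (T z)) - (U - z)) \<bullet> (x - U) + (G (T z) - z) \<bullet> (z - U)"
      by (simp add: inner_diff_left inner_diff_right)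
    also have "\<dots> \<le> \<sigma> + (\<tau> * (\<delta> + norm (z - T z)) + \<delta>) * real d + real d * \<delta>"
      using 1 2 3 by linarith
    also have "\<dots> = \<sigma> + (2 + \<tau>) * \<delta> * real d + \<tau> * (norm (z - T z) * real d)" by (simp add: algebra_simps)
    also have "\<dots> \<le> \<sigma> + \<epsilon> / 2 + 1 * \<sigma>"
      unfolding \<delta>(4) using zT tau \<sigma> by (intro add_mono mult_mono) auto
    also have "\<dots> \<le> \<epsilon>" using \<sigma>(3) \<delta>(1,3) by linarith
    finally show ?thesis by (simp add: U_def)
  qed
  have "\<exists>n \<le> Xi \<tau> (\<delta> / 6) g_c chi h d + c.
          (\<forall>i\<in>{n..n + g n}. \<forall>j\<in>{n..n + g n}. norm (u i - u j) \<le> \<epsilon>) \<and>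
          (norm (T x - x) \<le> 1 / real (k_i0 \<tau> chi h d (\<delta> / 6) g_c) \<longrightarrow> inner (G (u n) - u n) (x - u n) \<le> \<epsilon>)"
    using n_le osc vi unfolding k\<^sub>i\<^sub>0_def by blast
  then show "let \<delta> = \<epsilon> / (2 * real d * (2 + \<tau>));
         c = \<phi>1 (1 / \<tau> * (real (\<phi>2 (\<delta> / 6)) + ln (6 * real d / \<delta>)));
         g_c = (\<lambda>n. n + c + g (n + c));
         \<epsilon>' = 1 / real (k_i0 \<tau> chi h d (\<delta> / 6) g_c)
     in \<exists>n \<le> Xi \<tau> (\<delta> / 6) g_c chi h d + c.
          (\<forall>i\<in>{n..n + g n}. \<forall>j\<in>{n..n + g n}. norm (u i - u j) \<le> \<epsilon>) \<and>
          (norm (T x - x) \<le> \<epsilon>' \<longrightarrow> inner (G (u n) - u n) (x - u n) \<le> \<epsilon>)"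
    unfolding Let_def g_c_def c_def \<delta>_def .
qed

end
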